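(* Let $m\ge 3$ be a fixed integer and let $G\sim\mathcal{PA}(m;n)$. Then $$H(S(G)) = (m-1)\,n\log n + R(n),$$ where $R(n)$ satisfies $$Cn \le |R(n)| \le O(n\log\log n)$$ for some nonzero constant $C=C(m)$.
   Context: Preferential attachment model: for an integer $m\ge 1$, $\mathcal{PA}(m;n)$ is the distribution of the random multigraph $G_n$ on vertex set $[n]=\{1,\dots,n\}$ built recursively as follows. $G_1$ is the single vertex $1$ with $m$ self-loops (these are the only self-loops in the graph, and each is counted once in the degree of vertex $1$). Given $G_n$, add vertex $n+1$ and let it make $m$ random choices $v_1,\dots,v_m\in[n]$ of neighbors with $$P(v_i = w \mid G_n, v_1,\dots,v_{i-1}) = \frac{\deg_n(w)}{\sum_{u\in[n]}\deg_n(u)} = \frac{\deg_n(w)}{2mn-m},\qquad w\in[n],$$ where $\deg_n(w)$ is the degree of $w$ in $G_n$ (multiplicities counted); one edge joins $n+1$ to each $v_i$, so multiple edges may occur. The result is $G_{n+1}\sim\mathcal{PA}(m;n+1)$. $S(G)$ denotes the structure (isomorphism class, i.e. unlabeled version) of the labeled multigraph $G$, where an isomorphism is a bijection of vertex sets preserving the number of edges between every pair of vertices. $H(S(G))$ is the Shannon entropy of the random variable $S(G)$ (the structural entropy), with logarithms in the same base as in the statement. Asymptotic notation is as $n\to\infty$ with $m$ fixed. *)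

theory Defs
  imports "HOL-Probability.Probability" "HOL-Library.Landau_Symbols" "HOL-Library.Uprod"
begin

datatype multigraph = Multigraph (order: nat) (edges: "nat uprod multiset")

definition verts :: "multigraph \<Rightarrow> nat set" where
  "verts G = {1..order G}"

definition edge_mult :: "multigraph \<Rightarrow> nat \<Rightarrow> nat \<Rightarrow> nat" where
  "edge_mult G u v = count (edges G) (Upair u v)"

text \<open>Multiplicities are counted, but a self-loop contributes only one to the degree.\<close>

definition deg :: "multigraph \<Rightarrow> nat \<Rightarrow> nat" where
  "deg G w = size {#e \<in># edges G. w \<in> set_uprod e#}"

definition isomorphic :: "multigraph \<Rightarrow> multigraph \<Rightarrow> bool" where
  "isomorphic G H \<longleftrightarrow> (\<exists>f. bij_betw f (verts G) (verts H) \<and>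
     (\<forall>u\<in>verts G. \<forall>v\<in>verts G. edge_mult H (f u) (f v) = edge_mult G u v))"

definition structure_of :: "multigraph \<Rightarrow> multigraph set" where
  "structure_of G = {H. isomorphic G H}"

definition attach_prob :: "multigraph \<Rightarrow> nat \<Rightarrow> real" where
  "attach_prob G w = (if w \<in> verts G then real (deg G w) / real (\<Sum>u\<in>verts G. deg G u) else 0)"

text \<open>Only meaningful if some vertex has positive degree; see \<open>pmf_attach_pmf\<close>.\<close>

definition attach_pmf :: "multigraph \<Rightarrow> nat pmf" where
  "attach_pmf G = embed_pmf (attach_prob G)"

definition add_vertex :: "multigraph \<Rightarrow> nat list \<Rightarrow> multigraph" where
  "add_vertex G vs =
     Multigraph (Suc (order G)) (edges G + mset (map (Upair (Suc (order G))) vs))"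

text \<open>
  The law of a choice does not depend on the earlier choices of the same new vertex, so the
  \<open>m\<close> choices are independent given the current graph.  The value at \<open>0\<close> is a dummy.
\<close>

fun PA :: "nat \<Rightarrow> nat \<Rightarrow> multigraph pmf" where
  "PA m 0 = return_pmf (Multigraph 0 {#})"
| "PA m (Suc 0) = return_pmf (Multigraph 1 (replicate_mset m (Upair 1 1)))"
| "PA m (Suc (Suc n)) =
     bind_pmf (PA m (Suc n)) (\<lambda>G. map_pmf (add_vertex G) (replicate_pmf m (attach_pmf G)))"

definition structural_entropy :: "real \<Rightarrow> multigraph pmf \<Rightarrow> real" where
  "structural_entropy b p =
     prob_space.entropy (measure_pmf p) b (count_space (range structure_of)) structure_of"


lemma isomorphic_refl: "isomorphic G G"
  unfolding isomorphic_def by (rule exI[of _ id]) auto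

lemma isomorphic_sym:
  assumes "isomorphic G H"
  shows "isomorphic H G"
proof -
  obtain f where f: "bij_betw f (verts G) (verts H)"
    and e: "\<And>u v. u \<in> verts G \<Longrightarrow> v \<in> verts G \<Longrightarrow> edge_mult H (f u) (f v) = edge_mult G u v"
    using assms unfolding isomorphic_def by blast
  let ?g = "inv_into (verts G) f"
  have g: "bij_betw ?g (verts H) (verts G)"
    using f by (rule bij_betw_inv_into)
  have "edge_mult G (?g u) (?g v) = edge_mult H u v" if "u \<in> verts H" "v \<in> verts H" for u v
    using e[of "?g u" "?g v"] that g f
    by (simp add: bij_betw_apply bij_betw_inv_into_right)
  with g show ?thesis unfolding isomorphic_def by blast
qed

lemma isomorphic_trans:
  assumes "isomorphic G H" "isomorphic H K"
  shows "isomorphic G K"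
proof -
  obtain f where f: "bij_betw f (verts G) (verts H)"
    and e: "\<And>u v. u \<in> verts G \<Longrightarrow> v \<in> verts G \<Longrightarrow> edge_mult H (f u) (f v) = edge_mult G u v"
    using assms(1) unfolding isomorphic_def by blast
  obtain g where g: "bij_betw g (verts H) (verts K)"
    and e': "\<And>u v. u \<in> verts H \<Longrightarrow> v \<in> verts H \<Longrightarrow> edge_mult K (g u) (g v) = edge_mult H u v"
    using assms(2) unfolding isomorphic_def by blast
  have "bij_betw (g \<circ> f) (verts G) (verts K)"
    using f g by (rule bij_betw_trans)
  moreover have "edge_mult K ((g \<circ> f) u) ((g \<circ> f) v) = edge_mult G u v"
    if "u \<in> verts G" "v \<in> verts G" for u v
    using that f by (simp add: e e' bij_betw_apply)
  ultimately show ?thesis unfolding isomorphic_def by blast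
qed

lemma structure_of_eq_iff: "structure_of G = structure_of H \<longleftrightarrow> isomorphic G H"
  unfolding structure_of_def using isomorphic_refl isomorphic_sym isomorphic_trans by blast

lemma pmf_attach_pmf:
  assumes "(\<Sum>u\<in>verts G. deg G u) > 0"
  shows "pmf (attach_pmf G) w = attach_prob G w"
  unfolding attach_pmf_def
proof (rule pmf_embed_pmf)
  show "\<And>x. 0 \<le> attach_prob G x" by (simp add: attach_prob_def sum_nonneg)
  have fin: "finite (verts G)" by (simp add: verts_def)
  have "(\<integral>\<^sup>+x. ennreal (attach_prob G x) \<partial>count_space UNIV)
      = (\<Sum>x\<in>verts G. ennreal (attach_prob G x))"
    by (rule nn_integral_count_space'[OF fin]) (auto simp: attach_prob_def)
  also have "\<dots> = ennreal (\<Sum>x\<in>verts G. attach_prob G x)"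
    by (rule sum_ennreal) (simp add: attach_prob_def sum_nonneg)
  also have "(\<Sum>x\<in>verts G. attach_prob G x) = 1"
    using assms by (simp add: attach_prob_def flip: sum_divide_distrib of_nat_sum)
  finally show "(\<integral>\<^sup>+x. ennreal (attach_prob G x) \<partial>count_space UNIV) = 1" by simp
qed

lemma sum_deg_add_vertex:
  assumes wf: "\<And>e. e \<in># edges G \<Longrightarrow> set_uprod e \<subseteq> verts G"
    and vs: "set vs \<subseteq> verts G"
  shows "(\<Sum>u\<in>verts (add_vertex G vs). deg (add_vertex G vs) u)
       = (\<Sum>u\<in>verts G. deg G u) + 2 * length vs"
proof -
  let ?n = "Suc (order G)"
  have V: "verts (add_vertex G vs) = insert ?n (verts G)" "?n \<notin> verts G" "finite (verts G)"
    by (auto simp: verts_def add_vertex_def)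
  have d: "deg (add_vertex G vs) w = deg G w + length (filter (\<lambda>v. w = ?n \<or> w = v) vs)" for w
    by (induction vs) (auto simp: deg_def add_vertex_def)
  have "{#e \<in># edges G. ?n \<in> set_uprod e#} = {#}"
    using wf V(2) by (force simp: multiset_eq_iff count_eq_zero_iff)
  then have "deg G ?n = 0"
    by (simp add: deg_def)
  moreover have "(\<Sum>u\<in>verts G. length (filter (\<lambda>v. u = ?n \<or> u = v) vs)) = length vs"
    using vs
  proof (induction vs)
    case (Cons a vs)
    have "(\<Sum>u\<in>verts G. length (filter (\<lambda>v. u = ?n \<or> u = v) (a # vs)))
      = (\<Sum>u\<in>verts G. (if u = a then 1 else 0) + length (filter (\<lambda>v. u = ?n \<or> u = v) vs))"
      using V(2) by (intro sum.cong) auto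
    also have "\<dots> = Suc (length vs)"
      using Cons V(3) by (simp add: sum.distrib)
    finally show ?case by simp
  qed simp
  ultimately show ?thesis
    using V by (simp add: d sum.distrib)
qed

lemma PA_invariant:
  assumes "m \<ge> 1" "n \<ge> 1" "G \<in> set_pmf (PA m n)"
  shows "order G = n" "\<forall>e\<in>#edges G. set_uprod e \<subseteq> verts G"
    "(\<Sum>u\<in>verts G. deg G u) = 2 * m * n - m"
proof -
  have "order G = n \<and> (\<forall>e\<in>#edges G. set_uprod e \<subseteq> verts G) \<and>
    (\<Sum>u\<in>verts G. deg G u) = 2 * m * n - m"
    using assms(2,3)
  proof (induction n arbitrary: G rule: dec_induct)
    case base
    have "{#e \<in># replicate_mset m (Upair 1 1). 1 \<in> set_uprod e#} = replicate_mset m (Upair (1::nat) 1)"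
      by (induction m) auto
    with base show ?case by (auto simp: verts_def deg_def)
  next
    case (step n)
    obtain k where k: "n = Suc k" using step(1) by (cases n) auto
    obtain G' vs where G': "G' \<in> set_pmf (PA m n)" and G: "G = add_vertex G' vs"
      and vs: "length vs = m" "set vs \<subseteq> set_pmf (attach_pmf G')"
      using step.prems unfolding k by (auto simp: set_replicate_pmf)
    note IH = step.IH[OF G']
    have "(\<Sum>u\<in>verts G'. deg G' u) > 0" using IH assms(1) k by simp
    then have sub: "set vs \<subseteq> verts G'"
      using vs(2) by (auto simp: set_pmf_iff pmf_attach_pmf attach_prob_def split: if_splits)
    have "(\<Sum>u\<in>verts G. deg G u) = 2 * m * n - m + 2 * m"
      using sum_deg_add_vertex[OF _ sub] IH vs(1) unfolding G by simp
    also have "\<dots> = 2 * m * Suc n - m"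
      using k by simp
    finally show ?case
      using IH sub unfolding G by (fastforce simp: add_vertex_def verts_def)
  qed
  then show "order G = n" "\<forall>e\<in>#edges G. set_uprod e \<subseteq> verts G"
    "(\<Sum>u\<in>verts G. deg G u) = 2 * m * n - m" by auto
qed

lemma countable_UNIV_multigraph: "countable (UNIV :: multigraph set)"
proof -
  let ?f = "\<lambda>(n, xs). Multigraph n (mset (map (\<lambda>(a, b). Upair a b) xs))"
  have "G \<in> range ?f" for G
  proof (cases G)
    case (Multigraph n E)
    obtain es where es: "E = mset es" by (metis ex_mset)
    have "\<exists>xs. es = map (\<lambda>(a, b). Upair a b) xs"
    proof (induction es)
      case (Cons e es)
      then obtain xs where "es = map (\<lambda>(a, b). Upair a b) xs" by blast
      moreover obtain a b where "e = Upair a b" by (cases e)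
      ultimately show ?case by (intro exI[of _ "(a, b) # xs"]) simp
    qed simp
    then show ?thesis using Multigraph es by force
  qed
  then have "UNIV = range ?f" by blast
  then show ?thesis by (metis countable_image countableI_type)
qed

lemma structural_entropy_eq_sum:
  assumes "b > 1" and fin: "finite (set_pmf p)"
  shows "structural_entropy b p = - (\<Sum>s\<in>structure_of ` set_pmf p.
     pmf (map_pmf structure_of p) s * log b (pmf (map_pmf structure_of p) s))"
proof -
  interpret information_space "measure_pmf p" b
    by unfold_locales (use assms in auto)
  let ?S = "count_space (range structure_of)" and ?q = "map_pmf structure_of p"
  have cnt: "countable (range structure_of)"
    using countable_UNIV_multigraph by (rule countable_image)
  interpret S: sigma_finite_measure ?S
    using cnt by (rule sigma_finite_measure_count_space_countable)
  have "distributed (measure_pmf p) ?S structure_of (pmf ?q)"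
    unfolding distributed_def
  proof (intro conjI)
    show "distr (measure_pmf p) ?S structure_of = density ?S (\<lambda>x. ennreal (pmf ?q x))"
    proof (rule measure_eqI_countable[OF _ _ cnt])
      fix a assume a: "a \<in> range structure_of"
      have "emeasure (distr (measure_pmf p) ?S structure_of) {a}
          = emeasure (measure_pmf p) (structure_of -` {a})"
        using a by (subst emeasure_distr) auto
      also have "\<dots> = ennreal (pmf ?q a)"
        by (simp add: pmf_map measure_pmf.emeasure_eq_measure)
      also have "\<dots> = emeasure (density ?S (\<lambda>x. ennreal (pmf ?q x))) {a}"
        using a by (subst emeasure_density) (auto simp: nn_integral_count_space_indicator)
      finally show "emeasure (distr (measure_pmf p) ?S structure_of) {a}
        = emeasure (density ?S (\<lambda>x. ennreal (pmf ?q x))) {a}" .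
    qed auto
  qed auto
  then have "structural_entropy b p = - (\<integral>x. pmf ?q x * log b (pmf ?q x) \<partial>?S)"
    unfolding structural_entropy_def by (rule entropy_distr) auto
  also have "(\<integral>x. pmf ?q x * log b (pmf ?q x) \<partial>?S)
      = (\<Sum>s\<in>structure_of ` set_pmf p. pmf ?q s * log b (pmf ?q s))"
  proof -
    have "(\<integral>x. pmf ?q x * log b (pmf ?q x) \<partial>?S)
      = (\<Sum>s | s \<in> range structure_of \<and> pmf ?q s * log b (pmf ?q s) \<noteq> 0. pmf ?q s * log b (pmf ?q s))"
      by (rule lebesgue_integral_count_space_finite_support)
        (rule finite_subset[OF _ finite_imageI[OF fin, of structure_of]],
         auto simp: pmf_eq_0_set_pmf)
    also have "\<dots> = (\<Sum>s\<in>structure_of ` set_pmf p. pmf ?q s * log b (pmf ?q s))"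
      by (rule sum.mono_neutral_left) (use fin in \<open>auto simp: pmf_eq_0_set_pmf\<close>)
    finally show ?thesis .
  qed
  finally show ?thesis .
qed

end

theory Submission
  imports Defs "HOL-Real_Asymp.Real_Asymp" "HOL-Combinatorics.Multiset_Permutations"
    "HOL-Combinatorics.Permutations"
begin

text \<open>
  Record the ordered choices of all vertices in a history \<open>h\<close> and let \<open>P h\<close> be its probability.

  Lower bound: a structure on \<open>n\<close> vertices comes from at most \<open>n! m!\<^sup>n\<close> histories, so its entropy is at
  least \<open>E (- ln (P h)) - ln (n! m!\<^sup>n)\<close>, and \<open>E (- ln (P h)) = m n ln n - O(n)\<close> because \<open>\<Sum> d ln d\<close>
  over the degrees \<open>d\<close> has mean \<open>O(n)\<close>.

  Upper bound: relabelling \<open>h\<close> by a linear extension of its parent order, and reordering the choices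
  of each vertex, gives histories with the same structure and essentially the same probability.  Up
  to twins (vertices with the same parents) and vertices with a repeated parent, both of which are
  rare, there are \<open>e(h) m!\<^sup>n\<close> of these, where \<open>e(h)\<close> counts the linear extensions.  To bound \<open>e(h)\<close>
  from below, insert the vertices one at a time at a uniformly random admissible position.  The
  entropy of this process is at most \<open>ln e(h)\<close>, and on average it is at least \<open>ln n! - m n\<close> since the
  last \<open>j\<close> positions never carry a mean total degree above \<open>2 m j\<close>.  Together with
  \<open>E (\<Sum> d ln d) \<ge> 2 n (m ln m + m) - o(n)\<close> this bounds the entropy by
  \<open>(m - 1) n ln n - (m - 1 - m ln 2 + ln m!) n + o(n)\<close>, so the remainder is negative of linear order.
\<close>

section \<open>Expectations over finitely supported distributions\<close>

text \<open>The two bounds make unequal demands. From below, every error of order n is harmless.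
  From above, the sign of the remainder hangs on the coefficient of n, so each loss must be o(n) or
  be booked exactly. The balance for the arrival of vertex j + 2 is this: up to o(1), its choices
  add at most m ln (j + 1) + m ln 2 - m to E (- ln (P h)); its random position takes off at least ln
  (j + 1) - m, and the order of its choices takes off ln m!. The loss m in the linear extensions is
  thus made good by the gain m from the convexity of d ln d. Summing (m - 1) ln (j + 1) supplies the
  further - (m - 1) n. P itself is not invariant under relabelling, because the m choices of a
  vertex all see the same degrees, and which repeated choices occur at which degrees depends on the
  order. Rising factorials repair this, and they change nothing at vertices without a repeated
  parent. Third moments of the degrees serve only to show that coincidences cost o(n).\<close>

abbreviation E :: "'a pmf \<Rightarrow> ('a \<Rightarrow> real) \<Rightarrow> real" where
  "E p f \<equiv> measure_pmf.expectation p f"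

lemma E_finite:
  assumes "finite (set_pmf p)"
  shows "E p f = (\<Sum>x\<in>set_pmf p. pmf p x * f x)"
  using integral_measure_pmf_real[OF assms, of p f] by (simp add: mult.commute)

lemma E_cong: "(\<And>x. x \<in> set_pmf p \<Longrightarrow> f x = g x) \<Longrightarrow> E p f = E p g"
  by (intro integral_cong_AE) (auto simp: AE_measure_pmf_iff)

lemma E_mono:
  assumes "finite (set_pmf p)" "\<And>x. x \<in> set_pmf p \<Longrightarrow> f x \<le> g x"
  shows "E p f \<le> E p g"
  using assms by (auto simp: E_finite intro!: sum_mono mult_left_mono)

lemma E_add:
  assumes "finite (set_pmf p)"
  shows "E p (\<lambda>x. f x + g x) = E p f + E p g"
  using assms by (simp add: E_finite algebra_simps sum.distrib)

lemma E_diff: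
  assumes "finite (set_pmf p)"
  shows "E p (\<lambda>x. f x - g x) = E p f - E p g"
  using assms by (simp add: E_finite algebra_simps sum_subtractf)

lemma E_sum:
  assumes "finite (set_pmf p)"
  shows "E p (\<lambda>x. \<Sum>i\<in>I. f i x) = (\<Sum>i\<in>I. E p (f i))"
  using assms by (simp add: E_finite sum_distrib_left sum.swap[of _ I])

lemma E_const [simp]: "E p (\<lambda>x. c) = c"
  by simp

lemma E_bind:
  assumes "finite (set_pmf p)" "\<And>x. x \<in> set_pmf p \<Longrightarrow> finite (set_pmf (f x))"
  shows "E (bind_pmf p f) g = E p (\<lambda>x. E (f x) g)"
  using assms by (subst pmf_expectation_bind[of "set_pmf p"]) (auto simp: E_finite[of p])

lemma E_swap:
  assumes "finite (set_pmf p)" "finite (set_pmf q)"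
  shows "E p (\<lambda>x. E q (f x)) = E q (\<lambda>y. E p (\<lambda>x. f x y))"
  using assms by (simp add: E_finite sum_distrib_left sum.swap[of _ "set_pmf p"] mult_ac)

lemma finite_set_replicate_pmf:
  "finite (set_pmf p) \<Longrightarrow> finite (set_pmf (replicate_pmf k p))"
  using finite_lists_length_eq[of "set_pmf p" k]
  by (auto simp: set_replicate_pmf lists_eq_set Collect_conj_eq Int_commute elim!: finite_subset[rotated])

lemma E_replicate_sum_list:
  assumes "finite (set_pmf p)"
  shows "E (replicate_pmf k p) (\<lambda>v. \<Sum>x\<leftarrow>v. g x) = real k * E p g"
proof (induction k)
  case (Suc k)
  have "E (replicate_pmf (Suc k) p) (\<lambda>v. \<Sum>x\<leftarrow>v. g x)
      = E p (\<lambda>x. E (replicate_pmf k p) (\<lambda>v. g x + (\<Sum>x\<leftarrow>v. g x)))"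
    using assms finite_set_replicate_pmf[OF assms]
    by (simp add: E_bind)
  also have "\<dots> = real (Suc k) * E p g"
    using assms finite_set_replicate_pmf[OF assms] Suc by (simp add: E_add algebra_simps)
  finally show ?case .
qed simp

lemma pmf_replicate_pmf:
  assumes "finite (set_pmf p)" "length v = k"
  shows "pmf (replicate_pmf k p) v = (\<Prod>x\<leftarrow>v. pmf p x)"
  using assms(2)
proof (induction k arbitrary: v)
  case (Suc k)
  then obtain x w where v: "v = x # w" "length w = k" by (cases v) auto
  have "pmf (replicate_pmf (Suc k) p) v
      = E p (\<lambda>y. pmf (map_pmf ((#) y) (replicate_pmf k p)) (x # w))"
    using assms(1) by (simp add: pmf_bind v map_pmf_def)
  also have "\<dots> = E p (\<lambda>y. indicator {x} y * pmf (replicate_pmf k p) w)"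
  proof (rule E_cong)
    fix y
    show "pmf (map_pmf ((#) y) (replicate_pmf k p)) (x # w) = indicator {x} y * pmf (replicate_pmf k p) w"
    proof (cases "y = x")
      case True
      then show ?thesis by (simp add: pmf_map_inj' inj_def)
    next
      case False
      then show ?thesis by (auto simp: pmf_eq_0_set_pmf)
    qed
  qed
  also have "\<dots> = pmf p x * pmf (replicate_pmf k p) w"
    by (simp add: pmf.rep_eq)
  finally show ?case using Suc.IH[OF v(2)] by (simp add: v)
qed simp

section \<open>Attachment histories\<close>

text \<open>A history \<open>h\<close> maps a vertex \<open>v \<ge> 2\<close> to the list of its \<open>m\<close> choices in order; it is empty
  elsewhere, the loops at vertex \<open>1\<close> being left implicit.  The history reached after \<open>k\<close> arrivals
  describes a graph of order \<open>Suc k\<close>, whose degrees sum to \<open>m * (2 * k + 1)\<close>.\<close>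

locale pref_attach =
  fixes m :: nat
  assumes m2: "2 \<le> m"
begin

definition graph_of :: "nat \<Rightarrow> (nat \<Rightarrow> nat list) \<Rightarrow> multigraph" where
  "graph_of n h = Multigraph n (replicate_mset m (Upair 1 1)
     + (\<Sum>v\<in>{2..n}. mset (map (Upair v) (h v))))"

text \<open>The initial \<open>m\<close> stands for the vertex's own edges or, at vertex 1, for the
  loops, each counted once. The same formula gives \<open>m\<close> at a vertex that has not yet
  been chosen by anyone.\<close>

definition hdeg :: "nat \<Rightarrow> (nat \<Rightarrow> nat list) \<Rightarrow> nat \<Rightarrow> nat" where
  "hdeg n h w = m + (\<Sum>v\<in>{2..n}. count_list (h v) w)"

definition histories :: "nat \<Rightarrow> (nat \<Rightarrow> nat list) set" where
  "histories n = {h. (\<forall>v\<in>{2..n}. length (h v) = m \<and> set (h v) \<subseteq> {1..<v}) \<and> (\<forall>v. v \<notin> {2..n} \<longrightarrow> h v = [])}"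

definition attachment :: "nat \<Rightarrow> (nat \<Rightarrow> nat list) \<Rightarrow> nat pmf" where
  "attachment k h = attach_pmf (graph_of (Suc k) h)"

primrec hist :: "nat \<Rightarrow> (nat \<Rightarrow> nat list) pmf" where
  "hist 0 = return_pmf (\<lambda>_. [])"
| "hist (Suc k) = bind_pmf (hist k) (\<lambda>h. map_pmf (\<lambda>v. h(Suc (Suc k) := v)) (replicate_pmf m (attachment k h)))"

declare hist.simps(2) [simp del]

lemma order_graph_of [simp]: "order (graph_of n h) = n"
  by (simp add: graph_of_def)

lemma atLeast2_Suc: "{2..Suc (Suc k)} = insert (Suc (Suc k)) {2..Suc k}"
  by auto

lemma graph_of_upd: "graph_of (Suc (Suc k)) (h(Suc (Suc k) := v)) = add_vertex (graph_of (Suc k) h) v"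
proof -
  have "(\<Sum>u\<in>{2..Suc k}. mset (map (Upair u) ((h(Suc (Suc k) := v)) u)))
    = (\<Sum>u\<in>{2..Suc k}. mset (map (Upair u) (h u)))"
    by (intro sum.cong) auto
  then show ?thesis
    by (simp add: graph_of_def add_vertex_def atLeast2_Suc)
qed

lemma PA_eq: "PA m (Suc k) = map_pmf (graph_of (Suc k)) (hist k)"
proof (induction k)
  case (Suc k)
  show ?case
    by (simp add: hist.simps(2) Suc.IH map_bind_pmf bind_map_pmf pmf.map_comp o_def graph_of_upd attachment_def
        del: fun_upd_apply)
qed (simp add: graph_of_def)

lemma m_pos: "m > 0"
  using m2 by simp

lemma hdeg_ge: "m \<le> hdeg n h w"
  by (simp add: hdeg_def)

lemma hdeg_pos: "0 < hdeg n h w"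
  using hdeg_ge[of n h w] m_pos by linarith

lemma deg_graph_of:
  assumes h: "h \<in> histories n" and w: "w \<in> {1..n}"
  shows "deg (graph_of n h) w = hdeg n h w"
proof -
  let ?P = "\<lambda>e. w \<in> set_uprod e"
  have c: "size (filter_mset ?P (mset (map (Upair v) (h v)))) = (if v = w then m else count_list (h v) w)"
    if v: "v \<in> {2..n}" for v
  proof -
    have "size (filter_mset ?P (mset (map (Upair v) xs))) = (if v = w then length xs else count_list xs w)" for xs
      by (induction xs) auto
    then show ?thesis using h v by (simp add: histories_def)
  qed
  have z: "count_list (h w) w = 0"
    using h by (cases "w \<in> {2..n}") (force simp: histories_def count_list_0_iff)+
  have sz: "size (filter_mset ?P (\<Sum>v\<in>A. f v)) = (\<Sum>v\<in>A. size (filter_mset ?P (f v)))" if "finite A"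
    for A and f :: "nat \<Rightarrow> nat uprod multiset"
    using that by (induction A rule: finite_induct) auto
  have r: "size (filter_mset ?P (replicate_mset m (Upair 1 1))) = (if w = 1 then m else 0)"
    by (induction m) auto
  have "deg (graph_of n h) w = (if w = 1 then m else 0) + (\<Sum>v\<in>{2..n}. if v = w then m else count_list (h v) w)"
    using r sum.cong[OF refl c, of "{2..n}" "\<lambda>v. v"]
    by (simp add: deg_def graph_of_def sz del: mset_map One_nat_def)
  also have "(\<Sum>v\<in>{2..n}. if v = w then m else count_list (h v) w)
    = (\<Sum>v\<in>{2..n}. (if v = w then m else 0) + count_list (h v) w)"
    using z by (intro sum.cong) auto
  finally show ?thesis
    using w by (auto simp: hdeg_def sum.distrib)
qed

lemma sum_hdeg:
  assumes h: "h \<in> histories (Suc k)"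
  shows "(\<Sum>w\<in>{1..Suc k}. hdeg (Suc k) h w) = m * (2 * k + 1)"
proof -
  have "(\<Sum>w\<in>{1..Suc k}. \<Sum>v\<in>{2..Suc k}. count_list (h v) w)
      = (\<Sum>v\<in>{2..Suc k}. \<Sum>w\<in>{1..Suc k}. count_list (h v) w)"
    by (rule sum.swap)
  also have "\<dots> = (\<Sum>v\<in>{2..Suc k}. m)"
  proof (rule sum.cong)
    fix v assume v: "v \<in> {2..Suc k}"
    then have "set (h v) \<subseteq> {1..Suc k}" "length (h v) = m"
      using h by (force simp: histories_def)+
    then show "(\<Sum>w\<in>{1..Suc k}. count_list (h v) w) = m"
      using sum_count_set[of "h v" "{1..Suc k}"] by simp
  qed simp
  finally show ?thesis
    by (simp add: hdeg_def sum.distrib algebra_simps)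
qed

lemma pmf_attachment:
  assumes h: "h \<in> histories (Suc k)"
  shows "pmf (attachment k h) w = (if w \<in> {1..Suc k} then real (hdeg (Suc k) h w) / (real m * (2 * real k + 1)) else 0)"
proof -
  have s: "(\<Sum>u\<in>verts (graph_of (Suc k) h). deg (graph_of (Suc k) h) u) = m * (2 * k + 1)"
    unfolding verts_def order_graph_of sum_hdeg[OF h, symmetric]
    by (intro sum.cong refl deg_graph_of[OF h])
  show ?thesis
    using s m_pos unfolding attachment_def
    by (subst pmf_attach_pmf) (simp_all add: attach_prob_def verts_def deg_graph_of[OF h] algebra_simps del: of_nat_sum)
qed

lemma set_attachment:
  assumes h: "h \<in> histories (Suc k)"
  shows "set_pmf (attachment k h) = {1..Suc k}"
  using hdeg_pos m_pos unfolding set_pmf_eq by (auto simp: pmf_attachment[OF h] add_pos_nonneg add_nonneg_eq_0_iff gr0_conv_Suc)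

lemma histories_upd:
  assumes "h \<in> histories (Suc k)" "length v = m" "set v \<subseteq> {1..Suc k}"
  shows "h(Suc (Suc k) := v) \<in> histories (Suc (Suc k))"
  using assms by (auto simp: histories_def)

lemma histories_Suc:
  assumes "h \<in> histories (Suc (Suc k))"
  obtains g v where "g \<in> histories (Suc k)" "length v = m" "set v \<subseteq> {1..Suc k}" "h = g(Suc (Suc k) := v)"
proof
  show "h(Suc (Suc k) := []) \<in> histories (Suc k)"
    using assms by (auto simp: histories_def)
  show "length (h (Suc (Suc k))) = m" "set (h (Suc (Suc k))) \<subseteq> {1..Suc k}"
    using assms by (force simp: histories_def)+
qed simp

lemma set_choice:
  assumes h: "h \<in> histories (Suc k)"
  shows "set_pmf (replicate_pmf m (attachment k h)) = {v. length v = m \<and> set v \<subseteq> {1..Suc k}}"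
  by (auto simp: set_replicate_pmf set_attachment[OF h])

text \<open>Every present vertex has positive degree, so no admissible choice has probability
  zero.\<close>

lemma set_hist: "set_pmf (hist k) = histories (Suc k)"
proof (induction k)
  case 0
  then show ?case by (auto simp: histories_def)
next
  case (Suc k)
  show ?case
  proof (intro equalityI subsetI)
    fix h assume "h \<in> set_pmf (hist (Suc k))"
    then show "h \<in> histories (Suc (Suc k))"
      using histories_upd by (auto simp: hist.simps(2) Suc.IH set_choice simp del: fun_upd_apply)
  next
    fix h assume "h \<in> histories (Suc (Suc k))"
    then obtain g v where "g \<in> histories (Suc k)" "length v = m" "set v \<subseteq> {1..Suc k}" "h = g(Suc (Suc k) := v)"
      by (rule histories_Suc)
    then show "h \<in> set_pmf (hist (Suc k))"
      by (auto simp: hist.simps(2) Suc.IH set_choice simp del: fun_upd_apply intro!: bexI[of _ g])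
  qed
qed

lemma finite_choice: "h \<in> histories (Suc k) \<Longrightarrow> finite (set_pmf (replicate_pmf m (attachment k h)))"
  by (simp add: finite_set_replicate_pmf set_attachment)

lemma finite_hist: "finite (set_pmf (hist k))"
  by (induction k) (auto simp: hist.simps(2) finite_choice simp flip: set_hist)

lemma E_hist_Suc:
  "E (hist (Suc k)) f = E (hist k) (\<lambda>h. E (replicate_pmf m (attachment k h)) (\<lambda>v. f (h(Suc (Suc k) := v))))"
  unfolding hist.simps
  by (subst E_bind[OF finite_hist]) (simp_all add: set_hist finite_choice del: fun_upd_apply)

lemma pmf_hist_Suc:
  assumes h: "h \<in> histories (Suc k)" and v: "length v = m" "set v \<subseteq> {1..Suc k}"
  shows "pmf (hist (Suc k)) (h(Suc (Suc k) := v)) = pmf (hist k) h *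
    (\<Prod>x\<leftarrow>v. real (hdeg (Suc k) h x) / (real m * (2 * real k + 1)))"
proof -
  have inj: "inj (\<lambda>v. g(Suc (Suc k) := v))" for g :: "nat \<Rightarrow> nat list"
    by (auto simp: inj_def fun_eq_iff split: if_splits)
  have "pmf (hist (Suc k)) (h(Suc (Suc k) := v))
    = E (hist k) (\<lambda>g. pmf (map_pmf (\<lambda>v. g(Suc (Suc k) := v)) (replicate_pmf m (attachment k g))) (h(Suc (Suc k) := v)))"
    by (simp add: hist.simps(2) pmf_bind)
  also have "\<dots> = E (hist k) (\<lambda>g. indicator {h} g * pmf (replicate_pmf m (attachment k h)) v)"
  proof (rule E_cong)
    fix g assume g: "g \<in> set_pmf (hist k)"
    show "pmf (map_pmf (\<lambda>v. g(Suc (Suc k) := v)) (replicate_pmf m (attachment k g))) (h(Suc (Suc k) := v))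
      = indicator {h} g * pmf (replicate_pmf m (attachment k h)) v"
    proof (cases "g = h")
      case True
      then show ?thesis using pmf_map_inj'[OF inj] by simp
    next
      case False
      have "h(Suc (Suc k) := v) \<noteq> g(Suc (Suc k) := u)" for u
      proof
        assume eq: "h(Suc (Suc k) := v) = g(Suc (Suc k) := u)"
        have "h x = g x" for x
          using fun_cong[OF eq, of x] h g
          by (cases "x = Suc (Suc k)") (auto simp: set_hist histories_def)
        with False show False by auto
      qed
      then show ?thesis using False by (force simp: pmf_eq_0_set_pmf)
    qed
  qed
  also have "\<dots> = pmf (hist k) h * pmf (replicate_pmf m (attachment k h)) v"
    by (simp add: pmf.rep_eq)
  also have "pmf (replicate_pmf m (attachment k h)) v = (\<Prod>x\<leftarrow>v. pmf (attachment k h) x)"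
    using v by (intro pmf_replicate_pmf) (simp_all add: set_attachment[OF h])
  also have "\<dots> = (\<Prod>x\<leftarrow>v. real (hdeg (Suc k) h x) / (real m * (2 * real k + 1)))"
    using v by (intro arg_cong[of _ _ prod_list] map_cong) (auto simp: pmf_attachment[OF h])
  finally show ?thesis .
qed

text \<open>The number m of choices cancels against the m in the total degree m (2 k + 1). This
  leaves the normalisation 2 k + 1 that occurs in all recursions below.\<close>

lemma E_choice_sum_list:
  assumes h: "h \<in> histories (Suc k)"
  shows "E (replicate_pmf m (attachment k h)) (\<lambda>v. \<Sum>x\<leftarrow>v. g x)
    = (\<Sum>w\<in>{1..Suc k}. real (hdeg (Suc k) h w) * g w) / (2 * real k + 1)"
proof -
  have "E (replicate_pmf m (attachment k h)) (\<lambda>v. \<Sum>x\<leftarrow>v. g x) = real m * E (attachment k h) g"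
    by (rule E_replicate_sum_list) (simp add: set_attachment[OF h])
  also have "E (attachment k h) g = (\<Sum>w\<in>{1..Suc k}. real (hdeg (Suc k) h w) / (real m * (2 * real k + 1)) * g w)"
    unfolding E_finite[of "attachment k h", unfolded set_attachment[OF h], OF finite_atLeastAtMost]
    by (intro sum.cong refl) (simp add: pmf_attachment[OF h])
  also have "\<dots> = (\<Sum>w\<in>{1..Suc k}. real (hdeg (Suc k) h w) * g w / (real m * (2 * real k + 1)))"
    by (intro sum.cong) auto
  also have "real m * \<dots> = (\<Sum>w\<in>{1..Suc k}. real (hdeg (Suc k) h w) * g w) / (2 * real k + 1)"
    using m_pos by (simp flip: sum_divide_distrib)
  finally show ?thesis .
qed

lemma hdeg_upd: "hdeg (Suc (Suc k)) (h(Suc (Suc k) := v)) w = hdeg (Suc k) h w + count_list v w"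
proof -
  have "(\<Sum>u\<in>{2..Suc k}. count_list ((h(Suc (Suc k) := v)) u) w) = (\<Sum>u\<in>{2..Suc k}. count_list (h u) w)"
    by (intro sum.cong) auto
  then show ?thesis by (simp add: hdeg_def atLeast2_Suc)
qed

lemma hdeg_new:
  assumes "h \<in> histories (Suc k)"
  shows "hdeg (Suc k) h (Suc (Suc k)) = m"
proof -
  have "count_list (h v) (Suc (Suc k)) = 0" if "v \<in> {2..Suc k}" for v
    using assms that by (force simp: histories_def count_list_0_iff)
  then show ?thesis by (simp add: hdeg_def)
qed

lemma sum_count_list_mult:
  fixes g :: "nat \<Rightarrow> real"
  assumes "set v \<subseteq> A" "finite A"
  shows "(\<Sum>w\<in>A. real (count_list v w) * g w) = (\<Sum>x\<leftarrow>v. g x)"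
  using assms(1)
proof (induction v)
  case (Cons a v)
  have "(\<Sum>w\<in>A. real (count_list (a # v) w) * g w)
    = (\<Sum>w\<in>A. real (count_list v w) * g w + (if w = a then g w else 0))"
    by (intro sum.cong) (auto simp: algebra_simps)
  then show ?case using Cons assms(2) by (simp add: sum.distrib)
qed simp

end

section \<open>Moments of the degrees\<close>

text \<open>The derivative of the difference is nonnegative for x \<ge> 0. The inequality closes the
  induction for the third moment, where a factor 1 + (19/10) (2/u) has to be absorbed into a power
  of 1 + 2/u.\<close>

lemma powr_Bernoulli:
  fixes a x :: real
  assumes "a \<ge> 1" "x \<ge> 0"
  shows "1 + a * x \<le> (1 + x) powr a"
proof -
  let ?f = "\<lambda>x. (1 + x) powr a - a * x"
  have "?f 0 \<le> ?f x"
  proof (rule DERIV_nonneg_imp_nondecreasing[OF assms(2)])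
    fix y :: real assume y: "0 \<le> y" "y \<le> x"
    have "(?f has_real_derivative a * (1 + y) powr (a - 1) - a) (at y)"
      using y by (auto intro!: derivative_eq_intros)
    moreover have "0 \<le> a * (1 + y) powr (a - 1) - a"
      using assms y ge_one_powr_ge_zero[of "1 + y" "a - 1"] by (simp add: mult_le_cancel_left1)
    ultimately show "\<exists>z. (?f has_real_derivative z) (at y) \<and> 0 \<le> z" by blast
  qed
  then show ?thesis by simp
qed

text \<open>A union bound over pairs of positions: the event that the head recurs is bounded by its
  expected number of occurrences in the tail.\<close>

lemma E_not_distinct_le:
  assumes "finite (set_pmf p)"
  shows "E (replicate_pmf j p) (\<lambda>v. of_bool (\<not> distinct v)) \<le> real j ^ 2 * (\<Sum>x\<in>set_pmf p. pmf p x ^ 2)"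
proof (induction j)
  case (Suc j)
  note fin = finite_set_replicate_pmf[OF assms]
  have cnt: "E (replicate_pmf j p) (\<lambda>v. real (count_list v x)) = real j * pmf p x" for x
  proof -
    have "real (count_list v x) = (\<Sum>y\<leftarrow>v. indicator {x} y)" for v
      by (induction v) auto
    then show ?thesis using E_replicate_sum_list[OF assms] by (simp add: pmf.rep_eq)
  qed
  have "E (replicate_pmf (Suc j) p) (\<lambda>v. of_bool (\<not> distinct v))
    = E p (\<lambda>x. E (replicate_pmf j p) (\<lambda>v. of_bool (\<not> distinct (x # v))))"
    using assms fin by (simp add: E_bind)
  also have "\<dots> \<le> E p (\<lambda>x. E (replicate_pmf j p) (\<lambda>v. real (count_list v x) + of_bool (\<not> distinct v)))"
  proof (intro E_mono assms fin)
    fix x v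
    have "x \<in> set v \<Longrightarrow> count_list v x \<noteq> 0" by (simp add: count_list_0_iff)
    then show "of_bool (\<not> distinct (x # v)) \<le> real (count_list v x) + of_bool (\<not> distinct v)"
      by auto
  qed
  also have "\<dots> = E p (\<lambda>x. real j * pmf p x) + E (replicate_pmf j p) (\<lambda>v. of_bool (\<not> distinct v))"
    using fin assms by (simp add: E_add cnt)
  also have "E p (\<lambda>x. real j * pmf p x) = real j * (\<Sum>x\<in>set_pmf p. pmf p x ^ 2)"
    using assms by (simp add: E_finite sum_distrib_left power2_eq_square mult_ac)
  also have "real j * (\<Sum>x\<in>set_pmf p. pmf p x ^ 2) + E (replicate_pmf j p) (\<lambda>v. of_bool (\<not> distinct v))
    \<le> (real j + real j ^ 2) * (\<Sum>x\<in>set_pmf p. pmf p x ^ 2)"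
    using Suc by (simp add: algebra_simps)
  also have "\<dots> \<le> real (Suc j) ^ 2 * (\<Sum>x\<in>set_pmf p. pmf p x ^ 2)"
    by (intro mult_right_mono sum_nonneg) (auto simp: power2_eq_square algebra_simps)
  finally show ?case .
qed simp

text \<open>Two factors are kept and the others bounded by 1; then a b \<le> a^2 + b^2. Squares are
  wanted because a sum over all parents of all vertices then turns into a third moment of the
  degrees.\<close>

lemma prod_list_pmf_le_sum_squares:
  assumes "2 \<le> length c"
  shows "(\<Prod>x\<leftarrow>c. pmf p x) \<le> (\<Sum>x\<leftarrow>c. pmf p x ^ 2)"
proof -
  obtain a b r where c: "c = a # b # r"
    using assms by (cases c; cases "tl c") auto
  have "(\<Prod>x\<leftarrow>r. pmf p x) \<in> {0..1}"
    by (induction r) (auto simp: pmf_le_1 mult_le_one)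
  then have "(\<Prod>x\<leftarrow>c. pmf p x) \<le> pmf p a * pmf p b"
    by (auto simp: c simp flip: mult.assoc intro!: mult_left_le)
  also have "\<dots> \<le> pmf p a ^ 2 + pmf p b ^ 2"
    using sum_squares_bound[of "pmf p a" "pmf p b"] pmf_nonneg[of p a] pmf_nonneg[of p b]
    using mult_nonneg_nonneg[of "pmf p a" "pmf p b"] by linarith
  also have "\<dots> \<le> (\<Sum>x\<leftarrow>c. pmf p x ^ 2)"
    by (auto simp: c intro!: sum_list_nonneg)
  finally show ?thesis .
qed

lemma card_permutations_of_multiset_le: "card (permutations_of_multiset A) \<le> fact (size A)"
  unfolding card_permutations_of_multiset(1) by (rule div_le_dividend)

text \<open>All orderings of \<open>c\<close> are equally likely, and there are at most
  \<open>fact (length c)\<close> of them.\<close>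

lemma E_mset_eq_le:
  assumes "finite (set_pmf p)" "2 \<le> length c"
  shows "E (replicate_pmf (length c) p) (\<lambda>v. of_bool (mset c = mset v))
    \<le> fact (length c) * (\<Sum>x\<leftarrow>c. pmf p x ^ 2)"
proof -
  let ?S = "permutations_of_multiset (mset c)"
  have "E (replicate_pmf (length c) p) (\<lambda>v. of_bool (mset c = mset v))
    = (\<Sum>v\<in>?S. of_bool (mset c = mset v) * pmf (replicate_pmf (length c) p) v)"
    by (rule integral_measure_pmf_real) (simp, auto simp: permutations_of_multiset_def)
  also have "\<dots> = (\<Sum>v\<in>?S. \<Prod>x\<leftarrow>c. pmf p x)"
  proof (rule sum.cong)
    fix v assume "v \<in> ?S"
    then have eq: "mset v = mset c" by (simp add: permutations_of_multiset_def)
    then have "(\<Prod>x\<leftarrow>v. pmf p x) = (\<Prod>x\<leftarrow>c. pmf p x)"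
      by (metis mset_map prod_mset_prod_list)
    then show "of_bool (mset c = mset v) * pmf (replicate_pmf (length c) p) v = (\<Prod>x\<leftarrow>c. pmf p x)"
      using pmf_replicate_pmf[OF assms(1) refl, of v] mset_eq_length[OF eq] eq by simp
  qed simp
  also have "\<dots> = real (card ?S) * (\<Prod>x\<leftarrow>c. pmf p x)" by simp
  also have "\<dots> \<le> real (fact (length c)) * (\<Sum>x\<leftarrow>c. pmf p x ^ 2)"
  proof (rule mult_mono)
    show "real (card ?S) \<le> real (fact (length c))"
      using card_permutations_of_multiset_le[of "mset c"] by (simp only: of_nat_le_iff size_mset)
    show "0 \<le> (\<Prod>x\<leftarrow>c. pmf p x)"
      by (induction c) auto
  qed (simp_all only: prod_list_pmf_le_sum_squares[OF assms(2)] of_nat_0_le_iff)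
  finally show ?thesis by simp
qed

declare sum.cl_ivl_Suc [simp del]

context pref_attach
begin

section \<open>Sums of a function of the degrees and their one-step recursions\<close>

definition potential :: "(nat \<Rightarrow> real) \<Rightarrow> nat \<Rightarrow> (nat \<Rightarrow> nat list) \<Rightarrow> real" where
  "potential f n h = (\<Sum>w\<in>{1..n}. f (hdeg n h w))"

lemma potential_upd:
  assumes h: "h \<in> histories (Suc k)" and v: "set v \<subseteq> {1..Suc k}"
  shows "potential f (Suc (Suc k)) (h(Suc (Suc k) := v))
    = f m + (\<Sum>w\<in>{1..Suc k}. f (hdeg (Suc k) h w + count_list v w))"
proof -
  have "count_list v (Suc (Suc k)) = 0" using v by (force simp: count_list_0_iff)
  moreover have "{1..Suc (Suc k)} = insert (Suc (Suc k)) {1..Suc k}" by auto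
  ultimately show ?thesis
    by (simp add: potential_def hdeg_upd hdeg_new[OF h] del: fun_upd_apply)
qed

text \<open>Making the increment bound linear in x turns it into a sum over the m single choices, so
  their joint law does not matter. A single choice hits w with probability proportional to its
  degree, which is the origin of the extra factor d in front of \<open>g d\<close>.\<close>

lemma E_choice_potential_le:
  assumes h: "h \<in> histories (Suc k)"
    and f: "\<And>d x. m \<le> d \<Longrightarrow> x \<le> m \<Longrightarrow> f (d + x) \<le> f d + real x * g d"
  shows "E (replicate_pmf m (attachment k h)) (\<lambda>v. potential f (Suc (Suc k)) (h(Suc (Suc k) := v)))
    \<le> potential f (Suc k) h + f m + potential (\<lambda>d. real d * g d) (Suc k) h / (2 * real k + 1)"
proof -
  have "E (replicate_pmf m (attachment k h)) (\<lambda>v. potential f (Suc (Suc k)) (h(Suc (Suc k) := v)))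
    \<le> E (replicate_pmf m (attachment k h)) (\<lambda>v. (potential f (Suc k) h + f m) + (\<Sum>x\<leftarrow>v. g (hdeg (Suc k) h x)))"
  proof (rule E_mono[OF finite_choice[OF h]])
    fix v assume "v \<in> set_pmf (replicate_pmf m (attachment k h))"
    then have v: "set v \<subseteq> {1..Suc k}" "length v = m" by (auto simp: set_choice[OF h])
    have "(\<Sum>w\<in>{1..Suc k}. f (hdeg (Suc k) h w + count_list v w))
      \<le> (\<Sum>w\<in>{1..Suc k}. f (hdeg (Suc k) h w) + real (count_list v w) * g (hdeg (Suc k) h w))"
      using v(2) count_le_length[of v] by (intro sum_mono f hdeg_ge) auto
    also have "\<dots> = potential f (Suc k) h + (\<Sum>x\<leftarrow>v. g (hdeg (Suc k) h x))"
      unfolding potential_def sum.distrib sum_count_list_mult[OF v(1) finite_atLeastAtMost] ..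
    finally show "potential f (Suc (Suc k)) (h(Suc (Suc k) := v))
      \<le> (potential f (Suc k) h + f m) + (\<Sum>x\<leftarrow>v. g (hdeg (Suc k) h x))"
      by (simp add: potential_upd[OF h v(1)] del: fun_upd_apply)
  qed
  also have "\<dots> = potential f (Suc k) h + f m + potential (\<lambda>d. real d * g d) (Suc k) h / (2 * real k + 1)"
    by (subst E_add[OF finite_choice[OF h]])
      (simp only: E_const E_choice_sum_list[OF h] potential_def)
  finally show ?thesis .
qed

lemma E_potential_le:
  assumes f: "\<And>d x. m \<le> d \<Longrightarrow> x \<le> m \<Longrightarrow> f (d + x) \<le> f d + real x * g d"
  shows "E (hist (Suc k)) (potential f (Suc (Suc k)))
    \<le> E (hist k) (potential f (Suc k)) + f m + E (hist k) (potential (\<lambda>d. real d * g d) (Suc k)) / (2 * real k + 1)"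
proof -
  have "E (hist (Suc k)) (potential f (Suc (Suc k))) \<le> E (hist k) (\<lambda>h. (potential f (Suc k) h + f m)
      + potential (\<lambda>d. real d * g d) (Suc k) h / (2 * real k + 1))"
    unfolding E_hist_Suc using E_choice_potential_le[OF _ f]
    by (intro E_mono[OF finite_hist]) (simp add: set_hist)
  also have "\<dots> = E (hist k) (potential f (Suc k)) + f m + E (hist k) (potential (\<lambda>d. real d * g d) (Suc k)) / (2 * real k + 1)"
    by (simp add: E_add[OF finite_hist])
  finally show ?thesis .
qed

lemma E_potential_ge:
  assumes f: "\<And>d x. m \<le> d \<Longrightarrow> x \<le> m \<Longrightarrow> f d + real x * g d \<le> f (d + x)"
  shows "E (hist k) (potential f (Suc k)) + f m + E (hist k) (potential (\<lambda>d. real d * g d) (Suc k)) / (2 * real k + 1)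
    \<le> E (hist (Suc k)) (potential f (Suc (Suc k)))"
proof -
  have "E (hist (Suc k)) (potential (\<lambda>d. - f d) (Suc (Suc k)))
    \<le> E (hist k) (potential (\<lambda>d. - f d) (Suc k)) + - f m
      + E (hist k) (potential (\<lambda>d. real d * - g d) (Suc k)) / (2 * real k + 1)"
    by (rule E_potential_le) (use f in force)
  then show ?thesis by (simp add: potential_def[abs_def] sum_negf del: sum.cl_ivl_Suc)
qed

lemma potential_real:
  assumes "h \<in> histories (Suc k)"
  shows "potential real (Suc k) h = real m * (2 * real k + 1)"
  using arg_cong[OF sum_hdeg[OF assms], of real] by (simp add: potential_def algebra_simps)

lemma E_potential_real: "E (hist k) (potential real (Suc k)) = real m * (2 * real k + 1)"
  using E_cong[of "hist k" "potential real (Suc k)" "\<lambda>_. real m * (2 * real k + 1)"]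
  by (simp add: potential_real set_hist)

lemma E_potential_affine:
  "E (hist k) (potential (\<lambda>d. a * f d + c * real d) (Suc k))
    = a * E (hist k) (potential f (Suc k)) + c * (real m * (2 * real k + 1))"
proof -
  have "potential (\<lambda>d. a * f d + c * real d) (Suc k) h = a * potential f (Suc k) h + c * potential real (Suc k) h" for h
    by (simp add: potential_def sum.distrib sum_distrib_left)
  then have "E (hist k) (potential (\<lambda>d. a * f d + c * real d) (Suc k))
    = E (hist k) (\<lambda>h. a * potential f (Suc k) h + c * potential real (Suc k) h)"
    by (intro E_cong) simp
  then show ?thesis by (simp add: E_add[OF finite_hist] E_potential_real)
qed

section \<open>The means of the sums of d ln d and of d^3\<close>

definition mean_deg_ln :: "nat \<Rightarrow> real" where
  "mean_deg_ln k = E (hist k) (potential (\<lambda>d. real d * ln (real d)) (Suc k))"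

definition mean_deg_cubed :: "nat \<Rightarrow> real" where
  "mean_deg_cubed k = E (hist k) (potential (\<lambda>d. real d ^ 3) (Suc k))"

lemma mean_deg_ln_0: "mean_deg_ln 0 = real m * ln (real m)"
  by (simp add: mean_deg_ln_def potential_def hdeg_def)

lemma mean_deg_cubed_0: "mean_deg_cubed 0 = real m ^ 3"
  by (simp add: mean_deg_cubed_def potential_def hdeg_def)

text \<open>The function d ln d is convex with slope ln d + 1 at d. The tangent inequality is ln y
  \<le> y - 1 at y = d / (d + x).\<close>

lemma mean_deg_ln_Suc_ge: "(1 + 1 / (2 * real k + 1)) * mean_deg_ln k + (real m * ln (real m) + real m) \<le> mean_deg_ln (Suc k)"
proof -
  have "mean_deg_ln k + real m * ln (real m) + E (hist k) (potential (\<lambda>d. real d * (ln (real d) + 1)) (Suc k)) / (2 * real k + 1) \<le> mean_deg_ln (Suc k)"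
    unfolding mean_deg_ln_def
  proof (rule E_potential_ge)
    fix d x :: nat assume "m \<le> d"
    then have d: "real d > 0" using m_pos by simp
    then have "ln (real d / (real d + real x)) \<le> real d / (real d + real x) - 1"
      by (intro ln_le_minus_one) (simp add: add_pos_nonneg)
    moreover have "ln (real d / (real d + real x)) = ln (real d) - ln (real d + real x)"
      using d by (simp add: ln_div)
    ultimately have "(real d + real x) * (1 - real d / (real d + real x))
        \<le> (real d + real x) * (ln (real d + real x) - ln (real d))"
      by (intro mult_left_mono) auto
    then have "real x \<le> (real d + real x) * (ln (real d + real x) - ln (real d))"
      using d by (simp add: right_diff_distrib)
    then show "real d * ln (real d) + real x * (ln (real d) + 1) \<le> real (d + x) * ln (real (d + x))"
      by (simp add: algebra_simps)
  qed
  moreover have "E (hist k) (potential (\<lambda>d. real d * (ln (real d) + 1)) (Suc k))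
    = mean_deg_ln k + real m * (2 * real k + 1)"
    using E_potential_affine[of k 1 "\<lambda>d. real d * ln (real d)" 1] by (simp add: mean_deg_ln_def algebra_simps)
  ultimately show ?thesis by (simp add: field_simps)
qed

text \<open>The increment x is at most m, hence at most d, so the second-order term x^2 / d is at
  most x. This raises the slope from ln d + 1 to ln d + 2.\<close>

lemma mean_deg_ln_Suc_le: "mean_deg_ln (Suc k) \<le> (1 + 1 / (2 * real k + 1)) * mean_deg_ln k + (real m * ln (real m) + 2 * real m)"
proof -
  have "mean_deg_ln (Suc k) \<le> mean_deg_ln k + real m * ln (real m) + E (hist k) (potential (\<lambda>d. real d * (ln (real d) + 2)) (Suc k)) / (2 * real k + 1)"
    unfolding mean_deg_ln_def
  proof (rule E_potential_le)
    fix d x :: nat assume dx: "m \<le> d" "x \<le> m"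
    then have d: "real d > 0" using m_pos by simp
    have "ln (1 + real x / real d) \<le> real x / real d"
      by (rule ln_add_one_self_le_self) (use d in simp)
    moreover have "1 + real x / real d = (real d + real x) / real d" using d by (simp add: field_simps)
    ultimately have l: "ln (real d + real x) \<le> ln (real d) + real x / real d"
      using d by (simp add: ln_div)
    have "(real d + real x) * ln (real d + real x) \<le> (real d + real x) * (ln (real d) + real x / real d)"
      using l by (intro mult_left_mono) auto
    also have "\<dots> = (real d + real x) * ln (real d) + real x + real x * (real x / real d)"
      using d by (simp add: field_simps)
    also have "real x * (real x / real d) \<le> real x * 1"
      using dx d by (intro mult_left_mono) auto
    finally show "real (d + x) * ln (real (d + x)) \<le> real d * ln (real d) + real x * (ln (real d) + 2)"
      by (simp add: algebra_simps)
  qed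
  moreover have "E (hist k) (potential (\<lambda>d. real d * (ln (real d) + 2)) (Suc k))
    = mean_deg_ln k + 2 * (real m * (2 * real k + 1))"
    using E_potential_affine[of k 1 "\<lambda>d. real d * ln (real d)" 2] by (simp add: mean_deg_ln_def algebra_simps)
  ultimately show ?thesis by (simp add: field_simps)
qed

text \<open>With u = 2 k + 1, the bound K u solves the recursion exactly: (1 + 1/u) K u + K = K (u +
  2).\<close>

lemma mean_deg_ln_le: "mean_deg_ln k \<le> (real m * ln (real m) + 2 * real m) * (2 * real k + 1)"
proof (induction k)
  case 0
  then show ?case by (simp add: mean_deg_ln_0)
next
  case (Suc k)
  let ?K = "real m * ln (real m) + 2 * real m"
  have "mean_deg_ln (Suc k) \<le> (1 + 1 / (2 * real k + 1)) * (?K * (2 * real k + 1)) + ?K"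
    using mean_deg_ln_Suc_le[of k] mult_left_mono[OF Suc, of "1 + 1 / (2 * real k + 1)"] by simp
  also have "\<dots> = ?K * (2 * real (Suc k) + 1)"
    by (simp add: divide_simps) (simp add: algebra_simps)
  finally show ?case .
qed

text \<open>A deficit against the exact solution \<open>?K * (2 * k + 1)\<close> of the recursion is
  multiplied by 1 + 1 / (2 k + 1) in each step. It therefore grows only like sqrt k, and the leading
  coefficient, which enters the linear term of the upper bound, is kept in full.\<close>

lemma mean_deg_ln_ge: "(real m * ln (real m) + real m) * (2 * real k + 1) - 2 * real m * sqrt (real (Suc k)) \<le> mean_deg_ln k"
proof -
  let ?K = "real m * ln (real m) + real m"
  have step: "?K * (2 * real (Suc k) + 1) - (1 + 1 / (2 * real k + 1)) * c \<le> mean_deg_ln (Suc k)"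
    if "?K * (2 * real k + 1) - c \<le> mean_deg_ln k" for k c
  proof -
    have "(1 + 1 / (2 * real k + 1)) * (?K * (2 * real k + 1) - c) + ?K \<le> mean_deg_ln (Suc k)"
      using mean_deg_ln_Suc_ge[of k] mult_left_mono[OF that, of "1 + 1 / (2 * real k + 1)"] by simp
    moreover have "(1 + 1 / (2 * real k + 1)) * (?K * (2 * real k + 1) - c) + ?K
      = ?K * (2 * real (Suc k) + 1) - (1 + 1 / (2 * real k + 1)) * c"
      by (simp add: divide_simps) (simp add: algebra_simps)
    ultimately show ?thesis by simp
  qed
  \<comment> \<open>The deficit is m at index 0 and the first step doubles it. From index 1 on, the
    factor of a step is at most sqrt ((k + 1) / k), since 4 k (k + 1) \<le> (2 k + 1)^2; this
    comparison breaks down at k = 0.\<close>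
  have pos: "?K * (2 * real (Suc k) + 1) - 2 * real m * sqrt (real (Suc k)) \<le> mean_deg_ln (Suc k)" for k
  proof (induction k)
    case 0
    have "?K * (2 * real (Suc 0) + 1) - (1 + 1 / (2 * real 0 + 1)) * real m \<le> mean_deg_ln (Suc 0)"
      by (rule step) (simp add: mean_deg_ln_0)
    then show ?case by simp
  next
    case (Suc k)
    have "(1 + 1 / (2 * real (Suc k) + 1)) * sqrt (real (Suc k)) \<le> sqrt (real (Suc (Suc k)))"
    proof (rule real_le_rsqrt)
      have "((1 + 1 / (2 * real (Suc k) + 1)) * sqrt (real (Suc k)))\<^sup>2
        = ((2 * real (Suc k) + 2) / (2 * real (Suc k) + 1))\<^sup>2 * real (Suc k)"
      proof -
        have "1 + 1 / (2 * real (Suc k) + 1) = (2 * real (Suc k) + 2) / (2 * real (Suc k) + 1)"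
          by (simp add: divide_simps)
        then show ?thesis by (simp only: power_mult_distrib real_sqrt_pow2 of_nat_0_le_iff)
      qed
      also have "\<dots> \<le> real (Suc (Suc k))"
      proof -
        have "(2 * real (Suc k) + 2)\<^sup>2 * real (Suc k) \<le> real (Suc (Suc k)) * (2 * real (Suc k) + 1)\<^sup>2"
          by (simp add: algebra_simps power2_eq_square)
        moreover have "(2 * real (Suc k) + 1)\<^sup>2 > 0" by simp
        ultimately show ?thesis by (simp add: power_divide pos_divide_le_eq del: of_nat_Suc)
      qed
      finally show "((1 + 1 / (2 * real (Suc k) + 1)) * sqrt (real (Suc k)))\<^sup>2 \<le> real (Suc (Suc k))" .
    qed
    then have "(1 + 1 / (2 * real (Suc k) + 1)) * (2 * real m * sqrt (real (Suc k)))
        \<le> 2 * real m * sqrt (real (Suc (Suc k)))"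
      using mult_left_mono[OF _ of_nat_0_le_iff[of "2 * m"]] by (fastforce simp: mult_ac)
    then show ?case using step[OF Suc] by linarith
  qed
  show ?thesis
  proof (cases k)
    case 0
    then show ?thesis using mean_deg_ln_0 by simp
  next
    case (Suc j)
    have "sqrt (real (Suc j)) \<le> sqrt (real (Suc (Suc j)))" by simp
    then have "2 * real m * sqrt (real (Suc j)) \<le> 2 * real m * sqrt (real (Suc (Suc j)))"
      by (intro mult_left_mono) auto
    then show ?thesis using pos[of j] Suc by simp
  qed
qed

text \<open>The cross term 3 d m is split by (d - 3 m)^2 \<ge> 0, which raises the leading
  coefficient from 3 to 7/2. A coefficient a makes the moment grow like k^(a/2), so anything below 4
  keeps it below k^2.\<close>

lemma mean_deg_cubed_Suc_le: "mean_deg_cubed (Suc k) \<le> (1 + (7/2) / (2 * real k + 1)) * mean_deg_cubed k + 7 * real m ^ 3"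
proof -
  have "mean_deg_cubed (Suc k) \<le> mean_deg_cubed k + real m ^ 3
    + E (hist k) (potential (\<lambda>d. real d * ((7/2) * real d ^ 2 + 6 * real m ^ 2)) (Suc k)) / (2 * real k + 1)"
    unfolding mean_deg_cubed_def
  proof (rule E_potential_le)
    fix d x :: nat assume "m \<le> d" "x \<le> m"
    then have x: "real x \<le> real m" by simp
    have "real x ^ 2 \<le> real m ^ 2" using x by (intro power_mono) auto
    moreover have "3 * real d * real x \<le> 3 * real d * real m" using x by (intro mult_left_mono) auto
    moreover have "0 \<le> (real d - 3 * real m) ^ 2" by simp
    moreover have "(real d - 3 * real m) ^ 2 = real d ^ 2 - 6 * (real d * real m) + 9 * real m ^ 2"
      by (simp add: power2_eq_square algebra_simps)
    ultimately have "3 * real d ^ 2 + 3 * (real d * real x) + real x ^ 2 \<le> (7/2) * real d ^ 2 + 6 * real m ^ 2"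
      using zero_le_power2[of "real m"] unfolding mult.assoc by linarith
    from mult_left_mono[OF this, of "real x"]
    show "real (d + x) ^ 3 \<le> real d ^ 3 + real x * ((7/2) * real d ^ 2 + 6 * real m ^ 2)"
      by (simp add: power2_eq_square power3_eq_cube algebra_simps)
  qed
  moreover have "E (hist k) (potential (\<lambda>d. real d * ((7/2) * real d ^ 2 + 6 * real m ^ 2)) (Suc k))
    = (7/2) * mean_deg_cubed k + 6 * real m ^ 2 * (real m * (2 * real k + 1))"
    using E_potential_affine[of k "7/2" "\<lambda>d. real d ^ 3" "6 * real m ^ 2"]
    by (simp add: mean_deg_cubed_def algebra_simps power2_eq_square power3_eq_cube)
  ultimately show ?thesis
    by (simp add: divide_simps) (simp add: algebra_simps power2_eq_square power3_eq_cube)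
qed

text \<open>The exponent 19/10 lies between 7/4, the rate of the recursion, and 2. The room pays for
  the additive term: with the constant 24 that term is 7/24 of the bound's coefficient, and 7/2 +
  7/24 \<le> 38/10.\<close>

lemma mean_deg_cubed_le: "mean_deg_cubed k \<le> 24 * real m ^ 3 * (2 * real k + 1) powr (19/10)"
proof (induction k)
  case 0
  then show ?case by (simp add: mean_deg_cubed_0)
next
  case (Suc k)
  define u where "u = 2 * real k + 1"
  define K where "K = 24 * real m ^ 3"
  have u: "u \<ge> 1" and K: "K \<ge> 0" by (auto simp: u_def K_def)
  have "mean_deg_cubed (Suc k) \<le> (1 + (7/2) / u) * (K * u powr (19/10)) + (7/24) * K"
    using mean_deg_cubed_Suc_le[of k] mult_left_mono[OF Suc, of "1 + (7/2) / u"] u by (simp add: u_def K_def)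
  also have "\<dots> = K * (u powr (19/10) + (7/2) * u powr (9/10) + 7/24)"
    using u powr_add[of u 1 "9/10"] by (simp add: field_simps)
  also have "\<dots> \<le> K * (u powr (19/10) + (38/10) * u powr (9/10))"
    using ge_one_powr_ge_zero[OF u, of "9/10"] K by (intro mult_left_mono) auto
  also have "u powr (19/10) + (38/10) * u powr (9/10) = u powr (19/10) * (1 + (19/10) * (2 / u))"
    using u powr_add[of u 1 "9/10"] by (simp add: field_simps)
  also have "K * \<dots> \<le> K * (u powr (19/10) * (1 + 2 / u) powr (19/10))"
    using u K by (intro mult_left_mono powr_Bernoulli) auto
  also have "u powr (19/10) * (1 + 2 / u) powr (19/10) = (u * (1 + 2 / u)) powr (19/10)"
    using u by (simp add: powr_mult)
  also have "u * (1 + 2 / u) = 2 * real (Suc k) + 1"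
    using u by (simp add: u_def field_simps)
  finally show ?case by (simp add: K_def)
qed

text \<open>Up to a factor depending on m only, this bounds the mean number of coincidences (a
  repeated parent, or earlier twins) that the next arrival brings.\<close>

definition cubed_ratio :: "nat \<Rightarrow> real" where
  "cubed_ratio k = mean_deg_cubed k / (2 * real k + 1) ^ 2"

lemma cubed_ratio_nonneg: "0 \<le> cubed_ratio k"
  by (auto simp: cubed_ratio_def mean_deg_cubed_def potential_def intro!: sum_nonneg divide_nonneg_nonneg Bochner_Integration.integral_nonneg)

lemma cubed_ratio_tendsto: "cubed_ratio \<longlonglongrightarrow> 0"
proof (rule tendsto_sandwich[where f = "\<lambda>_. 0"])
  show "\<forall>\<^sub>F k in sequentially. cubed_ratio k \<le> 24 * real m ^ 3 * (2 * real k + 1) powr (19/10) / (2 * real k + 1) ^ 2"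
    unfolding cubed_ratio_def using mean_deg_cubed_le by (intro always_eventually allI divide_right_mono) auto
  show "(\<lambda>k. 24 * real m ^ 3 * (2 * real k + 1) powr (19/10) / (2 * real k + 1) ^ 2) \<longlonglongrightarrow> 0"
    by real_asymp
qed (auto simp: cubed_ratio_nonneg)

section \<open>Repeated parents and twins are rare\<close>

definition num_repeated :: "nat \<Rightarrow> (nat \<Rightarrow> nat list) \<Rightarrow> nat" where
  "num_repeated n h = card {v\<in>{2..n}. \<not> distinct (h v)}"

text \<open>Ordered pairs are counted and every vertex is its own twin, so the value for n \<ge> 1
  is n - 1 when there are no proper twins. Only the excess over that costs anything. A sum of class
  sizes is what the logarithm of their product is bounded by later.\<close>

definition num_twins :: "nat \<Rightarrow> (nat \<Rightarrow> nat list) \<Rightarrow> nat" where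
  "num_twins n h = (\<Sum>v\<in>{2..n}. card {u\<in>{2..n}. mset (h u) = mset (h v)})"

lemma num_repeated_upd: "num_repeated (Suc (Suc k)) (h(Suc (Suc k) := v)) = num_repeated (Suc k) h + of_bool (\<not> distinct v)"
proof -
  have "{u\<in>{2..Suc (Suc k)}. \<not> distinct ((h(Suc (Suc k) := v)) u)}
    = {u\<in>{2..Suc k}. \<not> distinct (h u)} \<union> (if distinct v then {} else {Suc (Suc k)})"
    by auto
  then show ?thesis by (simp add: num_repeated_def)
qed

lemma num_twins_alt: "real (num_twins n h) = (\<Sum>v\<in>{2..n}. \<Sum>u\<in>{2..n}. of_bool (mset (h u) = mset (h v)))"
  by (simp add: num_twins_def Int_def flip: Collect_conj_eq)

lemma num_twins_upd:
  "real (num_twins (Suc (Suc k)) (h(Suc (Suc k) := v)))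
    = real (num_twins (Suc k) h) + 1 + 2 * (\<Sum>u\<in>{2..Suc k}. of_bool (mset (h u) = mset v))"
proof -
  let ?g = "h(Suc (Suc k) := v)"
  let ?b = "\<lambda>x y. of_bool (mset x = mset y) :: real"
  have g: "?g u = h u" if "u \<in> {2..Suc k}" for u using that by auto
  have in1: "(\<Sum>u\<in>{2..Suc (Suc k)}. ?b (?g u) x) = ?b v x + (\<Sum>u\<in>{2..Suc k}. ?b (h u) x)" for x
    unfolding atLeast2_Suc
    by (subst sum.insert, simp, simp, intro arg_cong2[where f = "(+)"] sum.cong) (simp_all del: sum_of_bool_eq)
  have "real (num_twins (Suc (Suc k)) ?g) = (\<Sum>x\<in>{2..Suc (Suc k)}. ?b v (?g x) + (\<Sum>u\<in>{2..Suc k}. ?b (h u) (?g x)))"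
    unfolding num_twins_alt in1 ..
  also have "\<dots> = (1 + (\<Sum>u\<in>{2..Suc k}. ?b (h u) v))
    + (\<Sum>x\<in>{2..Suc k}. ?b v (h x) + (\<Sum>u\<in>{2..Suc k}. ?b (h u) (h x)))"
    unfolding atLeast2_Suc
    by (subst sum.insert, simp, simp, intro arg_cong2[where f = "(+)"] sum.cong) (simp_all del: sum_of_bool_eq)
  also have "\<dots> = real (num_twins (Suc k) h) + 1 + ((\<Sum>u\<in>{2..Suc k}. ?b (h u) v) + (\<Sum>u\<in>{2..Suc k}. ?b v (h u)))"
    unfolding num_twins_alt sum.distrib by (simp del: sum_of_bool_eq)
  also have "(\<Sum>u\<in>{2..Suc k}. ?b v (h u)) = (\<Sum>u\<in>{2..Suc k}. ?b (h u) v)"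
    by (intro sum.cong) auto
  finally show ?thesis by (simp del: fun_upd_apply)
qed

lemma sum_pmf_attachment_power_le:
  assumes h: "h \<in> histories (Suc k)"
  shows "(\<Sum>w\<in>{1..Suc k}. real (hdeg (Suc k) h w) * pmf (attachment k h) w ^ 2)
    \<le> potential (\<lambda>d. real d ^ 3) (Suc k) h / (2 * real k + 1) ^ 2"
  unfolding potential_def sum_divide_distrib
proof (rule sum_mono)
  fix w assume w: "w \<in> {1..Suc k}"
  have "1 \<le> real m" using m_pos by simp
  then have "pmf (attachment k h) w \<le> real (hdeg (Suc k) h w) / (2 * real k + 1)"
    using w by (simp only: pmf_attachment[OF h] if_True) (intro divide_left_mono, auto)
  then have "real (hdeg (Suc k) h w) * pmf (attachment k h) w ^ 2
    \<le> real (hdeg (Suc k) h w) * (real (hdeg (Suc k) h w) / (2 * real k + 1)) ^ 2"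
    by (intro mult_left_mono power_mono) auto
  then show "real (hdeg (Suc k) h w) * pmf (attachment k h) w ^ 2 \<le> real (hdeg (Suc k) h w) ^ 3 / (2 * real k + 1) ^ 2"
    by (simp add: power_divide power3_eq_cube power2_eq_square)
qed

lemma E_choice_not_distinct_le:
  assumes h: "h \<in> histories (Suc k)"
  shows "E (replicate_pmf m (attachment k h)) (\<lambda>v. of_bool (\<not> distinct v))
    \<le> real m ^ 2 * (potential (\<lambda>d. real d ^ 3) (Suc k) h / (2 * real k + 1) ^ 2)"
proof -
  have "E (replicate_pmf m (attachment k h)) (\<lambda>v. of_bool (\<not> distinct v))
    \<le> real m ^ 2 * (\<Sum>w\<in>{1..Suc k}. pmf (attachment k h) w ^ 2)"
    using E_not_distinct_le[of "attachment k h" m] by (simp add: set_attachment[OF h])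
  \<comment> \<open>A degree is at least 1; inserting it as a weight lets the third moment, which
    the twins require, serve here as well.\<close>
  also have "\<dots> \<le> real m ^ 2 * (\<Sum>w\<in>{1..Suc k}. real (hdeg (Suc k) h w) * pmf (attachment k h) w ^ 2)"
    using hdeg_pos[of "Suc k" h] by (intro mult_left_mono sum_mono) (auto simp: mult_le_cancel_right1 Suc_le_eq)
  also have "\<dots> \<le> real m ^ 2 * (potential (\<lambda>d. real d ^ 3) (Suc k) h / (2 * real k + 1) ^ 2)"
    by (intro mult_left_mono sum_pmf_attachment_power_le h) auto
  finally show ?thesis .
qed

lemma E_choice_twins_le:
  assumes h: "h \<in> histories (Suc k)"
  shows "E (replicate_pmf m (attachment k h)) (\<lambda>v. \<Sum>u\<in>{2..Suc k}. of_bool (mset (h u) = mset v))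
    \<le> fact m * (potential (\<lambda>d. real d ^ 3) (Suc k) h / (2 * real k + 1) ^ 2)"
proof -
  have hu: "length (h u) = m" "set (h u) \<subseteq> {1..Suc k}" if "u \<in> {2..Suc k}" for u
    using that h by (force simp: histories_def)+
  have "E (replicate_pmf m (attachment k h)) (\<lambda>v. \<Sum>u\<in>{2..Suc k}. of_bool (mset (h u) = mset v))
    = (\<Sum>u\<in>{2..Suc k}. E (replicate_pmf m (attachment k h)) (\<lambda>v. of_bool (mset (h u) = mset v)))"
    by (rule E_sum[OF finite_choice[OF h]])
  also have "\<dots> \<le> (\<Sum>u\<in>{2..Suc k}. fact m * (\<Sum>x\<leftarrow>h u. pmf (attachment k h) x ^ 2))"
    using E_mset_eq_le[of "attachment k h" "h u" for u] hu m2
    by (intro sum_mono) (metis finite_atLeastAtMost set_attachment[OF h])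
  also have "\<dots> = fact m * (\<Sum>u\<in>{2..Suc k}. \<Sum>w\<in>{1..Suc k}. real (count_list (h u) w) * pmf (attachment k h) w ^ 2)"
    unfolding sum_distrib_left[symmetric]
    by (intro arg_cong2[where f = "(*)"] sum.cong refl sum_count_list_mult[symmetric] hu) auto
  also have "(\<Sum>u\<in>{2..Suc k}. \<Sum>w\<in>{1..Suc k}. real (count_list (h u) w) * pmf (attachment k h) w ^ 2)
    = (\<Sum>w\<in>{1..Suc k}. real (\<Sum>u\<in>{2..Suc k}. count_list (h u) w) * pmf (attachment k h) w ^ 2)"
    by (subst sum.swap) (simp add: sum_distrib_right)
  \<comment> \<open>As a chosen parent, w occurs \<open>hdeg - m\<close> times altogether.\<close>
  also have "\<dots> \<le> (\<Sum>w\<in>{1..Suc k}. real (hdeg (Suc k) h w) * pmf (attachment k h) w ^ 2)"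
    by (intro sum_mono mult_right_mono) (auto simp: hdeg_def)
  also have "\<dots> \<le> potential (\<lambda>d. real d ^ 3) (Suc k) h / (2 * real k + 1) ^ 2"
    by (rule sum_pmf_attachment_power_le[OF h])
  finally show ?thesis by simp
qed

lemma E_num_repeated_le: "E (hist k) (\<lambda>h. real (num_repeated (Suc k) h)) \<le> real m ^ 2 * (\<Sum>j<k. cubed_ratio j)"
proof (induction k)
  case 0
  then show ?case by (simp add: num_repeated_def)
next
  case (Suc k)
  have "E (hist (Suc k)) (\<lambda>h. real (num_repeated (Suc (Suc k)) h))
    \<le> E (hist k) (\<lambda>h. real (num_repeated (Suc k) h)
        + real m ^ 2 * (potential (\<lambda>d. real d ^ 3) (Suc k) h / (2 * real k + 1) ^ 2))"
    unfolding E_hist_Suc num_repeated_upd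
  proof (rule E_mono[OF finite_hist])
    fix h assume "h \<in> set_pmf (hist k)"
    then have h: "h \<in> histories (Suc k)" by (simp add: set_hist)
    show "E (replicate_pmf m (attachment k h)) (\<lambda>v. real (num_repeated (Suc k) h + of_bool (\<not> distinct v)))
      \<le> real (num_repeated (Suc k) h) + real m ^ 2 * (potential (\<lambda>d. real d ^ 3) (Suc k) h / (2 * real k + 1) ^ 2)"
      using E_choice_not_distinct_le[OF h] E_add[OF finite_choice[OF h], of "\<lambda>_. real (num_repeated (Suc k) h)"]
      by simp
  qed
  also have "\<dots> = E (hist k) (\<lambda>h. real (num_repeated (Suc k) h)) + real m ^ 2 * cubed_ratio k"
    by (simp add: E_add[OF finite_hist] cubed_ratio_def mean_deg_cubed_def)
  finally show ?case using Suc by (simp add: algebra_simps)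
qed

lemma E_num_twins_le: "E (hist k) (\<lambda>h. real (num_twins (Suc k) h)) \<le> real k + 2 * fact m * (\<Sum>j<k. cubed_ratio j)"
proof (induction k)
  case 0
  then show ?case by (simp add: num_twins_def)
next
  case (Suc k)
  have "E (hist (Suc k)) (\<lambda>h. real (num_twins (Suc (Suc k)) h))
    \<le> E (hist k) (\<lambda>h. (real (num_twins (Suc k) h) + 1)
        + 2 * fact m * (potential (\<lambda>d. real d ^ 3) (Suc k) h / (2 * real k + 1) ^ 2))"
    unfolding E_hist_Suc num_twins_upd
  proof (rule E_mono[OF finite_hist])
    fix h assume "h \<in> set_pmf (hist k)"
    then have h: "h \<in> histories (Suc k)" by (simp add: set_hist)
    show "E (replicate_pmf m (attachment k h)) (\<lambda>v. real (num_twins (Suc k) h) + 1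
        + 2 * (\<Sum>u\<in>{2..Suc k}. of_bool (mset (h u) = mset v)))
      \<le> (real (num_twins (Suc k) h) + 1)
        + 2 * fact m * (potential (\<lambda>d. real d ^ 3) (Suc k) h / (2 * real k + 1) ^ 2)"
      unfolding E_add[OF finite_choice[OF h], of "\<lambda>_. real (num_twins (Suc k) h) + 1"]
      using E_choice_twins_le[OF h] by simp
  qed
  also have "\<dots> = E (hist k) (\<lambda>h. real (num_twins (Suc k) h)) + 1 + 2 * fact m * cubed_ratio k"
    by (simp add: E_add[OF finite_hist] cubed_ratio_def mean_deg_cubed_def)
  finally show ?case using Suc by (simp add: algebra_simps)
qed

section \<open>Entropy of the history\<close>

lemma prod_list_pos:
  fixes f :: "'b \<Rightarrow> real"
  assumes "\<And>x. x \<in> set v \<Longrightarrow> f x > 0"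
  shows "(\<Prod>x\<leftarrow>v. f x) > 0"
  using assms by (induction v) auto

lemma ln_prod_list:
  assumes "\<And>x. x \<in> set v \<Longrightarrow> f x > 0"
  shows "ln (\<Prod>x\<leftarrow>v. f x) = (\<Sum>x\<leftarrow>v. ln (f x :: real))"
  using assms
proof (induction v)
  case (Cons x v)
  moreover have "(\<Prod>x\<leftarrow>v. f x) > 0" using Cons.prems by (intro prod_list_pos) auto
  moreover have "f x > 0" using Cons.prems by simp
  ultimately show ?case by (simp add: ln_mult_pos)
qed simp

text \<open>Chain rule: given the past, each of the m choices contributes the logarithm of the total
  degree minus the mean logarithm of the chosen degree, and the latter is a degree-weighted mean,
  whence d ln d.\<close>

lemma E_neg_ln_pmf_hist:
  "E (hist k) (\<lambda>h. - ln (pmf (hist k) h))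
    = (\<Sum>j<k. real m * ln (real m * (2 * real j + 1)) - mean_deg_ln j / (2 * real j + 1))"
proof (induction k)
  case (Suc k)
  let ?c = "ln (real m * (2 * real k + 1))"
  have "E (hist (Suc k)) (\<lambda>h. - ln (pmf (hist (Suc k)) h))
    = E (hist k) (\<lambda>h. (- ln (pmf (hist k) h) + real m * ?c)
       - potential (\<lambda>d. real d * ln (real d)) (Suc k) h / (2 * real k + 1))"
    unfolding E_hist_Suc
  proof (rule E_cong)
    fix h assume "h \<in> set_pmf (hist k)"
    then have h: "h \<in> histories (Suc k)" and ph: "pmf (hist k) h > 0"
      using pmf_positive[of h "hist k"] by (auto simp: set_hist)
    have "E (replicate_pmf m (attachment k h)) (\<lambda>v. - ln (pmf (hist (Suc k)) (h(Suc (Suc k) := v))))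
      = E (replicate_pmf m (attachment k h)) (\<lambda>v. (- ln (pmf (hist k) h) + real m * ?c) - (\<Sum>x\<leftarrow>v. ln (real (hdeg (Suc k) h x))))"
    proof (rule E_cong)
      fix v assume "v \<in> set_pmf (replicate_pmf m (attachment k h))"
      then have v: "length v = m" "set v \<subseteq> {1..Suc k}" by (auto simp: set_choice[OF h])
      let ?f = "\<lambda>x. real (hdeg (Suc k) h x) / (real m * (2 * real k + 1))"
      have f: "?f x > 0" for x using hdeg_pos m_pos by (simp add: add_nonneg_pos)
      have "(\<Prod>x\<leftarrow>v. ?f x) > 0" by (rule prod_list_pos[OF f])
      then have "ln (pmf (hist (Suc k)) (h(Suc (Suc k) := v))) = ln (pmf (hist k) h) + (\<Sum>x\<leftarrow>v. ln (?f x))"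
        unfolding pmf_hist_Suc[OF h v] using ph f by (subst ln_mult) (auto simp: ln_prod_list[OF f])
      also have "(\<Sum>x\<leftarrow>v. ln (?f x)) = (\<Sum>x\<leftarrow>v. ln (real (hdeg (Suc k) h x)) - ?c)"
        using hdeg_pos m_pos by (intro arg_cong[of _ _ sum_list] map_cong) (auto simp: ln_div add_nonneg_pos)
      also have "\<dots> = (\<Sum>x\<leftarrow>v. ln (real (hdeg (Suc k) h x))) - real m * ?c"
        by (simp add: sum_list_subtractf v sum_list_triv)
      finally show "- ln (pmf (hist (Suc k)) (h(Suc (Suc k) := v)))
        = (- ln (pmf (hist k) h) + real m * ?c) - (\<Sum>x\<leftarrow>v. ln (real (hdeg (Suc k) h x)))"
        by (simp del: fun_upd_apply)
    qed
    also have "\<dots> = (- ln (pmf (hist k) h) + real m * ?c)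
       - potential (\<lambda>d. real d * ln (real d)) (Suc k) h / (2 * real k + 1)"
      by (subst E_diff[OF finite_choice[OF h]])
        (simp only: E_const E_choice_sum_list[OF h] potential_def)
    finally show "E (replicate_pmf m (attachment k h)) (\<lambda>v. - ln (pmf (hist (Suc k)) (h(Suc (Suc k) := v))))
      = (- ln (pmf (hist k) h) + real m * ?c)
       - potential (\<lambda>d. real d * ln (real d)) (Suc k) h / (2 * real k + 1)" .
  qed
  also have "\<dots> = E (hist k) (\<lambda>h. - ln (pmf (hist k) h)) + real m * ?c - mean_deg_ln k / (2 * real k + 1)"
    unfolding mean_deg_ln_def
    by (subst E_diff[OF finite_hist], subst E_add[OF finite_hist]) simp
  finally show ?case unfolding Suc.IH by simp
qed simp

end

section \<open>Random insertion of labels\<close>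

definition entropy_pmf :: "'a pmf \<Rightarrow> real" where
  "entropy_pmf p = E p (\<lambda>x. - ln (pmf p x))"

lemma entropy_pmf_le_ln_card:
  assumes fin: "finite (set_pmf p)"
  shows "entropy_pmf p \<le> ln (real (card (set_pmf p)))"
proof -
  let ?N = "real (card (set_pmf p))"
  have N: "?N > 0" using fin set_pmf_not_empty[of p] by (simp add: card_gt_0_iff)
  have "entropy_pmf p - ln ?N = (\<Sum>x\<in>set_pmf p. pmf p x * (- ln (pmf p x) - ln ?N))"
    using fin sum_pmf_eq_1[OF fin subset_refl]
    by (simp add: entropy_pmf_def E_finite right_diff_distrib sum_subtractf sum_negf flip: sum_distrib_right)
  also have "\<dots> \<le> (\<Sum>x\<in>set_pmf p. 1 / ?N - pmf p x)"
  proof (rule sum_mono)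
    fix x assume "x \<in> set_pmf p"
    then have x: "pmf p x > 0" by (rule pmf_positive)
    have "ln (1 / (pmf p x * ?N)) \<le> 1 / (pmf p x * ?N) - 1"
      using x N by (intro ln_le_minus_one) simp
    then have "pmf p x * (- ln (pmf p x) - ln ?N) \<le> pmf p x * (1 / (pmf p x * ?N) - 1)"
      using x N by (intro mult_left_mono) (simp_all add: ln_div ln_mult)
    then show "pmf p x * (- ln (pmf p x) - ln ?N) \<le> 1 / ?N - pmf p x"
      using x by (simp add: right_diff_distrib)
  qed
  also have "\<dots> = 0"
    using N sum_pmf_eq_1[OF fin subset_refl] by (simp add: sum_subtractf)
  finally show ?thesis by simp
qed

text \<open>Chain rule for a uniform extra step. Injectivity says that state and step can be read
  off the result, so no entropy is lost.\<close>

lemma entropy_pmf_bind_uniform: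
  assumes fin: "finite (set_pmf p)"
    and A: "\<And>x. x \<in> set_pmf p \<Longrightarrow> finite (A x) \<and> A x \<noteq> {}"
    and inj: "\<And>x y q r. x \<in> set_pmf p \<Longrightarrow> y \<in> set_pmf p \<Longrightarrow> q \<in> A x \<Longrightarrow> r \<in> A y \<Longrightarrow> g x q = g y r \<Longrightarrow> x = y \<and> q = r"
  shows "entropy_pmf (bind_pmf p (\<lambda>x. map_pmf (g x) (pmf_of_set (A x)))) = entropy_pmf p + E p (\<lambda>x. ln (real (card (A x))))"
proof -
  let ?b = "bind_pmf p (\<lambda>x. map_pmf (g x) (pmf_of_set (A x)))"
  have pmf: "pmf ?b (g x q) = pmf p x / real (card (A x))" if x: "x \<in> set_pmf p" and q: "q \<in> A x" for x q
  proof -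
    have "pmf ?b (g x q) = E p (\<lambda>y. indicator {x} y * (1 / real (card (A x))))"
      unfolding pmf_bind
    proof (rule E_cong)
      fix y assume y: "y \<in> set_pmf p"
      show "pmf (map_pmf (g y) (pmf_of_set (A y))) (g x q) = indicator {x} y * (1 / real (card (A x)))"
      proof (cases "y = x")
        case True
        have "inj_on (g x) (set_pmf (pmf_of_set (A x)))"
          using A[OF x] inj[OF x x] by (auto simp: inj_on_def)
        then have "pmf (map_pmf (g x) (pmf_of_set (A x))) (g x q) = pmf (pmf_of_set (A x)) q"
          using A[OF x] q by (intro pmf_map_inj) auto
        then show ?thesis using True A[OF x] q by simp
      next
        case False
        then have "g x q \<notin> g y ` A y" using inj[OF x y q] by auto
        then show ?thesis using False A[OF y] by (auto simp: pmf_eq_0_set_pmf)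
      qed
    qed
    then show ?thesis by (simp add: pmf.rep_eq)
  qed
  have "entropy_pmf ?b = E p (\<lambda>x. E (map_pmf (g x) (pmf_of_set (A x))) (\<lambda>y. - ln (pmf ?b y)))"
    unfolding entropy_pmf_def using fin A by (intro E_bind) auto
  also have "\<dots> = E p (\<lambda>x. - ln (pmf p x) + ln (real (card (A x))))"
  proof (rule E_cong)
    fix x assume x: "x \<in> set_pmf p"
    have "E (map_pmf (g x) (pmf_of_set (A x))) (\<lambda>y. - ln (pmf ?b y))
      = E (pmf_of_set (A x)) (\<lambda>q. - ln (pmf p x) + ln (real (card (A x))))"
      unfolding integral_map_pmf
    proof (rule E_cong)
      fix q assume "q \<in> set_pmf (pmf_of_set (A x))"
      then have q: "q \<in> A x" using A[OF x] by simp
      have "card (A x) > 0" "pmf p x > 0" using A[OF x] x by (auto simp: card_gt_0_iff pmf_positive)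
      then show "- ln (pmf ?b (g x q)) = - ln (pmf p x) + ln (real (card (A x)))"
        by (simp add: pmf[OF x q] ln_div)
    qed
    then show "E (map_pmf (g x) (pmf_of_set (A x))) (\<lambda>y. - ln (pmf ?b y))
      = - ln (pmf p x) + ln (real (card (A x)))" by simp
  qed
  also have "\<dots> = entropy_pmf p + E p (\<lambda>x. ln (real (card (A x))))"
    unfolding entropy_pmf_def by (rule E_add[OF fin])
  finally show ?thesis .
qed

text \<open>\<open>\<sigma> v\<close> is the position of \<open>v\<close> in a linear order.
  Positions from \<open>q\<close> on move up by one, so the order among the old vertices persists.
  Absent vertices have position 0 and keep it, because only positions \<open>q\<close> \<ge> 2 are
  ever inserted.\<close>

definition insert_label :: "nat \<Rightarrow> nat \<Rightarrow> (nat \<Rightarrow> nat) \<Rightarrow> nat \<Rightarrow> nat" where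
  "insert_label x q \<sigma> = (\<lambda>v. if v = x then q else if q \<le> \<sigma> v then Suc (\<sigma> v) else \<sigma> v)"

text \<open>The positions behind all parents, up to a new last one. Position 1 is never among them,
  so vertex 1 stays in front.\<close>

definition slots :: "nat \<Rightarrow> (nat \<Rightarrow> nat) \<Rightarrow> nat list \<Rightarrow> nat set" where
  "slots n \<sigma> v = {Suc (Max (\<sigma> ` set v))..Suc n}"

text \<open>In general this law is not uniform on the linear extensions, since the number of slots
  depends on the earlier positions. Its entropy is nevertheless a lower bound for the logarithm of
  their number, and unlike that number it can be followed from arrival to arrival.\<close>

primrec insertion_pmf :: "nat \<Rightarrow> (nat \<Rightarrow> nat list) \<Rightarrow> (nat \<Rightarrow> nat) pmf" where
  "insertion_pmf 0 h = return_pmf ((\<lambda>_. 0)(1 := 1))"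
| "insertion_pmf (Suc k) h = bind_pmf (insertion_pmf k h) (\<lambda>\<sigma>. map_pmf (\<lambda>q. insert_label (Suc (Suc k)) q \<sigma>)
     (pmf_of_set (slots (Suc k) \<sigma> (h (Suc (Suc k))))))"

declare insertion_pmf.simps(2) [simp del]

text \<open>The linear extensions of the parent order, given by positions. The value 0 off the
  vertex set makes each of them a single function; vertex 1 keeps its label because it bears the
  loops.\<close>

definition labellings :: "nat \<Rightarrow> (nat \<Rightarrow> nat list) \<Rightarrow> (nat \<Rightarrow> nat) set" where
  "labellings n h = {\<sigma>. bij_betw \<sigma> {1..n} {1..n} \<and> (\<forall>v. v \<notin> {1..n} \<longrightarrow> \<sigma> v = 0) \<and> \<sigma> 1 = 1
     \<and> (\<forall>v\<in>{2..n}. \<forall>w\<in>set (h v). \<sigma> w < \<sigma> v)}"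

lemma labellings_range: "\<sigma> \<in> labellings n h \<Longrightarrow> w \<in> {1..n} \<Longrightarrow> \<sigma> w \<in> {1..n}"
  unfolding labellings_def using bij_betwE by blast

lemma slots_props:
  assumes \<sigma>: "\<sigma> \<in> labellings n h" and v: "v \<noteq> []" "set v \<subseteq> {1..n}"
  shows "finite (slots n \<sigma> v)" "slots n \<sigma> v \<noteq> {}" "slots n \<sigma> v \<subseteq> {2..Suc n}"
    "\<And>q x. q \<in> slots n \<sigma> v \<Longrightarrow> x \<in> set v \<Longrightarrow> \<sigma> x < q"
    "\<exists>x\<in>set v. slots n \<sigma> v = {Suc (\<sigma> x)..Suc n}"
proof -
  have "Max (\<sigma> ` set v) \<in> \<sigma> ` set v" using v by (intro Max_in) auto
  then obtain x where x: "x \<in> set v" "Max (\<sigma> ` set v) = \<sigma> x" by auto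
  have r: "\<sigma> x \<in> {1..n}" using labellings_range[OF \<sigma>] x v by auto
  show "finite (slots n \<sigma> v)" by (simp add: slots_def)
  show "slots n \<sigma> v \<noteq> {}" "slots n \<sigma> v \<subseteq> {2..Suc n}" using x r by (auto simp: slots_def)
  show "\<exists>x\<in>set v. slots n \<sigma> v = {Suc (\<sigma> x)..Suc n}" using x by (auto simp: slots_def)
  show "\<sigma> y < q" if "q \<in> slots n \<sigma> v" "y \<in> set v" for q y
  proof -
    have "\<sigma> y \<le> Max (\<sigma> ` set v)" using that by (intro Max_ge) auto
    also have "\<dots> < q" using that by (simp add: slots_def)
    finally show ?thesis .
  qed
qed

lemma insert_label_in_labellings:
  assumes \<sigma>: "\<sigma> \<in> labellings n h" and n: "n \<ge> 1"
    and v: "h (Suc n) \<noteq> []" "set (h (Suc n)) \<subseteq> {1..n}"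
    and h: "\<And>u. u \<in> {2..n} \<Longrightarrow> set (h u) \<subseteq> {1..<u}"
    and q: "q \<in> slots n \<sigma> (h (Suc n))"
  shows "insert_label (Suc n) q \<sigma> \<in> labellings (Suc n) h"
proof -
  let ?s = "insert_label (Suc n) q \<sigma>"
  note sl = slots_props[OF \<sigma> v]
  have q2: "2 \<le> q" "q \<le> Suc n" using sl(3) q by auto
  have out: "\<sigma> u = 0" if "u \<notin> {1..n}" for u using \<sigma> that by (auto simp: labellings_def)
  have inj: "inj_on \<sigma> {1..n}" using \<sigma> by (auto simp: labellings_def bij_betw_def)
  have "inj_on ?s {1..Suc n}"
  proof (rule inj_onI)
    fix x y assume xy: "x \<in> {1..Suc n}" "y \<in> {1..Suc n}" "?s x = ?s y"
    show "x = y"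
    proof (cases "x = Suc n \<or> y = Suc n")
      case True
      then show ?thesis using xy(3) by (auto simp: insert_label_def split: if_splits)
    next
      case False
      then have "\<sigma> x = \<sigma> y" using xy(3) by (auto simp: insert_label_def split: if_splits)
      moreover have "x \<in> {1..n}" "y \<in> {1..n}" using False xy by auto
      ultimately show ?thesis using inj by (auto dest: inj_onD)
    qed
  qed
  moreover have "?s ` {1..Suc n} \<subseteq> {1..Suc n}"
    using labellings_range[OF \<sigma>] q2 by (fastforce simp: insert_label_def le_Suc_eq)
  ultimately have bij: "bij_betw ?s {1..Suc n} {1..Suc n}"
    unfolding bij_betw_def using endo_inj_surj[of "{1..Suc n}" ?s] by blast
  have zero: "?s u = 0" if "u \<notin> {1..Suc n}" for u
    using that q2 out[of u] by (auto simp: insert_label_def)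
  have one: "?s 1 = 1" using \<sigma> q2 n by (auto simp: insert_label_def labellings_def)
  have mono: "?s w < ?s u" if u: "u \<in> {2..Suc n}" and w: "w \<in> set (h u)" for u w
  proof (cases "u = Suc n")
    case True
    then have "w \<noteq> Suc n" "\<sigma> w < q" using v w sl(4)[OF q] by auto
    then show ?thesis using True by (simp add: insert_label_def)
  next
    case False
    then have u': "u \<in> {2..n}" using u by auto
    then have "w \<noteq> Suc n" using h[OF u'] w by auto
    moreover have "\<sigma> w < \<sigma> u" using \<sigma> u' w by (auto simp: labellings_def)
    ultimately show ?thesis using False by (auto simp: insert_label_def)
  qed
  show ?thesis
    unfolding labellings_def mem_Collect_eq
    by (intro conjI allI impI ballI bij zero one mono)
qed

lemma set_insertion_pmf_subset:
  assumes "\<And>u. u \<in> {2..Suc k} \<Longrightarrow> h u \<noteq> [] \<and> set (h u) \<subseteq> {1..<u}"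
  shows "set_pmf (insertion_pmf k h) \<subseteq> labellings (Suc k) h"
  using assms
proof (induction k)
  case 0
  have "bij_betw ((\<lambda>_. 0)(Suc 0 := Suc 0)) {Suc 0} {Suc 0}"
    by (simp add: bij_betw_def)
  then show ?case by (auto simp: labellings_def)
next
  case (Suc k)
  have IH: "set_pmf (insertion_pmf k h) \<subseteq> labellings (Suc k) h" using Suc by simp
  have v: "h (Suc (Suc k)) \<noteq> []" "set (h (Suc (Suc k))) \<subseteq> {1..Suc k}"
    using Suc.prems[of "Suc (Suc k)"] by auto
  show ?case
  proof
    fix s assume "s \<in> set_pmf (insertion_pmf (Suc k) h)"
    then obtain \<sigma> q where \<sigma>: "\<sigma> \<in> set_pmf (insertion_pmf k h)"
      and q: "q \<in> set_pmf (pmf_of_set (slots (Suc k) \<sigma> (h (Suc (Suc k)))))"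
      and s: "s = insert_label (Suc (Suc k)) q \<sigma>"
      by (auto simp: insertion_pmf.simps(2))
    have \<sigma>': "\<sigma> \<in> labellings (Suc k) h" using \<sigma> IH by auto
    have "q \<in> slots (Suc k) \<sigma> (h (Suc (Suc k)))"
      using q slots_props(1,2)[OF \<sigma>' v] by simp
    then show "s \<in> labellings (Suc (Suc k)) h"
      unfolding s using Suc.prems by (intro insert_label_in_labellings[OF \<sigma>' _ v]) auto
  qed
qed

lemma finite_labellings: "finite (labellings n h)"
proof (rule finite_subset)
  show "labellings n h \<subseteq> PiE_dflt {1..n} 0 (\<lambda>_. {1..n})"
  proof
    fix \<sigma> assume \<sigma>: "\<sigma> \<in> labellings n h"
    show "\<sigma> \<in> PiE_dflt {1..n} 0 (\<lambda>_. {1..n})"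
      using labellings_range[OF \<sigma>] \<sigma> by (auto simp: PiE_dflt_def labellings_def simp del: atLeastAtMost_iff)
  qed
qed (rule finite_PiE_dflt; simp)

lemma insertion_pmf_cong: "(\<And>u. u \<in> {2..Suc k} \<Longrightarrow> h u = g u) \<Longrightarrow> insertion_pmf k h = insertion_pmf k g"
proof (induction k)
  case (Suc k)
  then have "insertion_pmf k h = insertion_pmf k g" "h (Suc (Suc k)) = g (Suc (Suc k))" by auto
  then show ?case by (simp add: insertion_pmf.simps(2))
qed simp

context pref_attach
begin

lemma histories_wf: "h \<in> histories n \<Longrightarrow> u \<in> {2..n} \<Longrightarrow> h u \<noteq> [] \<and> set (h u) \<subseteq> {1..<u}"
  using m_pos by (auto simp: histories_def)

lemma set_insertion_pmf: "h \<in> histories (Suc k) \<Longrightarrow> set_pmf (insertion_pmf k h) \<subseteq> labellings (Suc k) h"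
  by (intro set_insertion_pmf_subset histories_wf)

lemma finite_insertion_pmf: "h \<in> histories (Suc k) \<Longrightarrow> finite (set_pmf (insertion_pmf k h))"
  using set_insertion_pmf finite_labellings by (rule finite_subset)

lemma insertion_pmf_upd: "insertion_pmf (Suc k) (h(Suc (Suc k) := v)) = bind_pmf (insertion_pmf k h)
   (\<lambda>\<sigma>. map_pmf (\<lambda>q. insert_label (Suc (Suc k)) q \<sigma>) (pmf_of_set (slots (Suc k) \<sigma> v)))"
proof -
  have "insertion_pmf k (h(Suc (Suc k) := v)) = insertion_pmf k h" by (rule insertion_pmf_cong) auto
  then show ?thesis by (simp add: insertion_pmf.simps(2))
qed

lemma insertion_pmf_slots:
  assumes "h \<in> histories (Suc k)" "\<sigma> \<in> set_pmf (insertion_pmf k h)" "v \<in> set_pmf (replicate_pmf m (attachment k h))"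
  shows "\<sigma> \<in> labellings (Suc k) h" "v \<noteq> []" "set v \<subseteq> {1..Suc k}" "length v = m"
    "finite (slots (Suc k) \<sigma> v)" "slots (Suc k) \<sigma> v \<noteq> {}"
proof -
  show \<sigma>: "\<sigma> \<in> labellings (Suc k) h" using assms set_insertion_pmf by auto
  show v: "v \<noteq> []" "set v \<subseteq> {1..Suc k}" and "length v = m"
    using assms(3) m_pos by (auto simp: set_choice[OF assms(1)])
  show "finite (slots (Suc k) \<sigma> v)" "slots (Suc k) \<sigma> v \<noteq> {}"
    using slots_props(1,2)[OF \<sigma> v] by auto
qed

section \<open>The joint law of a history and its random labelling\<close>

definition joint_E :: "nat \<Rightarrow> ((nat \<Rightarrow> nat list) \<Rightarrow> (nat \<Rightarrow> nat) \<Rightarrow> real) \<Rightarrow> real" where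
  "joint_E k f = E (hist k) (\<lambda>h. E (insertion_pmf k h) (f h))"

lemma joint_E_mono:
  assumes "\<And>h \<sigma>. h \<in> histories (Suc k) \<Longrightarrow> \<sigma> \<in> set_pmf (insertion_pmf k h) \<Longrightarrow> f h \<sigma> \<le> g h \<sigma>"
  shows "joint_E k f \<le> joint_E k g"
  unfolding joint_E_def using assms by (intro E_mono finite_hist) (auto simp: set_hist finite_insertion_pmf)

lemma joint_E_cong:
  assumes "\<And>h \<sigma>. h \<in> histories (Suc k) \<Longrightarrow> \<sigma> \<in> set_pmf (insertion_pmf k h) \<Longrightarrow> f h \<sigma> = g h \<sigma>"
  shows "joint_E k f = joint_E k g"
  using assms by (intro antisym joint_E_mono) auto

lemma joint_E_add: "joint_E k (\<lambda>h \<sigma>. f h \<sigma> + g h \<sigma>) = joint_E k f + joint_E k g"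
proof -
  have "joint_E k (\<lambda>h \<sigma>. f h \<sigma> + g h \<sigma>) = E (hist k) (\<lambda>h. E (insertion_pmf k h) (f h) + E (insertion_pmf k h) (g h))"
    unfolding joint_E_def by (intro E_cong E_add) (simp add: set_hist finite_insertion_pmf)
  then show ?thesis by (simp add: joint_E_def E_add[OF finite_hist])
qed

lemma joint_E_cmult: "joint_E k (\<lambda>h \<sigma>. c * f h \<sigma>) = c * joint_E k f"
  by (simp add: joint_E_def)

lemma joint_E_const [simp]: "joint_E k (\<lambda>h \<sigma>. c) = c"
  by (simp add: joint_E_def)

lemma joint_E_sum: "finite I \<Longrightarrow> joint_E k (\<lambda>h \<sigma>. \<Sum>i\<in>I. f i h \<sigma>) = (\<Sum>i\<in>I. joint_E k (f i))"
  by (induction I rule: finite_induct) (simp_all add: joint_E_add)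

text \<open>Given the history, the next choices do not depend on the labelling. The two expectations
  may therefore be exchanged, so that the labelling is fixed before the choices are drawn.\<close>

lemma joint_E_Suc:
  "joint_E (Suc k) f = joint_E k (\<lambda>h \<sigma>. E (replicate_pmf m (attachment k h)) (\<lambda>v.
     E (pmf_of_set (slots (Suc k) \<sigma> v)) (\<lambda>q. f (h(Suc (Suc k) := v)) (insert_label (Suc (Suc k)) q \<sigma>))))"
proof -
  have "joint_E (Suc k) f = E (hist k) (\<lambda>h. E (replicate_pmf m (attachment k h)) (\<lambda>v.
     E (insertion_pmf k h) (\<lambda>\<sigma>. E (pmf_of_set (slots (Suc k) \<sigma> v))
       (\<lambda>q. f (h(Suc (Suc k) := v)) (insert_label (Suc (Suc k)) q \<sigma>)))))"
    unfolding joint_E_def E_hist_Suc insertion_pmf_upd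
  proof (intro E_cong)
    fix h v assume "h \<in> set_pmf (hist k)" and v: "v \<in> set_pmf (replicate_pmf m (attachment k h))"
    then have h: "h \<in> histories (Suc k)" by (simp add: set_hist)
    show "E (insertion_pmf k h \<bind> (\<lambda>\<sigma>. map_pmf (\<lambda>q. insert_label (Suc (Suc k)) q \<sigma>) (pmf_of_set (slots (Suc k) \<sigma> v))))
        (f (h(Suc (Suc k) := v)))
      = E (insertion_pmf k h) (\<lambda>\<sigma>. E (pmf_of_set (slots (Suc k) \<sigma> v))
       (\<lambda>q. f (h(Suc (Suc k) := v)) (insert_label (Suc (Suc k)) q \<sigma>)))"
      using insertion_pmf_slots[OF h _ v]
      by (subst E_bind) (auto simp: finite_insertion_pmf[OF h] simp del: fun_upd_apply)
  qed
  also have "\<dots> = joint_E k (\<lambda>h \<sigma>. E (replicate_pmf m (attachment k h)) (\<lambda>v.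
     E (pmf_of_set (slots (Suc k) \<sigma> v)) (\<lambda>q. f (h(Suc (Suc k) := v)) (insert_label (Suc (Suc k)) q \<sigma>))))"
    unfolding joint_E_def
    by (intro E_cong E_swap) (auto simp: finite_insertion_pmf set_hist finite_choice)
  finally show ?thesis .
qed

section \<open>Total degree carried by the last positions\<close>

definition top_weight :: "nat \<Rightarrow> (nat \<Rightarrow> nat list) \<Rightarrow> (nat \<Rightarrow> nat) \<Rightarrow> nat \<Rightarrow> real" where
  "top_weight n h \<sigma> c = (\<Sum>w\<in>{1..n}. real (hdeg n h w) * of_bool (c \<le> \<sigma> w))"

text \<open>The cutoff moves from c to c + 1, so the number of last positions stays the same. If the
  new vertex lands among them, it brings degree m and pushes out the vertex at position c, and
  chosen parents above c gain. If it lands before them, the last positions hold the same vertices as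
  before, and no parent is among them because all parents precede q; the sum over \<open>v\<close>
  is then just a nonnegative surplus that keeps the formula uniform.\<close>

lemma top_weight_insert_le:
  assumes h: "h \<in> histories (Suc k)" and \<sigma>: "\<sigma> \<in> labellings (Suc k) h"
    and v: "v \<noteq> []" "set v \<subseteq> {1..Suc k}" and q: "q \<in> slots (Suc k) \<sigma> v" and c: "1 \<le> c"
  shows "top_weight (Suc (Suc k)) (h(Suc (Suc k) := v)) (insert_label (Suc (Suc k)) q \<sigma>) (Suc c)
    \<le> top_weight (Suc k) h \<sigma> c - of_bool (Suc c \<le> q) * (top_weight (Suc k) h \<sigma> c - top_weight (Suc k) h \<sigma> (Suc c) - real m)
      + (\<Sum>x\<leftarrow>v. of_bool (Suc c \<le> \<sigma> x))"
proof -
  let ?N = "Suc (Suc k)" and ?s = "insert_label (Suc (Suc k)) q \<sigma>"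
  have eq: "{1..?N} = insert ?N {1..Suc k}" by auto
  have c0: "count_list v ?N = 0" using v by (force simp: count_list_0_iff)
  have W': "top_weight ?N (h(?N := v)) ?s (Suc c) = real m * of_bool (Suc c \<le> q)
    + (\<Sum>w\<in>{1..Suc k}. (real (hdeg (Suc k) h w) + real (count_list v w)) * of_bool (Suc c \<le> ?s w))"
  proof -
    have "?s ?N = q" by (simp add: insert_label_def)
    then show ?thesis
      unfolding top_weight_def hdeg_upd eq
      by (subst sum.insert) (simp_all add: hdeg_new[OF h] c0 del: sum_mult_of_bool_eq sum_of_bool_mult_eq)
  qed
  show ?thesis
  proof (cases "Suc c \<le> q")
    case True
    have "(\<Sum>w\<in>{1..Suc k}. (real (hdeg (Suc k) h w) + real (count_list v w)) * of_bool (Suc c \<le> ?s w))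
      = (\<Sum>w\<in>{1..Suc k}. real (hdeg (Suc k) h w) * of_bool (Suc c \<le> \<sigma> w) + real (count_list v w) * of_bool (Suc c \<le> \<sigma> w))"
    proof (rule sum.cong)
      fix w assume "w \<in> {1..Suc k}"
      then have "Suc c \<le> ?s w \<longleftrightarrow> Suc c \<le> \<sigma> w" using True by (auto simp: insert_label_def)
      then show "(real (hdeg (Suc k) h w) + real (count_list v w)) * of_bool (Suc c \<le> ?s w)
        = real (hdeg (Suc k) h w) * of_bool (Suc c \<le> \<sigma> w) + real (count_list v w) * of_bool (Suc c \<le> \<sigma> w)"
        by (simp only: distrib_right)
    qed simp
    also have "\<dots> = top_weight (Suc k) h \<sigma> (Suc c) + (\<Sum>x\<leftarrow>v. of_bool (Suc c \<le> \<sigma> x))"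
      unfolding sum.distrib top_weight_def sum_count_list_mult[OF v(2) finite_atLeastAtMost] ..
    finally show ?thesis using True W' by simp
  next
    case False
    have "(\<Sum>w\<in>{1..Suc k}. (real (hdeg (Suc k) h w) + real (count_list v w)) * of_bool (Suc c \<le> ?s w))
      = top_weight (Suc k) h \<sigma> c"
      unfolding top_weight_def
    proof (rule sum.cong)
      fix w assume w: "w \<in> {1..Suc k}"
      have iff: "Suc c \<le> ?s w \<longleftrightarrow> c \<le> \<sigma> w" using False w by (auto simp: insert_label_def)
      have "count_list v w = 0" if "c \<le> \<sigma> w"
        using slots_props(4)[OF \<sigma> v q, of w] False that by (auto simp: count_list_0_iff)
      then show "(real (hdeg (Suc k) h w) + real (count_list v w)) * of_bool (Suc c \<le> ?s w)
        = real (hdeg (Suc k) h w) * of_bool (c \<le> \<sigma> w)"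
        unfolding iff by auto
    qed simp
    moreover have "0 \<le> (\<Sum>x\<leftarrow>v. of_bool (Suc c \<le> \<sigma> x) :: real)" by (rule sum_list_nonneg) auto
    ultimately show ?thesis using False W' by simp
  qed
qed

text \<open>The vertex at position c alone has degree at least m. So the vertex pushed out outweighs
  the newcomer, and landing among the last positions can only help before parents gain.\<close>

lemma top_weight_diff:
  assumes \<sigma>: "\<sigma> \<in> labellings n h" and c: "c \<in> {1..n}"
  shows "real m \<le> top_weight n h \<sigma> c - top_weight n h \<sigma> (Suc c)"
proof -
  have "c \<in> \<sigma> ` {1..n}" using \<sigma> c by (simp add: labellings_def bij_betw_def)
  then obtain x where x: "x \<in> {1..n}" "\<sigma> x = c" by blast
  have "real m \<le> real (hdeg n h x) * of_bool (\<sigma> x = c)" using x hdeg_ge[of n h x] by simp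
  also have "\<dots> \<le> (\<Sum>w\<in>{1..n}. real (hdeg n h w) * of_bool (\<sigma> w = c))"
    using x by (intro member_le_sum) auto
  also have "\<dots> = top_weight n h \<sigma> c - top_weight n h \<sigma> (Suc c)"
    unfolding top_weight_def sum_subtractf[symmetric] by (intro sum.cong) (auto simp: not_less_eq_eq)
  finally show ?thesis .
qed

text \<open>Parents only push the new vertex towards the end. With highest parent at s, the slots
  are s + 1, ..., n + 1: for s \<ge> c the event is certain, otherwise its probability is (n + 1 -
  c) / (n + 1 - s) with s \<ge> 1.\<close>

lemma slots_prob_ge:
  assumes \<sigma>: "\<sigma> \<in> labellings n h" and n: "1 \<le> n" and v: "v \<noteq> []" "set v \<subseteq> {1..n}" and c: "c \<in> {1..n}"
  shows "(real n + 1 - real c) / real n \<le> E (pmf_of_set (slots n \<sigma> v)) (\<lambda>q. of_bool (Suc c \<le> q))"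
proof -
  note sl = slots_props[OF \<sigma> v]
  obtain x where x: "x \<in> set v" "slots n \<sigma> v = {Suc (\<sigma> x)..Suc n}" using sl(5) by auto
  have r: "1 \<le> \<sigma> x" "\<sigma> x \<le> n" using labellings_range[OF \<sigma>, of x] x v by auto
  have E: "E (pmf_of_set (slots n \<sigma> v)) (\<lambda>q. of_bool (Suc c \<le> q))
    = (\<Sum>q\<in>slots n \<sigma> v. of_bool (Suc c \<le> q)) / real (card (slots n \<sigma> v))"
    using sl(1,2) by (intro integral_pmf_of_set) auto
  also have "(\<Sum>q\<in>slots n \<sigma> v. of_bool (Suc c \<le> q)) = real (card {max (Suc c) (Suc (\<sigma> x))..Suc n})"
  proof -
    have "slots n \<sigma> v \<inter> {q. Suc c \<le> q} = {max (Suc c) (Suc (\<sigma> x))..Suc n}" unfolding x(2) by auto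
    then show ?thesis using sl(1) by simp
  qed
  finally have E': "E (pmf_of_set (slots n \<sigma> v)) (\<lambda>q. of_bool (Suc c \<le> q))
    = (real n + 1 - max (real c) (real (\<sigma> x))) / (real n + 1 - real (\<sigma> x))"
    using r c unfolding x(2) by (simp add: of_nat_diff max_def algebra_simps)
  show ?thesis
  proof (cases "c \<le> \<sigma> x")
    case True
    then have "max (real c) (real (\<sigma> x)) = real (\<sigma> x)" by simp
    then show ?thesis unfolding E' using r c n by simp
  next
    case False
    then have "max (real c) (real (\<sigma> x)) = real c" by simp
    then show ?thesis unfolding E' using r c n by (simp add: frac_le)
  qed
qed

text \<open>Indexing by the number j of last positions, and not by the cutoff, keeps the index fixed
  while the graph grows.\<close>

definition mean_top_weight :: "nat \<Rightarrow> nat \<Rightarrow> real" where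
  "mean_top_weight k j = joint_E k (\<lambda>h \<sigma>. top_weight (Suc k) h \<sigma> (Suc (Suc k) - j))"

lemma mean_top_weight_Suc_le:
  assumes j: "1 \<le> j" "j \<le> Suc k"
  shows "mean_top_weight (Suc k) j \<le> (1 - real j / (real k + 1)) * mean_top_weight k j
    + (real j / (real k + 1) + 1 / (2 * real k + 1)) * mean_top_weight k (j - 1) + real j / (real k + 1) * real m"
proof -
  define c where "c = Suc (Suc k) - j"
  define t where "t = real j / (real k + 1)"
  have c: "c \<in> {1..Suc k}" "Suc (Suc (Suc k)) - j = Suc c" "Suc (Suc k) - (j - 1) = Suc c"
    using j by (auto simp: c_def)
  have t: "(real (Suc k) + 1 - real c) / real (Suc k) = t"
    using j by (simp add: c_def t_def of_nat_diff)
  have "mean_top_weight (Suc k) j \<le> joint_E k (\<lambda>h \<sigma>. (top_weight (Suc k) h \<sigma> c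
      - t * (top_weight (Suc k) h \<sigma> c - top_weight (Suc k) h \<sigma> (Suc c) - real m)) + top_weight (Suc k) h \<sigma> (Suc c) / (2 * real k + 1))"
    unfolding mean_top_weight_def joint_E_Suc c(2)
  proof (rule joint_E_mono)
    fix h \<sigma> assume h: "h \<in> histories (Suc k)" and \<sigma>: "\<sigma> \<in> set_pmf (insertion_pmf k h)"
    let ?W = "top_weight (Suc k) h \<sigma>"
    have l: "\<sigma> \<in> labellings (Suc k) h" using set_insertion_pmf[OF h] \<sigma> by auto
    have d: "0 \<le> ?W c - ?W (Suc c) - real m" using top_weight_diff[OF l c(1)] by simp
    have "E (replicate_pmf m (attachment k h)) (\<lambda>v. E (pmf_of_set (slots (Suc k) \<sigma> v))
        (\<lambda>q. top_weight (Suc (Suc k)) (h(Suc (Suc k) := v)) (insert_label (Suc (Suc k)) q \<sigma>) (Suc c)))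
      \<le> E (replicate_pmf m (attachment k h)) (\<lambda>v. (?W c - t * (?W c - ?W (Suc c) - real m)) + (\<Sum>x\<leftarrow>v. of_bool (Suc c \<le> \<sigma> x)))"
    proof (rule E_mono[OF finite_choice[OF h]])
      fix v assume v: "v \<in> set_pmf (replicate_pmf m (attachment k h))"
      note sl = insertion_pmf_slots[OF h \<sigma> v]
      let ?p = "pmf_of_set (slots (Suc k) \<sigma> v)"
      have fp: "finite (set_pmf ?p)" using sl by simp
      have "E ?p (\<lambda>q. top_weight (Suc (Suc k)) (h(Suc (Suc k) := v)) (insert_label (Suc (Suc k)) q \<sigma>) (Suc c))
        \<le> E ?p (\<lambda>q. (?W c + (\<Sum>x\<leftarrow>v. of_bool (Suc c \<le> \<sigma> x)))
             - of_bool (Suc c \<le> q) * (?W c - ?W (Suc c) - real m))"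
      proof (rule E_mono[OF fp])
        fix q assume "q \<in> set_pmf ?p"
        then have "q \<in> slots (Suc k) \<sigma> v" using sl by simp
        from top_weight_insert_le[OF h l sl(2,3) this, of c] c(1)
        show "top_weight (Suc (Suc k)) (h(Suc (Suc k) := v)) (insert_label (Suc (Suc k)) q \<sigma>) (Suc c)
          \<le> (?W c + (\<Sum>x\<leftarrow>v. of_bool (Suc c \<le> \<sigma> x))) - of_bool (Suc c \<le> q) * (?W c - ?W (Suc c) - real m)"
          by simp
      qed
      also have "\<dots> = (?W c + (\<Sum>x\<leftarrow>v. of_bool (Suc c \<le> \<sigma> x)))
          - E ?p (\<lambda>q. of_bool (Suc c \<le> q)) * (?W c - ?W (Suc c) - real m)"
        by (subst E_diff[OF fp]) simp
      \<comment> \<open>The probability may be replaced by its lower bound t because its coefficient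
        is nonnegative by \<open>d\<close>.\<close>
      also have "\<dots> \<le> (?W c + (\<Sum>x\<leftarrow>v. of_bool (Suc c \<le> \<sigma> x))) - t * (?W c - ?W (Suc c) - real m)"
        using slots_prob_ge[OF l _ sl(2,3) c(1)] t d by (intro diff_left_mono mult_right_mono) auto
      finally show "E ?p (\<lambda>q. top_weight (Suc (Suc k)) (h(Suc (Suc k) := v)) (insert_label (Suc (Suc k)) q \<sigma>) (Suc c))
        \<le> (?W c - t * (?W c - ?W (Suc c) - real m)) + (\<Sum>x\<leftarrow>v. of_bool (Suc c \<le> \<sigma> x))" by simp
    qed
    also have "\<dots> = (?W c - t * (?W c - ?W (Suc c) - real m)) + ?W (Suc c) / (2 * real k + 1)"
      by (subst E_add[OF finite_choice[OF h]]) (simp only: E_const E_choice_sum_list[OF h] top_weight_def)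
    finally show "E (replicate_pmf m (attachment k h)) (\<lambda>v. E (pmf_of_set (slots (Suc k) \<sigma> v))
        (\<lambda>q. top_weight (Suc (Suc k)) (h(Suc (Suc k) := v)) (insert_label (Suc (Suc k)) q \<sigma>) (Suc c)))
      \<le> (?W c - t * (?W c - ?W (Suc c) - real m)) + ?W (Suc c) / (2 * real k + 1)" .
  qed
  also have "\<dots> = joint_E k (\<lambda>h \<sigma>. (1 - t) * top_weight (Suc k) h \<sigma> c
      + ((t + 1 / (2 * real k + 1)) * top_weight (Suc k) h \<sigma> (Suc c) + t * real m))"
    by (intro joint_E_cong) (simp add: algebra_simps)
  also have "\<dots> = (1 - t) * mean_top_weight k j + ((t + 1 / (2 * real k + 1)) * mean_top_weight k (j - 1) + t * real m)"
    unfolding joint_E_add joint_E_cmult joint_E_const mean_top_weight_def c(3) c_def ..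
  finally show ?thesis by (simp add: t_def)
qed

lemma mean_top_weight_0: "mean_top_weight k 0 = 0"
proof -
  have "mean_top_weight k 0 = joint_E k (\<lambda>h \<sigma>. 0)"
    unfolding mean_top_weight_def
  proof (rule joint_E_cong)
    fix h \<sigma> assume "h \<in> histories (Suc k)" "\<sigma> \<in> set_pmf (insertion_pmf k h)"
    then have l: "\<sigma> \<in> labellings (Suc k) h" using set_insertion_pmf by auto
    show "top_weight (Suc k) h \<sigma> (Suc (Suc k) - 0) = 0"
      unfolding top_weight_def
    proof (intro sum.neutral ballI)
      fix w assume "w \<in> {1..Suc k}"
      from labellings_range[OF l this]
      show "real (hdeg (Suc k) h w) * of_bool (Suc (Suc k) - 0 \<le> \<sigma> w) = 0" by simp
    qed
  qed
  then show ?thesis by simp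
qed

lemma mean_top_weight_full: "mean_top_weight k (Suc k) = real m * (2 * real k + 1)"
proof -
  have "mean_top_weight k (Suc k) = joint_E k (\<lambda>h \<sigma>. real m * (2 * real k + 1))"
    unfolding mean_top_weight_def
  proof (rule joint_E_cong)
    fix h \<sigma> assume h: "h \<in> histories (Suc k)" "\<sigma> \<in> set_pmf (insertion_pmf k h)"
    then have l: "\<sigma> \<in> labellings (Suc k) h" using set_insertion_pmf by auto
    have "top_weight (Suc k) h \<sigma> (Suc (Suc k) - Suc k) = potential real (Suc k) h"
      unfolding top_weight_def potential_def
    proof (intro sum.cong refl)
      fix w assume "w \<in> {1..Suc k}"
      from labellings_range[OF l this]
      show "real (hdeg (Suc k) h w) * of_bool (Suc (Suc k) - Suc k \<le> \<sigma> w) = real (hdeg (Suc k) h w)" by simp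
    qed
    then show "top_weight (Suc k) h \<sigma> (Suc (Suc k) - Suc k) = real m * (2 * real k + 1)"
      by (simp add: potential_real[OF h(1)])
  qed
  then show ?thesis by simp
qed

text \<open>The last j positions hold about their proportional share of the total degree. The cases
  j = 0 and j = n are exact. In between, inserting the bound into the recursion leaves the excess m
  (2 (j - 1) / (2 k + 1) - j / (k + 1)), which is at most 0 for j \<le> 2 k + 2.\<close>

lemma mean_top_weight_le: "j \<le> Suc k \<Longrightarrow> mean_top_weight k j \<le> 2 * real m * real j"
proof (induction k arbitrary: j)
  case 0
  then consider "j = 0" | "j = Suc 0" by linarith
  then show ?case using mean_top_weight_0 mean_top_weight_full[of 0] by cases auto
next
  case (Suc k)
  show ?case
  proof (cases "j = 0 \<or> j = Suc (Suc k)")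
    case True
    then show ?thesis using mean_top_weight_0 mean_top_weight_full[of "Suc k"] by (auto simp: algebra_simps)
  next
    case False
    then have j: "1 \<le> j" "j \<le> Suc k" using Suc.prems by auto
    define t where "t = real j / (real k + 1)"
    have t: "0 \<le> t" "t \<le> 1" using j by (auto simp: t_def)
    have "mean_top_weight (Suc k) j \<le> (1 - t) * mean_top_weight k j + (t + 1 / (2 * real k + 1)) * mean_top_weight k (j - 1) + t * real m"
      unfolding t_def by (rule mean_top_weight_Suc_le[OF j])
    also have "\<dots> \<le> (1 - t) * (2 * real m * real j) + (t + 1 / (2 * real k + 1)) * (2 * real m * (real j - 1)) + t * real m"
      using Suc.IH[of j] Suc.IH[of "j - 1"] j t
      by (intro add_mono mult_left_mono) (auto simp: of_nat_diff)
    also have "\<dots> = 2 * real m * real j + real m * (2 * (real j - 1) / (2 * real k + 1) - t)"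
      by (simp add: field_simps)
    also have "2 * (real j - 1) / (2 * real k + 1) \<le> t"
    proof -
      have "2 * (real j - 1) * (real k + 1) \<le> real j * (2 * real k + 1)"
        using j by (simp add: algebra_simps)
      then show ?thesis by (simp add: t_def divide_simps mult_ac)
    qed
    then have "real m * (2 * (real j - 1) / (2 * real k + 1) - t) \<le> 0"
      by (intro mult_nonneg_nonpos) auto
    finally show ?thesis by simp
  qed
qed

text \<open>The logarithm is split into increments ln ((i + 1) / i), each switched on when s is
  among the last i positions. Summation by parts then expresses a degree-weighted sum of such
  logarithms through \<open>top_weight\<close>.\<close>

lemma ln_ratio_telescope:
  assumes "1 \<le> s" "s \<le> n"
  shows "ln (real n / real (Suc n - s)) = (\<Sum>i\<in>{1..<n}. of_bool (Suc n - i \<le> s) * ln (real (Suc i) / real i))"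
proof -
  let ?l = "Suc n - s"
  have l: "1 \<le> ?l" "?l \<le> n" using assms by auto
  have "(\<Sum>i\<in>{1..<n}. of_bool (Suc n - i \<le> s) * ln (real (Suc i) / real i)) = (\<Sum>i\<in>{?l..<n}. ln (real (Suc i) / real i))"
    using assms by (intro sum.mono_neutral_cong_right) auto
  also have "\<dots> = (\<Sum>i\<in>{?l..<n}. ln (real (Suc i)) - ln (real i))"
    using l by (intro sum.cong) (auto simp: ln_div)
  also have "\<dots> = ln (real n) - ln (real ?l)" by (rule sum_Suc_diff'[OF l(2)])
  also have "\<dots> = ln (real n / real ?l)" using l by (simp add: ln_div)
  finally show ?thesis by simp
qed

text \<open>With x the last parent in the order there are n + 1 - \<sigma> x slots, so the loss
  against ln n is ln (n / (n + 1 - \<sigma> x)). It is bounded by the sum of this quantity over all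
  parents, whose mean is a degree-weighted sum divided by 2 k + 1. After summation by parts, ln (1 +
  1/i) \<le> 1/i and the bound 2 m i on the top weight make every term at most 2 m, and 2 m k / (2 k
  + 1) \<le> m.\<close>

lemma joint_E_ln_slots_ge:
  "ln (real (Suc k)) - real m
    \<le> joint_E k (\<lambda>h \<sigma>. E (replicate_pmf m (attachment k h)) (\<lambda>v. ln (real (card (slots (Suc k) \<sigma> v)))))"
proof -
  let ?n = "Suc k"
  have "joint_E k (\<lambda>h \<sigma>. ln (real ?n) + (- 1 / (2 * real k + 1)) *
      (\<Sum>i\<in>{1..<?n}. ln (real (Suc i) / real i) * top_weight ?n h \<sigma> (Suc ?n - i)))
    \<le> joint_E k (\<lambda>h \<sigma>. E (replicate_pmf m (attachment k h)) (\<lambda>v. ln (real (card (slots ?n \<sigma> v)))))"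
  proof (rule joint_E_mono)
    fix h \<sigma> assume h: "h \<in> histories ?n" and \<sigma>: "\<sigma> \<in> set_pmf (insertion_pmf k h)"
    have l: "\<sigma> \<in> labellings ?n h" using set_insertion_pmf[OF h] \<sigma> by auto
    let ?g = "\<lambda>x. ln (real ?n / real (Suc ?n - \<sigma> x))"
    have g: "0 \<le> ?g x" if "x \<in> {1..?n}" for x
      using labellings_range[OF l that] by (intro ln_ge_zero) (simp add: le_divide_eq)
    have "E (replicate_pmf m (attachment k h)) (\<lambda>v. ln (real ?n) - (\<Sum>x\<leftarrow>v. ?g x))
      \<le> E (replicate_pmf m (attachment k h)) (\<lambda>v. ln (real (card (slots ?n \<sigma> v))))"
    proof (rule E_mono[OF finite_choice[OF h]])
      fix v assume v: "v \<in> set_pmf (replicate_pmf m (attachment k h))"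
      note sl = insertion_pmf_slots[OF h \<sigma> v]
      obtain x where x: "x \<in> set v" "slots ?n \<sigma> v = {Suc (\<sigma> x)..Suc ?n}"
        using slots_props(5)[OF l sl(2,3)] by auto
      have "\<sigma> x \<in> {1..?n}" using labellings_range[OF l] x(1) sl(3) by auto
      then have "ln (real (card (slots ?n \<sigma> v))) = ln (real ?n) - ?g x"
        unfolding x(2) by (simp add: ln_div)
      moreover have "?g x \<le> (\<Sum>x\<leftarrow>v. ?g x)"
        using x(1) sl(3) g by (intro member_le_sum_list) auto
      ultimately show "ln (real ?n) - (\<Sum>x\<leftarrow>v. ?g x) \<le> ln (real (card (slots ?n \<sigma> v)))" by simp
    qed
    also have "E (replicate_pmf m (attachment k h)) (\<lambda>v. ln (real ?n) - (\<Sum>x\<leftarrow>v. ?g x))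
      = ln (real ?n) - (\<Sum>w\<in>{1..?n}. real (hdeg ?n h w) * ?g w) / (2 * real k + 1)"
      by (subst E_diff[OF finite_choice[OF h]]) (simp only: E_const E_choice_sum_list[OF h])
    also have "(\<Sum>w\<in>{1..?n}. real (hdeg ?n h w) * ?g w)
      = (\<Sum>w\<in>{1..?n}. \<Sum>i\<in>{1..<?n}. ln (real (Suc i) / real i) * (real (hdeg ?n h w) * of_bool (Suc ?n - i \<le> \<sigma> w)))"
    proof (rule sum.cong)
      fix w assume "w \<in> {1..?n}"
      then have "\<sigma> w \<in> {1..?n}" using labellings_range[OF l] by auto
      then show "real (hdeg ?n h w) * ?g w
        = (\<Sum>i\<in>{1..<?n}. ln (real (Suc i) / real i) * (real (hdeg ?n h w) * of_bool (Suc ?n - i \<le> \<sigma> w)))"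
        by (subst ln_ratio_telescope, simp, simp) (simp only: sum_distrib_left mult_ac)
    qed simp
    also have "\<dots> = (\<Sum>i\<in>{1..<?n}. ln (real (Suc i) / real i) * top_weight ?n h \<sigma> (Suc ?n - i))"
      unfolding top_weight_def sum_distrib_left by (rule sum.swap)
    finally show "ln (real ?n) + (- 1 / (2 * real k + 1)) *
        (\<Sum>i\<in>{1..<?n}. ln (real (Suc i) / real i) * top_weight ?n h \<sigma> (Suc ?n - i))
      \<le> E (replicate_pmf m (attachment k h)) (\<lambda>v. ln (real (card (slots ?n \<sigma> v))))" by simp
  qed
  moreover have "joint_E k (\<lambda>h \<sigma>. ln (real ?n) + (- 1 / (2 * real k + 1)) *
      (\<Sum>i\<in>{1..<?n}. ln (real (Suc i) / real i) * top_weight ?n h \<sigma> (Suc ?n - i)))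
    = ln (real ?n) + (- 1 / (2 * real k + 1)) * (\<Sum>i\<in>{1..<?n}. ln (real (Suc i) / real i) * mean_top_weight k i)"
    unfolding joint_E_add joint_E_cmult joint_E_const mean_top_weight_def by (subst joint_E_sum) (simp_all only: joint_E_cmult finite_atLeastLessThan)
  moreover have "(\<Sum>i\<in>{1..<?n}. ln (real (Suc i) / real i) * mean_top_weight k i) \<le> (\<Sum>i\<in>{1..<?n}. 2 * real m)"
  proof (rule sum_mono)
    fix i assume i: "i \<in> {1..<?n}"
    have "ln (1 + 1 / real i) \<le> 1 / real i" using i by (intro ln_add_one_self_le_self) auto
    moreover have "1 + 1 / real i = real (Suc i) / real i" using i by (simp add: field_simps)
    ultimately have "ln (real (Suc i) / real i) \<le> 1 / real i" by simp
    moreover have "0 \<le> ln (real (Suc i) / real i)" using i by (intro ln_ge_zero) (simp add: le_divide_eq)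
    ultimately have "ln (real (Suc i) / real i) * mean_top_weight k i \<le> (1 / real i) * (2 * real m * real i)"
      using mean_top_weight_le[of i k] i
      by (intro order_trans[OF mult_left_mono[of "mean_top_weight k i" "2 * real m * real i"] mult_right_mono]) auto
    then show "ln (real (Suc i) / real i) * mean_top_weight k i \<le> 2 * real m" using i by simp
  qed
  moreover have "(\<Sum>i\<in>{1..<?n}. 2 * real m) / (2 * real k + 1) \<le> real m"
    by (simp add: divide_le_eq algebra_simps)
  ultimately show ?thesis
    using divide_right_mono[of "\<Sum>i\<in>{1..<?n}. ln (real (Suc i) / real i) * mean_top_weight k i" "\<Sum>i\<in>{1..<?n}. 2 * real m" "2 * real k + 1"]
    by simp
qed

lemma E_entropy_pmf_insertion_pmf_ge: "(\<Sum>j<k. ln (real (Suc j)) - real m) \<le> E (hist k) (\<lambda>h. entropy_pmf (insertion_pmf k h))"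
proof (induction k)
  case 0
  then show ?case by (simp add: entropy_pmf_def)
next
  case (Suc k)
  have "E (hist (Suc k)) (\<lambda>h. entropy_pmf (insertion_pmf (Suc k) h))
    = E (hist k) (\<lambda>h. E (replicate_pmf m (attachment k h)) (\<lambda>v.
        entropy_pmf (insertion_pmf k h) + E (insertion_pmf k h) (\<lambda>\<sigma>. ln (real (card (slots (Suc k) \<sigma> v))))))"
    unfolding E_hist_Suc insertion_pmf_upd
  proof (intro E_cong)
    fix h v assume "h \<in> set_pmf (hist k)" and v: "v \<in> set_pmf (replicate_pmf m (attachment k h))"
    then have h: "h \<in> histories (Suc k)" by (simp add: set_hist)
    show "entropy_pmf (insertion_pmf k h \<bind> (\<lambda>\<sigma>. map_pmf (\<lambda>q. insert_label (Suc (Suc k)) q \<sigma>) (pmf_of_set (slots (Suc k) \<sigma> v))))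
      = entropy_pmf (insertion_pmf k h) + E (insertion_pmf k h) (\<lambda>\<sigma>. ln (real (card (slots (Suc k) \<sigma> v))))"
    proof (rule entropy_pmf_bind_uniform[OF finite_insertion_pmf[OF h]])
      fix \<sigma> assume "\<sigma> \<in> set_pmf (insertion_pmf k h)"
      from insertion_pmf_slots[OF h this v]
      show "finite (slots (Suc k) \<sigma> v) \<and> slots (Suc k) \<sigma> v \<noteq> {}" by simp
    next
      fix \<sigma> \<tau> q r assume *: "\<sigma> \<in> set_pmf (insertion_pmf k h)" "\<tau> \<in> set_pmf (insertion_pmf k h)"
        and eq: "insert_label (Suc (Suc k)) q \<sigma> = insert_label (Suc (Suc k)) r \<tau>"
      have qr: "q = r" using fun_cong[OF eq, of "Suc (Suc k)"] by (simp add: insert_label_def)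
      have "\<sigma> u = \<tau> u" for u
      proof (cases "u = Suc (Suc k)")
        \<comment> \<open>Insertion overwrites the label at the new vertex, so the result says
          nothing about this value; both old labellings vanish there.\<close>
        case True
        then show ?thesis using insertion_pmf_slots(1)[OF h *(1) v] insertion_pmf_slots(1)[OF h *(2) v] by (simp add: labellings_def)
      next
        case False
        then show ?thesis using fun_cong[OF eq, of u] qr by (auto simp: insert_label_def split: if_splits)
      qed
      then show "\<sigma> = \<tau> \<and> q = r" using qr by auto
    qed
  qed
  also have "\<dots> = E (hist k) (\<lambda>h. entropy_pmf (insertion_pmf k h) + E (insertion_pmf k h) (\<lambda>\<sigma>. E (replicate_pmf m (attachment k h))
        (\<lambda>v. ln (real (card (slots (Suc k) \<sigma> v))))))"
  proof (rule E_cong)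
    fix h assume "h \<in> set_pmf (hist k)"
    then have h: "h \<in> histories (Suc k)" by (simp add: set_hist)
    show "E (replicate_pmf m (attachment k h)) (\<lambda>v.
        entropy_pmf (insertion_pmf k h) + E (insertion_pmf k h) (\<lambda>\<sigma>. ln (real (card (slots (Suc k) \<sigma> v)))))
      = entropy_pmf (insertion_pmf k h) + E (insertion_pmf k h) (\<lambda>\<sigma>. E (replicate_pmf m (attachment k h))
        (\<lambda>v. ln (real (card (slots (Suc k) \<sigma> v)))))"
      unfolding E_add[OF finite_choice[OF h]] E_const
      by (intro arg_cong2[where f = "(+)"] refl E_swap finite_choice finite_insertion_pmf h)
  qed
  also have "\<dots> = E (hist k) (\<lambda>h. entropy_pmf (insertion_pmf k h)) + joint_E k (\<lambda>h \<sigma>. E (replicate_pmf m (attachment k h))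
        (\<lambda>v. ln (real (card (slots (Suc k) \<sigma> v)))))"
    unfolding joint_E_def by (rule E_add[OF finite_hist])
  finally show ?case using Suc joint_E_ln_slots_ge[of k] by simp
qed

end

section \<open>Relabelling histories\<close>

lemma count_image_mset_inj_on:
  assumes "inj_on f A" "set_mset M \<subseteq> A" "x \<in> A"
  shows "count (image_mset f M) (f x) = count M x"
  using assms(2)
proof (induction M)
  case (add y M)
  then have "f x = f y \<longleftrightarrow> x = y" using assms(1,3) by (auto simp: inj_on_eq_iff)
  then show ?case using add by auto
qed simp

lemma image_mset_inj_onD:
  assumes "inj_on f A" "set_mset M \<subseteq> A" "set_mset N \<subseteq> A" "image_mset f M = image_mset f N"
  shows "M = N"
proof (rule multiset_eqI)
  fix x
  show "count M x = count N x"
  proof (cases "x \<in> A")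
    case True
    then show ?thesis
      using count_image_mset_inj_on[OF assms(1,2) True] count_image_mset_inj_on[OF assms(1,3) True] assms(4) by simp
  next
    case False
    then have "x \<notin># M" "x \<notin># N" using assms(2,3) by auto
    then show ?thesis by (simp add: not_in_iff)
  qed
qed

lemma inj_on_map_uprod:
  assumes "inj_on f A"
  shows "inj_on (map_uprod f) {e. set_uprod e \<subseteq> A}"
proof (rule inj_onI)
  fix e e' assume e: "e \<in> {e. set_uprod e \<subseteq> A}" "e' \<in> {e. set_uprod e \<subseteq> A}" "map_uprod f e = map_uprod f e'"
  obtain a b c d where "e = Upair a b" "e' = Upair c d" by (metis uprod_exhaust)
  then show "e = e'" using e assms by (auto simp: inj_on_eq_iff)
qed

lemma card_permutations_of_mset_distinct:
  assumes "distinct xs"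
  shows "card (permutations_of_multiset (mset xs)) = fact (length xs)"
proof -
  have "permutations_of_multiset (mset xs) = permutations_of_set (set xs)"
    using mset_set_set[OF assms] by (simp add: permutations_of_set_altdef)
  then show ?thesis using assms by (simp add: distinct_card)
qed

lemma labellings_bij:
  assumes "\<sigma> \<in> labellings n h"
  shows "bij_betw \<sigma> {2..n} {2..n}"
proof (cases "n = 0")
  case False
  have b: "bij_betw \<sigma> {1..n} {1..n}" and 1: "\<sigma> 1 = 1" using assms by (auto simp: labellings_def)
  have eq: "{2..n} = {1..n} - {1}" by auto
  have "bij_betw \<sigma> ({1..n} - {1}) ({1..n} - {\<sigma> 1})"
    using b False by (intro bij_betw_DiffI) (auto simp: bij_betw_def 1)
  then show ?thesis unfolding eq 1 .
qed (simp add: bij_betw_def)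

declare prod.cl_ivl_Suc [simp del]

context pref_attach
begin

lemma histories_set: "h \<in> histories n \<Longrightarrow> v \<in> {2..n} \<Longrightarrow> set (h v) \<subseteq> {1..n}"
  by (force simp: histories_def)

text \<open>Only the multisets of choices are prescribed, so all orders of the choices of each
  vertex are included.\<close>

definition relabelled :: "nat \<Rightarrow> (nat \<Rightarrow> nat list) \<Rightarrow> (nat \<Rightarrow> nat) \<Rightarrow> (nat \<Rightarrow> nat list) set" where
  "relabelled n h \<sigma> = {g \<in> histories n. \<forall>v\<in>{2..n}. mset (g (\<sigma> v)) = image_mset \<sigma> (mset (h v))}"

lemma edges_subset:
  assumes "h \<in> histories n" "n \<ge> 1" "e \<in># edges (graph_of n h)"
  shows "set_uprod e \<subseteq> {1..n}"
proof -
  have "e = Upair 1 1 \<or> (\<exists>v\<in>{2..n}. e \<in># mset (map (Upair v) (h v)))"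
    using assms(3) by (auto simp: graph_of_def set_mset_sum split: if_splits)
  then show ?thesis
  proof
    assume "\<exists>v\<in>{2..n}. e \<in># mset (map (Upair v) (h v))"
    then obtain v w where "v \<in> {2..n}" "w \<in> set (h v)" "e = Upair v w" by auto
    then show ?thesis using histories_set[OF assms(1), of v] by auto
  qed (use assms(2) in auto)
qed

lemma edges_relabelled:
  assumes "\<sigma> \<in> labellings n h" "g \<in> relabelled n h \<sigma>"
  shows "edges (graph_of n g) = image_mset (map_uprod \<sigma>) (edges (graph_of n h))"
proof -
  have 1: "\<sigma> 1 = 1" using assms(1) by (simp add: labellings_def)
  have "(\<Sum>v\<in>{2..n}. mset (map (Upair v) (g v))) = (\<Sum>v\<in>{2..n}. mset (map (Upair (\<sigma> v)) (g (\<sigma> v))))"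
    by (rule sum.reindex_bij_betw[OF labellings_bij[OF assms(1)], symmetric])
  also have "\<dots> = (\<Sum>v\<in>{2..n}. image_mset (map_uprod \<sigma>) (mset (map (Upair v) (h v))))"
  proof (rule sum.cong)
    fix v assume "v \<in> {2..n}"
    then have "mset (g (\<sigma> v)) = image_mset \<sigma> (mset (h v))" using assms(2) by (simp add: relabelled_def)
    then show "mset (map (Upair (\<sigma> v)) (g (\<sigma> v))) = image_mset (map_uprod \<sigma>) (mset (map (Upair v) (h v)))"
      by (simp add: multiset.map_comp o_def)
  qed simp
  also have "\<dots> = image_mset (map_uprod \<sigma>) (\<Sum>v\<in>{2..n}. mset (map (Upair v) (h v)))"
  proof -
    have *: "(\<Sum>v\<in>A. image_mset (map_uprod \<sigma>) (f v)) = image_mset (map_uprod \<sigma>) (\<Sum>v\<in>A. f v)"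
      if "finite A" for A and f :: "nat \<Rightarrow> nat uprod multiset"
      using that by (induction A rule: finite_induct) auto
    show ?thesis by (rule *) simp
  qed
  finally show ?thesis by (simp add: graph_of_def 1 del: One_nat_def)
qed

lemma isomorphic_relabelled:
  assumes h: "h \<in> histories n" and n: "n \<ge> 1" and \<sigma>: "\<sigma> \<in> labellings n h" and g: "g \<in> relabelled n h \<sigma>"
  shows "isomorphic (graph_of n h) (graph_of n g)"
proof -
  have b: "bij_betw \<sigma> {1..n} {1..n}" using \<sigma> by (simp add: labellings_def)
  then have inj: "inj_on (map_uprod \<sigma>) {e. set_uprod e \<subseteq> {1..n}}"
    by (intro inj_on_map_uprod) (simp add: bij_betw_def)
  have "edge_mult (graph_of n g) (\<sigma> u) (\<sigma> v) = edge_mult (graph_of n h) u v"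
    if "u \<in> {1..n}" "v \<in> {1..n}" for u v
  proof -
    have "count (image_mset (map_uprod \<sigma>) (edges (graph_of n h))) (map_uprod \<sigma> (Upair u v))
      = count (edges (graph_of n h)) (Upair u v)"
      using edges_subset[OF h n] that by (intro count_image_mset_inj_on[OF inj]) auto
    then show ?thesis by (simp add: edge_mult_def edges_relabelled[OF \<sigma> g])
  qed
  then show ?thesis using b unfolding isomorphic_def verts_def order_graph_of by blast
qed

text \<open>A labelling puts parents before children, so every way of ordering the transported
  choices is again a history. The set is therefore a full product and can be counted factor by
  factor.\<close>

lemma relabelled_eq:
  assumes h: "h \<in> histories n" and \<sigma>: "\<sigma> \<in> labellings n h"
  shows "relabelled n h \<sigma> = PiE_dflt {2..n} []
    (\<lambda>u. permutations_of_multiset (image_mset \<sigma> (mset (h (inv_into {2..n} \<sigma> u)))))"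
proof -
  let ?i = "inv_into {2..n} \<sigma>"
  note b = labellings_bij[OF \<sigma>]
  have i1: "?i u \<in> {2..n}" "\<sigma> (?i u) = u" if "u \<in> {2..n}" for u
    by (rule bij_betw_apply[OF bij_betw_inv_into[OF b] that], rule bij_betw_inv_into_right[OF b that])
  have i2: "?i (\<sigma> v) = v" "\<sigma> v \<in> {2..n}" if "v \<in> {2..n}" for v
    by (rule bij_betw_inv_into_left[OF b that], rule bij_betw_apply[OF b that])
  show ?thesis
  proof (intro equalityI subsetI)
    fix g assume g: "g \<in> relabelled n h \<sigma>"
    have "mset (g u) = image_mset \<sigma> (mset (h (?i u)))" if "u \<in> {2..n}" for u
      using g i1[OF that] unfolding relabelled_def by fastforce
    then show "g \<in> PiE_dflt {2..n} [] (\<lambda>u. permutations_of_multiset (image_mset \<sigma> (mset (h (?i u)))))"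
      using g by (auto simp: PiE_dflt_def permutations_of_multiset_def relabelled_def histories_def)
  next
    fix g assume g: "g \<in> PiE_dflt {2..n} [] (\<lambda>u. permutations_of_multiset (image_mset \<sigma> (mset (h (?i u)))))"
    have ms: "mset (g u) = image_mset \<sigma> (mset (h (?i u)))" if "u \<in> {2..n}" for u
      using g that by (simp add: PiE_dflt_def permutations_of_multiset_def)
    have "length (g u) = m \<and> set (g u) \<subseteq> {1..<u}" if u: "u \<in> {2..n}" for u
    proof -
      note v = i1[OF u]
      have "length (g u) = length (h (?i u))"
        using arg_cong[OF ms[OF u], of size] by simp
      moreover have "set (g u) = \<sigma> ` set (h (?i u))"
        using arg_cong[OF ms[OF u], of set_mset] by simp
      moreover have "\<sigma> w \<in> {1..<u}" if w: "w \<in> set (h (?i u))" for w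
      proof -
        have "\<sigma> w < \<sigma> (?i u)" using \<sigma> v(1) w unfolding labellings_def by blast
        moreover have "\<sigma> w \<in> {1..n}" using labellings_range[OF \<sigma>] histories_set[OF h v(1)] w by auto
        ultimately show ?thesis using v by simp
      qed
      ultimately show ?thesis using h v(1) by (auto simp: histories_def)
    qed
    moreover have "g u = []" if "u \<notin> {2..n}" for u using g that by (simp add: PiE_dflt_def)
    ultimately have "g \<in> histories n" unfolding histories_def by blast
    moreover have "mset (g (\<sigma> v)) = image_mset \<sigma> (mset (h v))" if "v \<in> {2..n}" for v
      using ms[of "\<sigma> v"] i2[OF that] by simp
    ultimately show "g \<in> relabelled n h \<sigma>" by (simp add: relabelled_def)
  qed
qed

lemma card_relabelled_ge:
  assumes h: "h \<in> histories n" and \<sigma>: "\<sigma> \<in> labellings n h"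
  shows "fact m ^ card {v\<in>{2..n}. distinct (h v)} \<le> card (relabelled n h \<sigma>)"
proof -
  let ?P = "\<lambda>v. permutations_of_multiset (image_mset \<sigma> (mset (h v)))"
  note b = labellings_bij[OF \<sigma>]
  have inj: "inj_on \<sigma> {1..n}" using \<sigma> by (simp add: labellings_def bij_betw_def)
  have "fact m ^ card {v\<in>{2..n}. distinct (h v)} = (\<Prod>v\<in>{2..n}. if distinct (h v) then fact m else 1 :: nat)"
    by (simp add: prod.If_cases Int_def)
  also have "\<dots> \<le> (\<Prod>v\<in>{2..n}. card (?P v))"
  proof (rule prod_mono)
    fix v assume v: "v \<in> {2..n}"
    have "card (?P v) = fact m" if "distinct (h v)"
    proof -
      have "inj_on \<sigma> (set (h v))" using histories_set[OF h v] inj by (rule inj_on_subset[rotated])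
      then have "distinct (map \<sigma> (h v))" using that by (simp add: distinct_map)
      from card_permutations_of_mset_distinct[OF this] show ?thesis using h v by (simp add: histories_def)
    qed
    moreover have "card (?P v) \<ge> 1" by (simp add: Suc_le_eq card_gt_0_iff)
    ultimately show "0 \<le> (if distinct (h v) then fact m else 1 :: nat) \<and>
      (if distinct (h v) then fact m else 1) \<le> card (?P v)" by simp
  qed
  also have "\<dots> = (\<Prod>v\<in>{2..n}. card (?P (inv_into {2..n} \<sigma> (\<sigma> v))))"
    using b by (intro prod.cong) (auto simp: bij_betw_inv_into_left)
  also have "\<dots> = (\<Prod>u\<in>{2..n}. card (?P (inv_into {2..n} \<sigma> u)))"
    by (rule prod.reindex_bij_betw[OF b])
  also have "\<dots> = card (relabelled n h \<sigma>)"
    unfolding relabelled_eq[OF h \<sigma>] by (rule card_PiE_dflt[symmetric]) auto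
  finally show ?thesis .
qed

section \<open>How many labellings lead to the same history\<close>

definition twins :: "nat \<Rightarrow> (nat \<Rightarrow> nat list) \<Rightarrow> nat \<Rightarrow> nat set" where
  "twins n h v = {u\<in>{2..n}. mset (h u) = mset (h v)}"

text \<open>A relabelling is determined step by step along the vertices in order of arrival: once the images
  of the parents of \<open>v\<close> are known, the image of \<open>v\<close> lies in a twin class of known size.\<close>

lemma card_labellings_relabelled_le:
  assumes h: "h \<in> histories n" and n: "n \<ge> 1"
  shows "card {\<sigma>\<in>labellings n h. g \<in> relabelled n h \<sigma>} \<le> (\<Prod>v\<in>{2..n}. card (twins n h v))"
proof -
  define S where "S = {\<sigma>\<in>labellings n h. g \<in> relabelled n h \<sigma>}"
  define restr where "restr j \<sigma> = (\<lambda>v. if v \<le> j then \<sigma> v else 0)" for j and \<sigma> :: "nat \<Rightarrow> nat"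
  have finS: "finite S" unfolding S_def using finite_labellings by simp
  have "Suc 0 \<le> j \<Longrightarrow> j \<le> n \<Longrightarrow> card (restr j ` S) \<le> (\<Prod>v\<in>{2..j}. card (twins n h v))" for j
  proof (induction j rule: dec_induct)
    case base
    have "restr (Suc 0) \<sigma> = (\<lambda>v. if v = 1 then 1 else 0)" if "\<sigma> \<in> S" for \<sigma>
      using that by (auto simp: restr_def S_def labellings_def fun_eq_iff le_Suc_eq)
    then have "restr (Suc 0) ` S \<subseteq> {\<lambda>v. if v = 1 then 1 else 0}" by auto
    from card_mono[OF _ this] show ?case by simp
  next
    case (step j)
    let ?v = "Suc j"
    have v: "?v \<in> {2..n}" using step by auto
    define X where "X \<rho> = {x\<in>{2..n}. mset (g x) = image_mset \<rho> (mset (h ?v))}" for \<rho>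
    have par: "set (h ?v) \<subseteq> {..j}" using h v by (force simp: histories_def)
    have img: "image_mset (restr j \<sigma>) (mset (h ?v)) = image_mset \<sigma> (mset (h ?v))" for \<sigma>
      using par by (intro image_mset_cong) (auto simp: restr_def)
    have sub: "restr ?v ` S \<subseteq> (\<Union>\<rho>\<in>restr j ` S. (\<lambda>x. \<rho>(?v := x)) ` X \<rho>)"
    proof
      fix \<rho>' assume "\<rho>' \<in> restr ?v ` S"
      then obtain \<sigma> where \<sigma>: "\<sigma> \<in> S" "\<rho>' = restr ?v \<sigma>" by auto
      have "\<rho>' = (restr j \<sigma>)(?v := \<sigma> ?v)" by (auto simp: \<sigma>(2) restr_def fun_eq_iff)
      moreover have "\<sigma> ?v \<in> X (restr j \<sigma>)"
        using \<sigma>(1) v bij_betwE[OF labellings_bij, of \<sigma> n h] by (auto simp: X_def img S_def relabelled_def)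
      ultimately show "\<rho>' \<in> (\<Union>\<rho>\<in>restr j ` S. (\<lambda>x. \<rho>(?v := x)) ` X \<rho>)" using \<sigma>(1) by blast
    qed
    have cX: "card ((\<lambda>x. \<rho>(?v := x)) ` X \<rho>) \<le> card (twins n h ?v)" if rho: "\<rho> \<in> restr j ` S" for \<rho>
    proof -
      obtain \<sigma> where \<sigma>: "\<sigma> \<in> S" "\<rho> = restr j \<sigma>" using rho by blast
      have l: "\<sigma> \<in> labellings n h" and r: "g \<in> relabelled n h \<sigma>" using \<sigma> by (auto simp: S_def)
      have inj: "inj_on \<sigma> {1..n}" using l by (simp add: labellings_def bij_betw_def)
      \<comment> \<open>\<open>X \<rho>\<close> depends only on the restriction
        \<open>\<rho>\<close>. To compare its size with the twin class, one full labelling extending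
        \<open>\<rho>\<close> is fixed and used as an injection.\<close>
      have "X \<rho> \<subseteq> \<sigma> ` twins n h ?v"
      proof
        fix x assume x: "x \<in> X \<rho>"
        then have "x \<in> \<sigma> ` {2..n}" using labellings_bij[OF l] by (auto simp: X_def bij_betw_def)
        then obtain u where u: "u \<in> {2..n}" "x = \<sigma> u" by auto
        have "mset (g x) = image_mset \<sigma> (mset (h ?v))" using x by (simp add: X_def \<sigma>(2) img)
        moreover have "mset (g (\<sigma> u)) = image_mset \<sigma> (mset (h u))" using r u(1) by (simp add: relabelled_def)
        ultimately have "image_mset \<sigma> (mset (h u)) = image_mset \<sigma> (mset (h ?v))" using u(2) by simp
        then have "mset (h u) = mset (h ?v)"
          by (rule image_mset_inj_onD[OF inj, rotated 2]) (simp_all only: set_mset_mset histories_set[OF h u(1)] histories_set[OF h v])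
        then show "x \<in> \<sigma> ` twins n h ?v" using u by (auto simp: twins_def)
      qed
      then have "card (X \<rho>) \<le> card (twins n h ?v)"
        by (rule surj_card_le[rotated]) (simp add: twins_def)
      moreover have "finite (X \<rho>)" by (simp add: X_def)
      ultimately show ?thesis using card_image_le le_trans by blast
    qed
    have "card (restr ?v ` S) \<le> card (\<Union>\<rho>\<in>restr j ` S. (\<lambda>x. \<rho>(?v := x)) ` X \<rho>)"
      using finS by (intro card_mono[OF _ sub]) (auto simp: X_def)
    also have "\<dots> \<le> (\<Sum>\<rho>\<in>restr j ` S. card ((\<lambda>x. \<rho>(?v := x)) ` X \<rho>))"
      using finS by (intro card_UN_le) simp
    also have "\<dots> \<le> card (restr j ` S) * card (twins n h ?v)"
      using sum_bounded_above[OF cX] by simp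
    also have "\<dots> \<le> (\<Prod>u\<in>{2..j}. card (twins n h u)) * card (twins n h ?v)"
      using step by (intro mult_right_mono) auto
    also have "\<dots> = (\<Prod>u\<in>{2..?v}. card (twins n h u))"
      using step by (simp add: prod.nat_ivl_Suc')
    finally show ?case .
  qed
  from this[of n] have "card (restr n ` S) \<le> (\<Prod>v\<in>{2..n}. card (twins n h v))" using n by simp
  moreover have "restr n \<sigma> = \<sigma>" if "\<sigma> \<in> S" for \<sigma>
    using that by (auto simp: restr_def S_def labellings_def fun_eq_iff)
  then have "restr n ` S = S" by force
  ultimately show ?thesis unfolding S_def by simp
qed

section \<open>Rising factorials and the near invariance of the probability\<close>

lemma prod_list_eq_prod_power:
  fixes f :: "nat \<Rightarrow> real"
  assumes "set v \<subseteq> A" "finite A"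
  shows "(\<Prod>x\<leftarrow>v. f x) = (\<Prod>w\<in>A. f w ^ count_list v w)"
  using assms(1)
proof (induction v)
  case (Cons x v)
  have "(\<Prod>w\<in>A. f w ^ count_list (x # v) w) = (\<Prod>w\<in>A. f w ^ count_list v w * (if w = x then f w else 1))"
    by (intro prod.cong) auto
  also have "\<dots> = (\<Prod>w\<in>A. f w ^ count_list v w) * f x"
    using Cons.prems assms(2) by (simp add: prod.distrib)
  finally show ?case using Cons by simp
qed simp

text \<open>For d \<ge> 1 this is d (d + 1) ... (d + c - 1), the weight of choosing a vertex of
  degree d exactly c times if its degree were updated after every choice.\<close>

definition rise :: "nat \<Rightarrow> nat \<Rightarrow> real" where
  "rise d c = fact (d + c - 1) / fact (d - 1)"

lemma rise_0 [simp]: "rise d 0 = 1"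
  by (simp add: rise_def)

lemma rise_Suc: "d \<ge> 1 \<Longrightarrow> rise d (Suc c) = rise d c * real (d + c)"
  by (cases d) (simp_all add: rise_def)

text \<open>Each factor d + i with i < c lies between d and 2 d when c \<le> d. In the application c
  \<le> m \<le> d.\<close>

lemma rise_bounds:
  assumes "1 \<le> d"
  shows "real d ^ c \<le> rise d c" "c \<le> d \<Longrightarrow> rise d c \<le> (2 * real d) ^ c" "c \<le> 1 \<Longrightarrow> rise d c = real d ^ c"
proof -
  have nn: "0 \<le> rise d c" for c by (simp add: rise_def)
  show "real d ^ c \<le> rise d c"
  proof (induction c)
    case (Suc c)
    have "real d ^ c * real d \<le> rise d c * real (d + c)" using Suc nn by (intro mult_mono) auto
    then show ?case using assms by (simp add: rise_Suc mult.commute)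
  qed simp
  show "rise d c \<le> (2 * real d) ^ c" if "c \<le> d"
    using that
  proof (induction c)
    case (Suc c)
    have "rise d c * real (d + c) \<le> (2 * real d) ^ c * (2 * real d)" using Suc nn by (intro mult_mono) auto
    then show ?case using assms by (simp add: rise_Suc mult.commute)
  qed simp
  show "rise d c = real d ^ c" if "c \<le> 1"
    using that assms by (cases c) (auto simp: rise_Suc)
qed

text \<open>Replacing the powers in the probability of a history by rising factorials gives a quantity that
  depends on the degrees only and is therefore invariant under relabelling.\<close>

definition rising_prob :: "nat \<Rightarrow> (nat \<Rightarrow> nat list) \<Rightarrow> real" where
  "rising_prob k h = (\<Prod>w\<in>{1..Suc k}. fact (hdeg (Suc k) h w - 1) / fact (m - 1)) / (\<Prod>j<k. (real m * (2 * real j + 1)) ^ m)"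

text \<open>At each vertex the rising factorials of successive arrivals telescope to a quotient of
  factorials. Only the final degree remains, and the order of arrival is forgotten.\<close>

lemma rising_prob_upd:
  assumes h: "h \<in> histories (Suc k)" and v: "set v \<subseteq> {1..Suc k}"
  shows "rising_prob (Suc k) (h(Suc (Suc k) := v))
    = rising_prob k h * ((\<Prod>w\<in>{1..Suc k}. rise (hdeg (Suc k) h w) (count_list v w)) / (real m * (2 * real k + 1)) ^ m)"
proof -
  have c0: "count_list v (Suc (Suc k)) = 0" using v by (force simp: count_list_0_iff)
  have eq: "{1..Suc (Suc k)} = insert (Suc (Suc k)) {1..Suc k}" by auto
  have "(\<Prod>w\<in>{1..Suc (Suc k)}. fact (hdeg (Suc (Suc k)) (h(Suc (Suc k) := v)) w - 1) / fact (m - 1) :: real)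
    = (\<Prod>w\<in>{1..Suc k}. fact (hdeg (Suc k) h w + count_list v w - 1) / fact (m - 1))"
    unfolding eq hdeg_upd by (simp add: hdeg_new[OF h] c0)
  also have "\<dots> = (\<Prod>w\<in>{1..Suc k}. (fact (hdeg (Suc k) h w - 1) / fact (m - 1)) * rise (hdeg (Suc k) h w) (count_list v w))"
    by (intro prod.cong) (simp_all add: rise_def)
  also have "\<dots> = (\<Prod>w\<in>{1..Suc k}. fact (hdeg (Suc k) h w - 1) / fact (m - 1))
    * (\<Prod>w\<in>{1..Suc k}. rise (hdeg (Suc k) h w) (count_list v w))" by (rule prod.distrib)
  finally show ?thesis
    unfolding rising_prob_def prod.lessThan_Suc by (simp only: times_divide_times_eq)
qed

lemma rise_prod_bounds:
  fixes d :: "nat \<Rightarrow> nat"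
  assumes d: "\<And>w. m \<le> d w" and v: "length v = m" "set v \<subseteq> A" "finite A"
  shows "(\<Prod>x\<leftarrow>v. real (d x)) \<le> (\<Prod>w\<in>A. rise (d w) (count_list v w))"
    and "(\<Prod>w\<in>A. rise (d w) (count_list v w)) \<le> 2 ^ (m * of_bool (\<not> distinct v)) * (\<Prod>x\<leftarrow>v. real (d x))"
proof -
  have d1: "1 \<le> d w" for w using d[of w] m_pos by linarith
  have cm: "count_list v w \<le> m" for w using count_le_length[of v w] v(1) by simp
  note p = prod_list_eq_prod_power[OF v(2,3)]
  show "(\<Prod>x\<leftarrow>v. real (d x)) \<le> (\<Prod>w\<in>A. rise (d w) (count_list v w))"
    unfolding p using rise_bounds(1)[OF d1] by (intro prod_mono) auto
  show "(\<Prod>w\<in>A. rise (d w) (count_list v w)) \<le> 2 ^ (m * of_bool (\<not> distinct v)) * (\<Prod>x\<leftarrow>v. real (d x))"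
  proof (cases "distinct v")
    case True
    then have "count_list v w \<le> 1" for w
      by (simp add: distinct_count_atmost_1 flip: count_mset)
    then have "(\<Prod>w\<in>A. rise (d w) (count_list v w)) = (\<Prod>x\<leftarrow>v. real (d x))"
      unfolding p using rise_bounds(3)[OF d1] by (intro prod.cong) auto
    then show ?thesis using True by simp
  next
    case False
    have "(\<Prod>w\<in>A. rise (d w) (count_list v w)) \<le> (\<Prod>w\<in>A. (2 * real (d w)) ^ count_list v w)"
    proof (intro prod_mono conjI)
      fix w
      show "0 \<le> rise (d w) (count_list v w)" by (simp add: rise_def)
      show "rise (d w) (count_list v w) \<le> (2 * real (d w)) ^ count_list v w"
        using le_trans[OF cm d] by (rule rise_bounds(2)[OF d1])
    qed
    also have "\<dots> = (\<Prod>x\<leftarrow>v. 2 * real (d x))" by (rule prod_list_eq_prod_power[OF v(2,3), symmetric])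
    also have "\<dots> = 2 ^ length v * (\<Prod>x\<leftarrow>v. real (d x))" by (induction v) auto
    finally show ?thesis using False v(1) by simp
  qed
qed

text \<open>An arrival with distinct choices contributes equally to both sides; one with a repeated
  choice at most doubles each of its m factors.\<close>

lemma pmf_hist_rising_prob:
  "h \<in> histories (Suc k) \<Longrightarrow> pmf (hist k) h \<le> rising_prob k h \<and> rising_prob k h \<le> 2 ^ (m * num_repeated (Suc k) h) * pmf (hist k) h"
proof (induction k arbitrary: h)
  case 0
  have "h = (\<lambda>_. [])" using 0 by (auto simp: histories_def)
  then show ?case by (simp add: rising_prob_def hdeg_def num_repeated_def)
next
  case (Suc k)
  obtain g v where g: "g \<in> histories (Suc k)" and v: "length v = m" "set v \<subseteq> {1..Suc k}"
    and h: "h = g(Suc (Suc k) := v)" using Suc.prems by (rule histories_Suc)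
  define D where "D = (real m * (2 * real k + 1)) ^ m"
  define Q where "Q = (\<Prod>x\<leftarrow>v. real (hdeg (Suc k) g x))"
  define R where "R = (\<Prod>w\<in>{1..Suc k}. rise (hdeg (Suc k) g w) (count_list v w))"
  have D: "D > 0" using m_pos by (simp add: D_def add_nonneg_pos)
  have Q: "Q \<ge> 0" unfolding Q_def by (intro prod_list_nonneg) auto
  have "(\<Prod>x\<leftarrow>v. real (hdeg (Suc k) g x) / (real m * (2 * real k + 1))) = Q / (real m * (2 * real k + 1)) ^ length v"
    unfolding Q_def by (induction v) auto
  then have pm: "pmf (hist (Suc k)) h = pmf (hist k) g * (Q / D)"
    unfolding h pmf_hist_Suc[OF g v] by (simp add: D_def v)
  have ps: "rising_prob (Suc k) h = rising_prob k g * (R / D)"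
    unfolding h rising_prob_upd[OF g v(2)] D_def R_def ..
  have QR: "Q \<le> R" "R \<le> 2 ^ (m * of_bool (\<not> distinct v)) * Q"
    using rise_prod_bounds[where d = "hdeg (Suc k) g", OF hdeg_ge v finite_atLeastAtMost] by (auto simp: Q_def R_def)
  have nr: "num_repeated (Suc (Suc k)) h = num_repeated (Suc k) g + of_bool (\<not> distinct v)"
    unfolding h by (rule num_repeated_upd)
  note IH = Suc.IH[OF g]
  have ps0: "0 \<le> rising_prob k g" by (rule order_trans[OF pmf_nonneg conjunct1[OF IH]])
  have "pmf (hist (Suc k)) h \<le> rising_prob (Suc k) h"
    unfolding pm ps using D Q ps0 by (intro mult_mono divide_right_mono QR(1) conjunct1[OF IH]) simp_all
  moreover have "rising_prob (Suc k) h \<le> (2 ^ (m * num_repeated (Suc k) g) * pmf (hist k) g) * (2 ^ (m * of_bool (\<not> distinct v)) * Q / D)"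
    unfolding ps using D order_trans[OF Q QR(1)]
    by (intro mult_mono divide_right_mono QR(2) conjunct2[OF IH]) simp_all
  moreover have "\<dots> = 2 ^ (m * num_repeated (Suc (Suc k)) h) * pmf (hist (Suc k)) h"
    unfolding pm nr by (simp add: power_add distrib_left mult_ac)
  ultimately show ?case by simp
qed

text \<open>A labelling carries degrees and repetitions along, and the denominators in
  \<open>rising_prob\<close> depend on the arrival times alone.\<close>

lemma relabelled_invariants:
  assumes h: "h \<in> histories (Suc k)" and \<sigma>: "\<sigma> \<in> labellings (Suc k) h" and g: "g \<in> relabelled (Suc k) h \<sigma>"
  shows "rising_prob k g = rising_prob k h" "num_repeated (Suc k) g = num_repeated (Suc k) h"
proof -
  let ?n = "Suc k"
  note b2 = labellings_bij[OF \<sigma>]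
  have b: "bij_betw \<sigma> {1..?n} {1..?n}" using \<sigma> by (simp add: labellings_def)
  then have inj: "inj_on \<sigma> {1..?n}" by (simp add: bij_betw_def)
  have gm: "mset (g (\<sigma> v)) = image_mset \<sigma> (mset (h v))" if "v \<in> {2..?n}" for v
    using g that by (simp add: relabelled_def)
  have cnt: "count_list (g (\<sigma> v)) (\<sigma> w) = count_list (h v) w" if v: "v \<in> {2..?n}" and w: "w \<in> {1..?n}" for v w
    using count_image_mset_inj_on[OF inj _ w, of "mset (h v)"] histories_set[OF h v] gm[OF v]
    by (simp flip: count_mset)
  have dgs: "hdeg ?n g (\<sigma> w) = hdeg ?n h w" if w: "w \<in> {1..?n}" for w
  proof -
    have "(\<Sum>v\<in>{2..?n}. count_list (g v) (\<sigma> w)) = (\<Sum>v\<in>{2..?n}. count_list (g (\<sigma> v)) (\<sigma> w))"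
      by (rule sum.reindex_bij_betw[OF b2, symmetric])
    also have "\<dots> = (\<Sum>v\<in>{2..?n}. count_list (h v) w)" using w by (intro sum.cong refl cnt)
    finally show ?thesis by (simp add: hdeg_def)
  qed
  have "(\<Prod>w\<in>{1..?n}. fact (hdeg ?n g w - 1) / fact (m - 1) :: real) = (\<Prod>w\<in>{1..?n}. fact (hdeg ?n g (\<sigma> w) - 1) / fact (m - 1))"
    by (rule prod.reindex_bij_betw[OF b, symmetric])
  also have "\<dots> = (\<Prod>w\<in>{1..?n}. fact (hdeg ?n h w - 1) / fact (m - 1))"
    using dgs by (intro prod.cong) auto
  finally show "rising_prob k g = rising_prob k h" by (simp add: rising_prob_def)
  have dist: "distinct (g (\<sigma> v)) \<longleftrightarrow> distinct (h v)" if v: "v \<in> {2..?n}" for v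
  proof -
    have "distinct (g (\<sigma> v)) \<longleftrightarrow> distinct (map \<sigma> (h v))"
      by (rule mset_eq_imp_distinct_iff) (simp add: gm[OF v])
    moreover have "inj_on \<sigma> (set (h v))" using histories_set[OF h v] inj by (rule inj_on_subset[rotated])
    ultimately show ?thesis by (simp add: distinct_map)
  qed
  have "\<sigma> ` {v\<in>{2..?n}. \<not> distinct (h v)} = {v\<in>{2..?n}. \<not> distinct (g v)}"
  proof (intro equalityI subsetI)
    fix u assume "u \<in> {v\<in>{2..?n}. \<not> distinct (g v)}"
    then have u: "u \<in> {2..?n}" "\<not> distinct (g u)" by auto
    then have "u \<in> \<sigma> ` {2..?n}" using b2 by (simp add: bij_betw_def)
    then obtain v where "v \<in> {2..?n}" "u = \<sigma> v" by auto
    then show "u \<in> \<sigma> ` {v\<in>{2..?n}. \<not> distinct (h v)}" using u(2) dist by auto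
  qed (use dist bij_betwE[OF b2] in auto)
  moreover have "inj_on \<sigma> {v\<in>{2..?n}. \<not> distinct (h v)}"
    using b2 by (auto simp: bij_betw_def inj_on_def)
  ultimately show "num_repeated ?n g = num_repeated ?n h" unfolding num_repeated_def using card_image by fastforce
qed

lemma pmf_relabelled_ge:
  assumes h: "h \<in> histories (Suc k)" and \<sigma>: "\<sigma> \<in> labellings (Suc k) h" and g: "g \<in> relabelled (Suc k) h \<sigma>"
  shows "pmf (hist k) h / 2 ^ (m * num_repeated (Suc k) h) \<le> pmf (hist k) g"
proof -
  have g': "g \<in> histories (Suc k)" using g by (simp add: relabelled_def)
  have "pmf (hist k) h \<le> 2 ^ (m * num_repeated (Suc k) h) * pmf (hist k) g"
    using pmf_hist_rising_prob[OF h] pmf_hist_rising_prob[OF g'] relabelled_invariants[OF h \<sigma> g] by simp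
  then show ?thesis by (simp add: divide_le_eq mult.commute)
qed

section \<open>Isomorphism classes of histories\<close>

definition iso_class :: "nat \<Rightarrow> (nat \<Rightarrow> nat list) \<Rightarrow> (nat \<Rightarrow> nat list) set" where
  "iso_class n h = {g\<in>histories n. isomorphic (graph_of n h) (graph_of n g)}"

definition class_prob :: "nat \<Rightarrow> (nat \<Rightarrow> nat list) \<Rightarrow> real" where
  "class_prob k h = (\<Sum>g\<in>iso_class (Suc k) h. pmf (hist k) g)"

lemma finite_histories: "finite (histories (Suc k))"
  using finite_hist[of k] by (simp add: set_hist)

lemma finite_iso_class: "finite (iso_class (Suc k) h)"
  using finite_histories by (simp add: iso_class_def)

text \<open>Pairs of a labelling and one of its relabelled histories are counted twice. Each
  labelling yields at least m! histories per vertex with distinct parents, all isomorphic to h and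
  not much less likely. Each history arises from at most as many labellings as the product of the
  twin class sizes.\<close>

lemma class_prob_ge:
  assumes h: "h \<in> histories (Suc k)"
  shows "real (card (labellings (Suc k) h)) * real (fact m) ^ card {v\<in>{2..Suc k}. distinct (h v)}
      * (pmf (hist k) h / 2 ^ (m * num_repeated (Suc k) h))
    \<le> real (\<Prod>v\<in>{2..Suc k}. card (twins (Suc k) h v)) * class_prob k h"
proof -
  let ?n = "Suc k" and ?L = "labellings (Suc k) h" and ?R = "relabelled (Suc k) h"
  define q where "q = pmf (hist k) h / 2 ^ (m * num_repeated (Suc k) h)"
  have q: "q \<ge> 0" by (simp add: q_def)
  have sub: "?R \<sigma> \<subseteq> iso_class ?n h" if "\<sigma> \<in> ?L" for \<sigma>
    using isomorphic_relabelled[OF h _ that] by (auto simp: iso_class_def relabelled_def)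
  have "real (card ?L) * real (fact m) ^ card {v\<in>{2..?n}. distinct (h v)} * q
    = (\<Sum>\<sigma>\<in>?L. real (fact m ^ card {v\<in>{2..?n}. distinct (h v)}) * q)" by simp
  also have "\<dots> \<le> (\<Sum>\<sigma>\<in>?L. real (card (?R \<sigma>)) * q)"
    using card_relabelled_ge[OF h] q by (intro sum_mono mult_right_mono of_nat_mono) auto
  also have "\<dots> = (\<Sum>\<sigma>\<in>?L. \<Sum>g\<in>?R \<sigma>. q)" by simp
  also have "\<dots> \<le> (\<Sum>\<sigma>\<in>?L. \<Sum>g\<in>?R \<sigma>. pmf (hist k) g)"
    using pmf_relabelled_ge[OF h] by (intro sum_mono) (auto simp: q_def)
  also have "\<dots> = (\<Sum>\<sigma>\<in>?L. \<Sum>g\<in>iso_class ?n h. of_bool (g \<in> ?R \<sigma>) * pmf (hist k) g)"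
  proof (rule sum.cong)
    fix \<sigma> assume "\<sigma> \<in> ?L"
    then show "(\<Sum>g\<in>?R \<sigma>. pmf (hist k) g) = (\<Sum>g\<in>iso_class ?n h. of_bool (g \<in> ?R \<sigma>) * pmf (hist k) g)"
      using sub finite_iso_class by (intro sum.mono_neutral_cong_left) auto
  qed simp
  also have "\<dots> = (\<Sum>g\<in>iso_class ?n h. \<Sum>\<sigma>\<in>?L. of_bool (g \<in> ?R \<sigma>) * pmf (hist k) g)"
    by (rule sum.swap)
  also have "\<dots> = (\<Sum>g\<in>iso_class ?n h. real (card {\<sigma>\<in>?L. g \<in> ?R \<sigma>}) * pmf (hist k) g)"
    using finite_labellings by (simp add: Int_def flip: sum_distrib_right)
  also have "\<dots> \<le> (\<Sum>g\<in>iso_class ?n h. real (\<Prod>v\<in>{2..?n}. card (twins ?n h v)) * pmf (hist k) g)"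
    using card_labellings_relabelled_le[OF h] by (intro sum_mono mult_right_mono of_nat_mono) auto
  also have "\<dots> = real (\<Prod>v\<in>{2..?n}. card (twins ?n h v)) * class_prob k h"
    by (simp add: class_prob_def sum_distrib_left)
  finally show ?thesis unfolding q_def .
qed

text \<open>An edge that is not a loop was made by its larger endpoint. Hence the labelled graph
  determines the multiset of choices of each vertex.\<close>

lemma edge_mult_graph_of:
  assumes g: "g \<in> histories n" and u: "u \<in> {2..n}" and w: "w < u"
  shows "edge_mult (graph_of n g) u w = count_list (g u) w"
proof -
  have cs: "count (\<Sum>v\<in>A. f v) x = (\<Sum>v\<in>A. count (f v) x)" if "finite A"
    for A and f :: "nat \<Rightarrow> nat uprod multiset" and x
    using that by (induction A rule: finite_induct) auto
  have eq: "count (mset (map (Upair v) (g v))) (Upair u w) = (if v = u then count_list (g u) w else 0)"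
    if v: "v \<in> {2..n}" for v
  proof (cases "v = u")
    case True
    have "count (mset (map (Upair u) xs)) (Upair u w) = count_list xs w" for xs
      by (induction xs) auto
    then show ?thesis using True by simp
  next
    case False
    have "Upair u w \<notin> Upair v ` set (g v)"
    proof
      assume "Upair u w \<in> Upair v ` set (g v)"
      then obtain x where "x \<in> set (g v)" "Upair u w = Upair v x" by auto
      then show False using False w g v by (force simp: histories_def)
    qed
    then show ?thesis using False by (auto simp: not_in_iff[symmetric])
  qed
  have "edge_mult (graph_of n g) u w = (\<Sum>v\<in>{2..n}. count (mset (map (Upair v) (g v))) (Upair u w))"
    using w by (simp add: edge_mult_def graph_of_def cs)
  also have "\<dots> = (\<Sum>v\<in>{2..n}. if v = u then count_list (g u) w else 0)"
    by (intro sum.cong refl eq)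
  also have "\<dots> = count_list (g u) w" using u by simp
  finally show ?thesis .
qed

text \<open>A permutation of the vertices fixes the labelled graph, the labelled graph fixes the
  choices up to order, and each of the n - 1 later vertices has at most m! orders.\<close>

lemma card_iso_class_le: "card (iso_class n h) \<le> fact n * fact m ^ (n - 1)"
proof -
  define T where "T f = {g\<in>histories n. \<forall>u\<in>{1..n}. \<forall>v\<in>{1..n}.
    edge_mult (graph_of n g) (f u) (f v) = edge_mult (graph_of n h) u v}" for f
  let ?F = "{f. f permutes {1..n}}"
  have T: "finite (T f) \<and> card (T f) \<le> fact m ^ (n - 1)" if f: "f permutes {1..n}" for f
  proof (cases "T f = {}")
    case False
    then obtain g0 where g0: "g0 \<in> T f" by auto
    have "T f \<subseteq> PiE_dflt {2..n} [] (\<lambda>u. permutations_of_multiset (mset (g0 u)))"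
    proof
      fix g assume g: "g \<in> T f"
      have gH: "g \<in> histories n" "g0 \<in> histories n" using g g0 by (auto simp: T_def)
      have "mset (g u) = mset (g0 u)" if u: "u \<in> {2..n}" for u
      proof (rule multiset_eqI)
        fix w
        show "count (mset (g u)) w = count (mset (g0 u)) w"
        proof (cases "w \<in> {1..<u}")
          case True
          have "u \<in> f ` {1..n}" "w \<in> f ` {1..n}" using permutes_image[OF f] u True by auto
          then have "edge_mult (graph_of n g) u w = edge_mult (graph_of n g0) u w"
            using g g0 by (auto simp: T_def)
          then show ?thesis
            using True u edge_mult_graph_of[OF gH(1) u] edge_mult_graph_of[OF gH(2) u] by (simp add: count_mset)
        next
          case False
          then have "w \<notin> set (g u)" "w \<notin> set (g0 u)" using gH u unfolding histories_def by blast+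
          then have "count (mset (g u)) w = 0" "count (mset (g0 u)) w = 0"
            unfolding count_eq_zero_iff by simp_all
          then show ?thesis by (rule trans[OF _ sym])
        qed
      qed
      then show "g \<in> PiE_dflt {2..n} [] (\<lambda>u. permutations_of_multiset (mset (g0 u)))"
        using gH by (auto simp: PiE_dflt_def permutations_of_multiset_def histories_def)
    qed
    moreover have fin: "finite (PiE_dflt {2..n} [] (\<lambda>u. permutations_of_multiset (mset (g0 u))))"
      by (intro finite_PiE_dflt) auto
    moreover have "card (PiE_dflt {2..n} [] (\<lambda>u. permutations_of_multiset (mset (g0 u)))) \<le> fact m ^ (n - 1)"
    proof -
      have "card (PiE_dflt {2..n} [] (\<lambda>u. permutations_of_multiset (mset (g0 u))))
        = (\<Prod>u\<in>{2..n}. card (permutations_of_multiset (mset (g0 u))))"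
        by (rule card_PiE_dflt) auto
      also have "\<dots> \<le> (\<Prod>u\<in>{2..n}. fact m)"
      proof (intro prod_mono conjI)
        fix u assume "u \<in> {2..n}"
        then have "length (g0 u) = m" using g0 by (auto simp: T_def histories_def)
        then show "card (permutations_of_multiset (mset (g0 u))) \<le> fact m"
          using card_permutations_of_multiset_le[of "mset (g0 u)"] by simp
      qed simp
      finally show ?thesis by simp
    qed
    ultimately show ?thesis using finite_subset card_mono le_trans by meson
  qed simp
  have "iso_class n h \<subseteq> (\<Union>f\<in>?F. T f)"
  proof
    fix g assume "g \<in> iso_class n h"
    then obtain f where g: "g \<in> histories n" and b: "bij_betw f {1..n} {1..n}"
      and e: "\<forall>u\<in>{1..n}. \<forall>v\<in>{1..n}. edge_mult (graph_of n g) (f u) (f v) = edge_mult (graph_of n h) u v"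
      unfolding iso_class_def isomorphic_def verts_def order_graph_of by blast
    \<comment> \<open>Continuing by the identity turns the bijection of the vertex set into a
      permutation, so that there are only n! candidates.\<close>
    define f' where "f' u = (if u \<in> {1..n} then f u else u)" for u
    have "bij_betw f' {1..n} {1..n}" using b by (subst bij_betw_cong[of _ f' f]) (auto simp: f'_def)
    then have "f' permutes {1..n}" by (rule bij_imp_permutes) (simp only: f'_def if_False)
    moreover have "g \<in> T f'" using g e by (simp add: T_def f'_def)
    ultimately show "g \<in> (\<Union>f\<in>?F. T f)" by blast
  qed
  then have "card (iso_class n h) \<le> card (\<Union>f\<in>?F. T f)"
    using T finite_permutations[of "{1..n}"] by (intro card_mono) auto
  also have "\<dots> \<le> (\<Sum>f\<in>?F. card (T f))"
    by (intro card_UN_le) (simp add: finite_permutations)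
  also have "\<dots> \<le> (\<Sum>f\<in>?F. fact m ^ (n - 1))" using T by (intro sum_mono) auto
  also have "\<dots> = fact n * fact m ^ (n - 1)"
    by (simp add: card_permutations)
  finally show ?thesis .
qed

end

section \<open>Entropy of the structure\<close>

text \<open>Cesaro averaging: losses that vanish per arrival are o(n) in total.\<close>

lemma eventually_sum_le_linear:
  fixes e :: "nat \<Rightarrow> real"
  assumes "e \<longlonglongrightarrow> 0" "\<epsilon> > 0"
  shows "\<forall>\<^sub>F k in sequentially. (\<Sum>j<k. e j) \<le> \<epsilon> * real k"
proof -
  obtain N where N: "\<And>j. j \<ge> N \<Longrightarrow> norm (e j - 0) < \<epsilon> / 2"
    using LIMSEQ_D[OF assms(1), of "\<epsilon> / 2"] assms(2) by auto
  define c where "c = (\<Sum>j<N. \<bar>e j\<bar>)"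
  have "(\<Sum>j<k. e j) \<le> c + \<epsilon> / 2 * real k" for k
  proof (induction k)
    case 0
    then show ?case by (simp add: c_def sum_nonneg)
  next
    case (Suc k)
    show ?case
    proof (cases "k < N")
      case True
      have "(\<Sum>j<Suc k. e j) \<le> (\<Sum>j<Suc k. \<bar>e j\<bar>)" by (intro sum_mono) auto
      also have "\<dots> \<le> c" unfolding c_def using True by (intro sum_mono2) auto
      also have "\<dots> \<le> c + \<epsilon> / 2 * real (Suc k)" using assms(2) by simp
      finally show ?thesis .
    next
      case False
      then have "e k \<le> \<epsilon> / 2" using N[of k] by simp
      then show ?thesis using Suc by (simp add: algebra_simps add_divide_distrib)
    qed
  qed
  note bound = this
  obtain M where M: "real M \<ge> 2 * c / \<epsilon>" using real_arch_simple by blast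
  show ?thesis
  proof (rule eventually_sequentiallyI)
    fix k assume "M \<le> k"
    then have "2 * c / \<epsilon> \<le> real k" using M by (meson of_nat_le_iff order_trans)
    then have "c \<le> \<epsilon> / 2 * real k" using assms(2) by (simp add: field_simps)
    then show "(\<Sum>j<k. e j) \<le> \<epsilon> * real k" using bound[of k] by (simp add: field_simps)
  qed
qed

lemma ln_ratio_bounds:
  assumes "x > (0::real)"
  shows "1 / (x + 1) \<le> ln (x + 1) - ln x" "ln (x + 1) - ln x \<le> 1 / x"
proof -
  have "ln (x / (x + 1)) \<le> x / (x + 1) - 1" using assms by (intro ln_le_minus_one) simp
  then show "1 / (x + 1) \<le> ln (x + 1) - ln x" using assms by (simp add: ln_div field_simps)
  have "ln ((x + 1) / x) \<le> (x + 1) / x - 1" using assms by (intro ln_le_minus_one) simp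
  then show "ln (x + 1) - ln x \<le> 1 / x" using assms by (simp add: ln_div field_simps)
qed

lemma sum_ln_le: "(\<Sum>j<k. ln (real (Suc j))) \<le> real (Suc k) * ln (real (Suc k)) - real k"
proof (induction k)
  case (Suc k)
  define x where "x = real (Suc k)"
  have x: "x > 0" "real (Suc (Suc k)) = x + 1" by (auto simp: x_def)
  have "1 \<le> (x + 1) * (ln (x + 1) - ln x)"
    using ln_ratio_bounds(1)[OF x(1)] x by (simp add: divide_le_eq mult.commute)
  then show ?case using Suc unfolding sum.lessThan_Suc x(2) x_def[symmetric] by (simp add: algebra_simps x_def)
qed simp

lemma sum_ln_ge: "real k * ln (real (Suc k)) - real k - 1 \<le> (\<Sum>j<k. ln (real (Suc j)))"
proof (induction k)
  case (Suc k)
  define x where "x = real (Suc k)"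
  have x: "x > 0" "real (Suc (Suc k)) = x + 1" by (auto simp: x_def)
  have "x * (ln (x + 1) - ln x) \<le> 1"
    using ln_ratio_bounds(2)[OF x(1)] x by (simp add: le_divide_eq mult.commute)
  moreover have "real k * ln x = x * ln x - ln x" "real k = x - 1" by (simp_all add: x_def algebra_simps)
  ultimately show ?case
    using Suc unfolding sum.lessThan_Suc x(2) x_def[symmetric] right_diff_distrib by linarith
qed simp

lemma ln_fact_eq_sum: "ln (fact k :: real) = (\<Sum>j<k. ln (real (Suc j)))"
  by (induction k) (simp_all add: ln_mult del: of_nat_Suc)

context pref_attach
begin

section \<open>Lower and upper bounds for the structural entropy in nats\<close>

definition class_entropy :: "nat \<Rightarrow> real" where
  "class_entropy k = E (hist k) (\<lambda>h. - ln (class_prob k h))"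

lemma pmf_structure:
  assumes h: "h \<in> histories (Suc k)"
  shows "pmf (map_pmf structure_of (PA m (Suc k))) (structure_of (graph_of (Suc k) h)) = class_prob k h"
proof -
  have "pmf (map_pmf structure_of (PA m (Suc k))) (structure_of (graph_of (Suc k) h))
    = measure (measure_pmf (hist k)) ((\<lambda>g. structure_of (graph_of (Suc k) g)) -` {structure_of (graph_of (Suc k) h)} \<inter> set_pmf (hist k))"
    unfolding PA_eq pmf.map_comp pmf_map measure_Int_set_pmf o_def ..
  also have "(\<lambda>g. structure_of (graph_of (Suc k) g)) -` {structure_of (graph_of (Suc k) h)} \<inter> set_pmf (hist k)
    = iso_class (Suc k) h"
    by (auto simp: iso_class_def set_hist structure_of_eq_iff intro: isomorphic_sym)
  also have "measure (measure_pmf (hist k)) (iso_class (Suc k) h) = class_prob k h"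
    unfolding class_prob_def by (rule measure_measure_pmf_finite[OF finite_iso_class])
  finally show ?thesis .
qed

lemma structural_entropy_eq:
  assumes b: "b > 1"
  shows "structural_entropy b (PA m (Suc k)) = class_entropy k / ln b"
proof -
  let ?q = "map_pmf structure_of (PA m (Suc k))"
  have fin: "finite (set_pmf (PA m (Suc k)))" by (simp add: PA_eq finite_hist)
  have "structural_entropy b (PA m (Suc k)) = E ?q (\<lambda>s. - log b (pmf ?q s))"
    unfolding structural_entropy_eq_sum[OF b fin]
    using fin by (subst E_finite) (simp_all add: sum_negf)
  also have "\<dots> = E (hist k) (\<lambda>h. - log b (pmf ?q (structure_of (graph_of (Suc k) h))))"
    by (simp add: PA_eq)
  also have "\<dots> = E (hist k) (\<lambda>h. - ln (class_prob k h) / ln b)"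
    by (intro E_cong) (simp add: pmf_structure set_hist log_def)
  also have "\<dots> = class_entropy k / ln b" by (simp add: class_entropy_def)
  finally show ?thesis .
qed

lemma class_prob_pos:
  assumes h: "h \<in> histories (Suc k)"
  shows "0 < pmf (hist k) h" "0 < class_prob k h"
proof -
  show p: "0 < pmf (hist k) h" using h by (intro pmf_positive) (simp add: set_hist)
  have "h \<in> iso_class (Suc k) h" using h by (simp add: iso_class_def isomorphic_refl)
  then have "pmf (hist k) h \<le> class_prob k h"
    unfolding class_prob_def by (intro member_le_sum finite_iso_class) auto
  then show "0 < class_prob k h" using p by simp
qed

text \<open>The entropy of a history given its structure is at most the logarithm of the class size.
  Formally, ln y \<le> y - 1 is applied to y = \<open>class_prob / (pmf * N)\<close>; the mean of
  \<open>class_prob / pmf\<close> is the sum of \<open>class_prob\<close> over all histories, which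
  by double counting is the mean class size and hence at most N.\<close>

lemma class_entropy_ge: "E (hist k) (\<lambda>h. - ln (pmf (hist k) h)) - ln (fact (Suc k)) - real k * ln (fact m) \<le> class_entropy k"
proof -
  define N :: real where "N = fact (Suc k) * fact m ^ k"
  have N: "N > 0" by (simp add: N_def)
  have lnN: "ln N = ln (fact (Suc k)) + real k * ln (fact m)"
    unfolding N_def by (subst ln_mult_pos) (simp_all add: ln_realpow del: fact_Suc)
  have "(\<Sum>h\<in>histories (Suc k). class_prob k h) = (\<Sum>h\<in>histories (Suc k). \<Sum>g\<in>histories (Suc k). of_bool (g \<in> iso_class (Suc k) h) * pmf (hist k) g)"
    unfolding class_prob_def
    by (intro sum.cong refl sum.mono_neutral_cong_left finite_histories) (auto simp: iso_class_def)
  also have "\<dots> = (\<Sum>g\<in>histories (Suc k). \<Sum>h\<in>histories (Suc k). of_bool (g \<in> iso_class (Suc k) h) * pmf (hist k) g)"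
    by (rule sum.swap)
  also have "\<dots> = (\<Sum>g\<in>histories (Suc k). real (card (iso_class (Suc k) g)) * pmf (hist k) g)"
  proof (rule sum.cong)
    fix g assume g: "g \<in> histories (Suc k)"
    have "{h \<in> histories (Suc k). g \<in> iso_class (Suc k) h} = iso_class (Suc k) g"
      using g by (auto simp: iso_class_def intro: isomorphic_sym)
    then show "(\<Sum>h\<in>histories (Suc k). of_bool (g \<in> iso_class (Suc k) h) * pmf (hist k) g)
      = real (card (iso_class (Suc k) g)) * pmf (hist k) g"
      using finite_histories by (simp add: Int_def flip: sum_distrib_right)
  qed simp
  also have "\<dots> \<le> (\<Sum>g\<in>histories (Suc k). N * pmf (hist k) g)"
  proof (intro sum_mono mult_right_mono)
    fix g
    have "real (card (iso_class (Suc k) g)) \<le> real (fact (Suc k) * fact m ^ k)"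
      using card_iso_class_le[of "Suc k" g] by (intro of_nat_mono) simp
    then show "real (card (iso_class (Suc k) g)) \<le> N" by (simp add: N_def del: fact_Suc)
  qed simp
  also have "\<dots> = N"
    using sum_pmf_eq_1[OF finite_histories[of k], of "hist k"] by (simp add: set_hist flip: sum_distrib_left)
  finally have S: "(\<Sum>h\<in>histories (Suc k). class_prob k h) \<le> N" .
  have "E (hist k) (\<lambda>h. ln (class_prob k h) - ln (pmf (hist k) h))
    \<le> E (hist k) (\<lambda>h. (ln N - 1) + class_prob k h / pmf (hist k) h / N)"
  proof (rule E_mono[OF finite_hist])
    fix h assume "h \<in> set_pmf (hist k)"
    then have h: "0 < pmf (hist k) h" "0 < class_prob k h" using class_prob_pos by (auto simp: set_hist)
    have "ln (class_prob k h / pmf (hist k) h / N) \<le> class_prob k h / pmf (hist k) h / N - 1"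
      using h N by (intro ln_le_minus_one) simp
    moreover have "ln (class_prob k h / pmf (hist k) h / N) = ln (class_prob k h) - ln (pmf (hist k) h) - ln N"
      using h N by (simp only: ln_divide_pos divide_pos_pos)
    ultimately show "ln (class_prob k h) - ln (pmf (hist k) h) \<le> (ln N - 1) + class_prob k h / pmf (hist k) h / N" by simp
  qed
  also have "\<dots> = (ln N - 1) + E (hist k) (\<lambda>h. class_prob k h / pmf (hist k) h) / N"
    by (simp add: E_add[OF finite_hist] del: divide_divide_eq_left)
  also have "E (hist k) (\<lambda>h. class_prob k h / pmf (hist k) h) = (\<Sum>h\<in>histories (Suc k). class_prob k h)"
    unfolding E_finite[OF finite_hist] set_hist
  proof (rule sum.cong)
    fix h assume "h \<in> histories (Suc k)"
    from class_prob_pos(1)[OF this] show "pmf (hist k) h * (class_prob k h / pmf (hist k) h) = class_prob k h" by simp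
  qed simp
  also have "(ln N - 1) + (\<Sum>h\<in>histories (Suc k). class_prob k h) / N \<le> ln N"
    using S N by (simp add: divide_le_eq)
  finally have "E (hist k) (\<lambda>h. ln (class_prob k h) - ln (pmf (hist k) h)) \<le> ln N" .
  then show ?thesis by (simp add: E_diff[OF finite_hist] class_entropy_def lnN)
qed

text \<open>The logarithm of \<open>class_prob_ge\<close> is taken history by history and then
  averaged; the number of labellings enters through the entropy of the random insertion.\<close>

lemma class_entropy_le:
  "class_entropy k \<le> E (hist k) (\<lambda>h. - ln (pmf (hist k) h)) - (\<Sum>j<k. ln (real (Suc j)) - real m) - real k * ln (fact m)
    + (ln (fact m) + real m * ln 2) * (real m ^ 2 * (\<Sum>j<k. cubed_ratio j)) + 2 * fact m * (\<Sum>j<k. cubed_ratio j)"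
proof -
  let ?n = "Suc k"
  \<comment> \<open>The price of a vertex with a repeated parent: its factor m! of orderings and a
    factor 2^m in probability.\<close>
  define c :: real where "c = ln (fact m) + real m * ln 2"
  have c: "c \<ge> 0" unfolding c_def by (intro add_nonneg_nonneg ln_ge_zero mult_nonneg_nonneg) (auto simp: fact_ge_1)
  have "class_entropy k \<le> E (hist k) (\<lambda>h. ((- ln (pmf (hist k) h) - entropy_pmf (insertion_pmf k h)) + c * real (num_repeated ?n h))
      + (real (num_twins ?n h) - real k - real k * ln (fact m)))"
    unfolding class_entropy_def
  proof (rule E_mono[OF finite_hist])
    fix h assume "h \<in> set_pmf (hist k)"
    then have h: "h \<in> histories ?n" by (simp add: set_hist)
    note pos = class_prob_pos[OF h]
    let ?L = "real (card (labellings ?n h))" and ?d = "card {v\<in>{2..?n}. distinct (h v)}"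
      and ?T = "real (\<Prod>v\<in>{2..?n}. card (twins ?n h v))"
    have "set_pmf (insertion_pmf k h) \<noteq> {}" by (rule set_pmf_not_empty)
    then have cs: "0 < card (set_pmf (insertion_pmf k h))" "card (set_pmf (insertion_pmf k h)) \<le> card (labellings ?n h)"
      using finite_insertion_pmf[OF h] card_mono[OF finite_labellings set_insertion_pmf[OF h]] by (auto simp: card_gt_0_iff)
    then have L: "?L > 0" by simp
    have "entropy_pmf (insertion_pmf k h) \<le> ln (real (card (set_pmf (insertion_pmf k h))))" by (rule entropy_pmf_le_ln_card[OF finite_insertion_pmf[OF h]])
    also have "\<dots> \<le> ln ?L" using cs by simp
    finally have entL: "entropy_pmf (insertion_pmf k h) \<le> ln ?L" .
    have tw: "card (twins ?n h v) \<ge> 1" if "v \<in> {2..?n}" for v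
      using that by (auto simp: twins_def Suc_le_eq card_gt_0_iff)
    have T: "?T > 0"
      unfolding of_nat_prod using tw by (intro prod_pos ballI) (simp add: Suc_le_eq)
    have "ln ?T = (\<Sum>v\<in>{2..?n}. ln (real (card (twins ?n h v))))"
    proof -
      have "real (card (twins ?n h v)) \<noteq> 0" if "v \<in> {2..?n}" for v using tw[OF that] by simp
      then show ?thesis unfolding of_nat_prod by (intro ln_prod) simp_all
    qed
    \<comment> \<open>The inequality ln x \<le> x - 1 subtracts 1 per vertex, which cancels the k
      pairs in which a vertex is its own twin.\<close>
    also have "\<dots> \<le> (\<Sum>v\<in>{2..?n}. real (card (twins ?n h v)) - 1)"
      using tw by (intro sum_mono ln_le_minus_one) (simp add: Suc_le_eq)
    also have "\<dots> = real (num_twins ?n h) - real k"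
      by (simp add: num_twins_def twins_def sum_subtractf)
    finally have lnT: "ln ?T \<le> real (num_twins ?n h) - real k" .
    have "{v\<in>{2..?n}. distinct (h v)} \<union> {v\<in>{2..?n}. \<not> distinct (h v)} = {2..?n}" by auto
    then have "?d + num_repeated ?n h = card {2..?n}"
      unfolding num_repeated_def by (subst card_Un_disjoint[symmetric]) auto
    then have d: "real ?d = real k - real (num_repeated ?n h)" by simp
    have f: "real (fact m) ^ ?d > 0" by simp
    have pp: "pmf (hist k) h / 2 ^ (m * num_repeated ?n h) > 0" using pos by simp
    have "ln (?L * real (fact m) ^ ?d * (pmf (hist k) h / 2 ^ (m * num_repeated ?n h))) \<le> ln (?T * class_prob k h)"
    proof (subst ln_le_cancel_iff)
      show "0 < ?L * real (fact m) ^ ?d * (pmf (hist k) h / 2 ^ (m * num_repeated ?n h))"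
        by (intro mult_pos_pos L f pp)
      show "0 < ?T * class_prob k h" by (intro mult_pos_pos T pos)
    qed (rule class_prob_ge[OF h])
    moreover have "ln (?L * real (fact m) ^ ?d * (pmf (hist k) h / 2 ^ (m * num_repeated ?n h)))
      = ln ?L + real ?d * ln (real (fact m)) + (ln (pmf (hist k) h) - real (m * num_repeated ?n h) * ln 2)"
      using L f pp pos by (simp only: ln_mult_pos mult_pos_pos ln_realpow ln_divide_pos zero_less_power zero_less_numeral)
    moreover have "ln (?T * class_prob k h) = ln ?T + ln (class_prob k h)"
      by (rule ln_mult_pos[OF T pos(2)])
    ultimately have main: "ln ?L + real ?d * ln (real (fact m)) + (ln (pmf (hist k) h) - real (m * num_repeated ?n h) * ln 2)
      \<le> ln ?T + ln (class_prob k h)" by linarith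
    have "real ?d * ln (real (fact m)) = real k * ln (fact m) - real (num_repeated ?n h) * ln (fact m)"
      unfolding d left_diff_distrib by simp
    moreover have "c * real (num_repeated ?n h) = real (num_repeated ?n h) * ln (fact m) + real (m * num_repeated ?n h) * ln 2"
      by (simp add: c_def algebra_simps)
    ultimately show "- ln (class_prob k h) \<le> ((- ln (pmf (hist k) h) - entropy_pmf (insertion_pmf k h)) + c * real (num_repeated ?n h))
        + (real (num_twins ?n h) - real k - real k * ln (fact m))"
      using main entL lnT by linarith
  qed
  also have "\<dots> = E (hist k) (\<lambda>h. - ln (pmf (hist k) h)) - E (hist k) (\<lambda>h. entropy_pmf (insertion_pmf k h))
      + c * E (hist k) (\<lambda>h. real (num_repeated ?n h))
      + (E (hist k) (\<lambda>h. real (num_twins ?n h)) - real k - real k * ln (fact m))"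
    by (simp only: E_add[OF finite_hist] E_diff[OF finite_hist] E_const integral_mult_right_zero)
  also have "\<dots> \<le> E (hist k) (\<lambda>h. - ln (pmf (hist k) h)) - (\<Sum>j<k. ln (real (Suc j)) - real m)
      + c * (real m ^ 2 * (\<Sum>j<k. cubed_ratio j)) + (2 * fact m * (\<Sum>j<k. cubed_ratio j) - real k * ln (fact m))"
    using E_entropy_pmf_insertion_pmf_ge[of k] E_num_twins_le[of k] mult_left_mono[OF E_num_repeated_le[of k] c] by linarith
  finally show ?thesis by (simp add: c_def)
qed

lemma class_entropy_lower:
  "\<exists>C. \<forall>k. - C * real (Suc k) \<le> class_entropy k - (real m - 1) * real (Suc k) * ln (real (Suc k))"
proof -
  define K where "K = real m * ln (real m) + 2 * real m"
  have m1: "real m \<ge> 1" using m_pos by simp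
  have K: "K \<ge> 0" using m1 by (simp add: K_def)
  \<comment> \<open>In the constant, m - 1 comes from Stirling and m from bounding m ln n by m (n -
    1). The rest, K + ln m!, is the loss per arrival.\<close>
  have "- (2 * real m - 1 + K + ln (fact m)) * real (Suc k) \<le> class_entropy k - (real m - 1) * real (Suc k) * ln (real (Suc k))" for k
  proof -
    let ?s = "\<Sum>j<k. ln (real (Suc j))"
    have "(\<Sum>j<k. real m * ln (real (Suc j)) - K) \<le> E (hist k) (\<lambda>h. - ln (pmf (hist k) h))"
      unfolding E_neg_ln_pmf_hist
    proof (rule sum_mono)
      fix j
      have "real (Suc j) * 1 \<le> (2 * real j + 1) * real m" using m1 by (intro mult_mono) auto
      then have "ln (real (Suc j)) \<le> ln (real m * (2 * real j + 1))" by (simp add: mult.commute)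
      then have "real m * ln (real (Suc j)) \<le> real m * ln (real m * (2 * real j + 1))"
        by (intro mult_left_mono) auto
      moreover have "mean_deg_ln j / (2 * real j + 1) \<le> K" using mean_deg_ln_le[of j] by (simp add: divide_le_eq K_def)
      ultimately show "real m * ln (real (Suc j)) - K
        \<le> real m * ln (real m * (2 * real j + 1)) - mean_deg_ln j / (2 * real j + 1)" by simp
    qed
    moreover have "(\<Sum>j<k. real m * ln (real (Suc j)) - K) = real m * ?s - real k * K"
      by (simp add: sum_subtractf sum_distrib_left)
    ultimately have "real m * ?s - real k * K - ln (fact (Suc k)) - real k * ln (fact m) \<le> class_entropy k"
      using class_entropy_ge[of k] by simp
    moreover have "ln (fact (Suc k) :: real) = ?s + ln (real (Suc k))"
      using ln_fact_eq_sum[of "Suc k"] by simp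
    moreover have "(real m - 1) * (real k * ln (real (Suc k)) - real k - 1) \<le> (real m - 1) * ?s"
      using sum_ln_ge[of k] m1 by (intro mult_left_mono) auto
    moreover have "real m * ln (real (Suc k)) \<le> real m * (real (Suc k) - 1)"
      by (intro mult_left_mono ln_le_minus_one) auto
    moreover have "real k * (K + ln (fact m)) \<le> real (Suc k) * (K + ln (fact m))"
      using K fact_ge_1[of m, where 'a = real] by (intro mult_right_mono) auto
    ultimately show ?thesis by (simp add: algebra_simps)
  qed
  then show ?thesis by blast
qed

lemma class_entropy_upper:
  assumes m3: "m \<ge> 3"
  shows "\<exists>C>0. \<forall>\<^sub>F k in sequentially. class_entropy k - (real m - 1) * real (Suc k) * ln (real (Suc k)) \<le> - C * real (Suc k)"
proof -
  define c :: real where "c = (ln (fact m) + real m * ln 2) * real m ^ 2 + 2 * fact m"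
  \<comment> \<open>The losses per arrival that tend to 0: the deficit of the d ln d mean, and the
    coincidences.\<close>
  define e where "e j = 2 * real m * sqrt (real (Suc j)) / (2 * real j + 1) + c * cubed_ratio j" for j
  define g :: real where "g = real m - 1 - real m * ln 2 + ln (fact m)"
  have "g > 0"
  proof -
    \<comment> \<open>From m = 3 on, ln m! \<ge> ln 6 > 1, so the crude bound ln 2 \<le> 1 already
      gives a positive \<open>g\<close>.\<close>
    have "fact 3 \<le> (fact m :: real)" using m3 by (rule fact_mono)
    then have f6: "6 \<le> (fact m :: real)" by (simp add: fact_numeral)
    have "ln (exp 1) < ln (6 :: real)" using exp_le by (subst ln_less_cancel_iff) auto
    also have "\<dots> \<le> ln (fact m)" using f6 by simp
    finally have "1 < ln (fact m :: real)" by simp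
    moreover have "ln 2 \<le> (2::real) - 1" by (intro ln_le_minus_one) simp
    then have "real m * ln 2 \<le> real m * 1" by (intro mult_left_mono) auto
    ultimately show ?thesis by (simp add: g_def)
  qed
  have "(\<lambda>j. 2 * real m * sqrt (real (Suc j)) / (2 * real j + 1)) \<longlonglongrightarrow> 0" by real_asymp
  then have e0: "e \<longlonglongrightarrow> 0"
    unfolding e_def using tendsto_add[OF _ tendsto_mult_right_zero[OF cubed_ratio_tendsto, of c]] by fastforce
  have bound: "class_entropy k - (real m - 1) * real (Suc k) * ln (real (Suc k)) \<le> - g * real k + (\<Sum>j<k. e j)" for k
  proof -
    let ?s = "\<Sum>j<k. ln (real (Suc j))"
    have m1: "real m \<ge> 1" using m_pos by simp
    have "E (hist k) (\<lambda>h. - ln (pmf (hist k) h))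
      \<le> (\<Sum>j<k. real m * ln (real (Suc j)) + (real m * ln 2 - real m) + 2 * real m * sqrt (real (Suc j)) / (2 * real j + 1))"
      unfolding E_neg_ln_pmf_hist
    proof (rule sum_mono)
      fix j
      have "ln (real m * (2 * real j + 1)) \<le> ln (real m * (2 * real (Suc j)))"
        using m1 by (subst ln_le_cancel_iff) (auto simp: add_nonneg_pos)
      also have "\<dots> = ln (real m) + (ln 2 + ln (real (Suc j)))"
        using m1 by (simp add: ln_mult del: of_nat_Suc)
      finally have "real m * ln (real m * (2 * real j + 1)) \<le> real m * (ln (real m) + (ln 2 + ln (real (Suc j))))"
        by (intro mult_left_mono) auto
      moreover have "((real m * ln (real m) + real m) * (2 * real j + 1) - 2 * real m * sqrt (real (Suc j))) / (2 * real j + 1)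
        \<le> mean_deg_ln j / (2 * real j + 1)"
        by (intro divide_right_mono mean_deg_ln_ge) auto
      moreover have "((real m * ln (real m) + real m) * (2 * real j + 1) - 2 * real m * sqrt (real (Suc j))) / (2 * real j + 1)
        = real m * ln (real m) + real m - 2 * real m * sqrt (real (Suc j)) / (2 * real j + 1)"
        unfolding diff_divide_distrib by simp
      ultimately show "real m * ln (real m * (2 * real j + 1)) - mean_deg_ln j / (2 * real j + 1)
        \<le> real m * ln (real (Suc j)) + (real m * ln 2 - real m) + 2 * real m * sqrt (real (Suc j)) / (2 * real j + 1)"
        by (simp add: distrib_left)
    qed
    moreover have "\<dots> = real m * ?s + real k * (real m * ln 2 - real m)
        + (\<Sum>j<k. 2 * real m * sqrt (real (Suc j)) / (2 * real j + 1))"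
      by (simp only: sum.distrib sum_distrib_left sum_constant card_lessThan)
    moreover have "(\<Sum>j<k. ln (real (Suc j)) - real m) = ?s - real k * real m"
      by (simp add: sum_subtractf)
    moreover have "(\<Sum>j<k. e j) = (\<Sum>j<k. 2 * real m * sqrt (real (Suc j)) / (2 * real j + 1)) + c * (\<Sum>j<k. cubed_ratio j)"
      by (simp add: e_def sum.distrib sum_distrib_left)
    moreover have "(ln (fact m) + real m * ln 2) * (real m ^ 2 * (\<Sum>j<k. cubed_ratio j)) + 2 * fact m * (\<Sum>j<k. cubed_ratio j)
      = c * (\<Sum>j<k. cubed_ratio j)"
      by (simp add: c_def algebra_simps)
    moreover have "(real m - 1) * ?s \<le> (real m - 1) * (real (Suc k) * ln (real (Suc k)) - real k)"
      using sum_ln_le[of k] m1 by (intro mult_left_mono) auto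
    ultimately show ?thesis
      using class_entropy_le[of k] by (simp add: g_def algebra_simps)
  qed
  \<comment> \<open>Half of \<open>g\<close> pays for the sum of \<open>e\<close>; replacing k by k
    + 1 costs at most half of what is left once k \<ge> 1.\<close>
  have "\<forall>\<^sub>F k in sequentially. class_entropy k - (real m - 1) * real (Suc k) * ln (real (Suc k)) \<le> - (g / 4) * real (Suc k)"
    using eventually_sum_le_linear[OF e0 half_gt_zero[OF \<open>g > 0\<close>]] eventually_ge_at_top[of 1]
  proof eventually_elim
    case (elim k)
    then have k: "1 \<le> real k" by simp
    have "g \<le> g * real k" using mult_left_mono[OF k, of g] \<open>g > 0\<close> by simp
    moreover have "- (g / 4) * real (Suc k) = - (g * real k) / 4 - g / 4" by (simp add: algebra_simps)
    ultimately show ?case using bound[of k] elim(1) by linarith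
  qed
  then show ?thesis using \<open>g > 0\<close> by (intro exI[of _ "g / 4"]) simp
qed

end

theorem theorem2:
  fixes m :: nat and b :: real
  assumes "m \<ge> 3" and "b > 1"
  shows "\<exists>R :: nat \<Rightarrow> real.
    (\<forall>n\<ge>1. structural_entropy b (PA m n) = (real m - 1) * real n * log b (real n) + R n) \<and>
    (\<exists>C>0. \<forall>\<^sub>F n in sequentially. C * real n \<le> \<bar>R n\<bar>) \<and>
    (\<lambda>n. \<bar>R n\<bar>) \<in> O(\<lambda>n. real n * log b (log b (real n)))"
proof -
  interpret pref_attach m by unfold_locales (use assms(1) in simp)
  have lnb: "ln b > 0" using assms(2) by simp
  define R where "R n = structural_entropy b (PA m n) - (real m - 1) * real n * log b (real n)" for n
  have R: "R (Suc k) = (class_entropy k - (real m - 1) * real (Suc k) * ln (real (Suc k))) / ln b" for k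
    unfolding R_def structural_entropy_eq[OF assms(2)] by (simp add: log_def diff_divide_distrib)
  obtain C1 where C1: "C1 > 0"
    and up: "\<forall>\<^sub>F k in sequentially. class_entropy k - (real m - 1) * real (Suc k) * ln (real (Suc k)) \<le> - C1 * real (Suc k)"
    using class_entropy_upper[OF assms(1)] by blast
  obtain C2 where low: "\<And>k. - C2 * real (Suc k) \<le> class_entropy k - (real m - 1) * real (Suc k) * ln (real (Suc k))"
    using class_entropy_lower by blast
  have "\<forall>\<^sub>F k in sequentially. R (Suc k) \<le> - (C1 / ln b) * real (Suc k)"
    using up
  proof eventually_elim
    case (elim k)
    then show ?case using divide_right_mono[OF elim, of "ln b"] lnb by (simp only: R) simp
  qed
  then have upR: "\<forall>\<^sub>F n in sequentially. R n \<le> - (C1 / ln b) * real n"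
    by (subst (asm) eventually_sequentially_Suc)
  have "\<forall>\<^sub>F k in sequentially. - (C2 / ln b) * real (Suc k) \<le> R (Suc k)"
  proof (intro always_eventually allI)
    fix k
    show "- (C2 / ln b) * real (Suc k) \<le> R (Suc k)"
      using divide_right_mono[OF low[of k], of "ln b"] lnb by (simp only: R) simp
  qed
  then have lowR: "\<forall>\<^sub>F n in sequentially. - (C2 / ln b) * real n \<le> R n"
    by (subst (asm) eventually_sequentially_Suc)
  have c: "C1 / ln b > 0" using C1 lnb by simp
  have "\<forall>\<^sub>F n in sequentially. C1 / ln b * real n \<le> \<bar>R n\<bar>"
    using upR by eventually_elim linarith
  moreover have "(\<lambda>n. \<bar>R n\<bar>) \<in> O(\<lambda>n. real n * log b (log b (real n)))"
  \<comment> \<open>The remainder has exact order n, so the bound of the statement follows through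
    O(n).\<close>
  proof (rule landau_o.big_trans)
    show "(\<lambda>n. \<bar>R n\<bar>) \<in> O(\<lambda>n. real n)"
    proof (rule bigoI)
      show "\<forall>\<^sub>F n in sequentially. norm \<bar>R n\<bar> \<le> (C2 / ln b) * norm (real n)"
        using upR lowR
      proof eventually_elim
        case (elim n)
        \<comment> \<open>Then \<open>R n\<close> \<le> 0 by the upper bound, and the lower bound
          alone controls its absolute value.\<close>
        have "0 \<le> C1 / ln b * real n" by (rule mult_nonneg_nonneg) (use c in simp_all)
        then show ?case using elim by simp
      qed
    qed
    show "(\<lambda>n. real n) \<in> O(\<lambda>n. real n * log b (log b (real n)))"
      using lnb unfolding log_def by real_asymp
  qed
  ultimately show ?thesis
    using c by (intro exI[of _ R]) (auto simp: R_def)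
qed

end
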